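(* Let $R$ be a ring with unity and let $\mathcal{X}$ be a semibrick of left $R$-modules such that every $X\in\mathcal{X}$ has projective dimension at most one and $\mathcal{X}$ contains no $\mathcal{X}$-divisible objects. Then for every $Y\in\mathcal{X}$ we have $\mathrm{soc}_{\mathcal{X}}\,\bar{Y}=Y$, where $\bar{Y}=Y_{\mathcal{X}}(\infty)$ is the Prüfer module of $Y$. In particular, every Prüfer module is indecomposable.
   Context: A brick is a finitely presented left $R$-module whose endomorphism ring is a division ring. A semibrick is a class $\mathcal{X}$ of pairwise non-isomorphic bricks with $\mathrm{Hom}(X,X')=0$ for distinct $X,X'\in\mathcal{X}$. A module $M$ is $\mathcal{X}$-divisible if $\mathrm{Ext}^1(X,M)=0$ for all $X\in\mathcal{X}$. $\mathcal{X}$-universal sequences: let $Y$ be a module. For each $X\in\mathcal{X}$, $\mathrm{Ext}^1(X,Y)$ is a left $\mathrm{End}(X)$-module (acting by pull-back; compositions written from left to right). Choose a basis $(0\to Y\to M_{X,i}\to X\to 0)_{i\in I_X}$ over the division ring $\mathrm{End}(X)$. The $\mathcal{X}$-universal short exact sequence $0\to Y\to M\to\bigoplus_{X\in\mathcal{X}}X^{(I_X)}\to 0$ starting from $Y$ is the push-out of $0\to\bigoplus_{X}Y^{(I_X)}\to\bigoplus_{X,i}M_{X,i}\to\bigoplus_{X}X^{(I_X)}\to 0$ along the summation map $\bigoplus_X Y^{(I_X)}\to Y$. Define $Y_{\mathcal{X}}(1)=Y$ and let $Y_{\mathcal{X}}(i)\to Y_{\mathcal{X}}(i+1)$ be the monomorphism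 of an $\mathcal{X}$-universal sequence starting from $Y_{\mathcal{X}}(i)$; $Y_{\mathcal{X}}(\infty)$ is the direct limit, and $Y$ is viewed as a submodule of $Y_{\mathcal{X}}(\infty)$. For $Y\in\mathcal{X}$ the module $\bar{Y}=Y_{\mathcal{X}}(\infty)$ is called a Prüfer module. For a module $M$ admitting a (transfinite, continuous) filtration with consecutive factors isomorphic to modules in $\mathcal{X}$ (such as $\bar{Y}$), $\mathrm{soc}_{\mathcal{X}}M=\sum_{X\in\mathcal{X},\,f\in\mathrm{Hom}(X,M)}\mathrm{Im}\,f$. *)

theory Defs
  imports "HOL-Algebra.Module" "HOL-Algebra.AbelCoset"
begin

section \<open>Left modules over a not necessarily commutative ring\<close>

text \<open>
  The library locale \<^locale>\<open>module\<close> requires a commutative ring, so left modules are set up here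
  on the library record type. The ring fields \<^const>\<open>monoid.mult\<close> and \<^const>\<open>one\<close> of that record carry no
  meaning for a module.
\<close>

locale left_module = R?: ring R + M?: abelian_group M
  for R :: "'r ring" (structure) and M :: "('r, 'a) module" (structure) +
  assumes smult_closed [simp, intro]:
      "\<lbrakk>a \<in> carrier R; x \<in> carrier M\<rbrakk> \<Longrightarrow> a \<odot>\<^bsub>M\<^esub> x \<in> carrier M"
    and smult_l_distr:
      "\<lbrakk>a \<in> carrier R; b \<in> carrier R; x \<in> carrier M\<rbrakk> \<Longrightarrow>
        (a \<oplus>\<^bsub>R\<^esub> b) \<odot>\<^bsub>M\<^esub> x = a \<odot>\<^bsub>M\<^esub> x \<oplus>\<^bsub>M\<^esub> b \<odot>\<^bsub>M\<^esub> x"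
    and smult_r_distr:
      "\<lbrakk>a \<in> carrier R; x \<in> carrier M; y \<in> carrier M\<rbrakk> \<Longrightarrow>
        a \<odot>\<^bsub>M\<^esub> (x \<oplus>\<^bsub>M\<^esub> y) = a \<odot>\<^bsub>M\<^esub> x \<oplus>\<^bsub>M\<^esub> a \<odot>\<^bsub>M\<^esub> y"
    and smult_assoc:
      "\<lbrakk>a \<in> carrier R; b \<in> carrier R; x \<in> carrier M\<rbrakk> \<Longrightarrow>
        (a \<otimes>\<^bsub>R\<^esub> b) \<odot>\<^bsub>M\<^esub> x = a \<odot>\<^bsub>M\<^esub> (b \<odot>\<^bsub>M\<^esub> x)"
    and smult_one [simp]:
      "x \<in> carrier M \<Longrightarrow> \<one>\<^bsub>R\<^esub> \<odot>\<^bsub>M\<^esub> x = x"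

definition module_hom :: "'r ring \<Rightarrow> ('r, 'a) module \<Rightarrow> ('r, 'b) module \<Rightarrow> ('a \<Rightarrow> 'b) set" where
  "module_hom R M N =
     {f \<in> carrier M \<rightarrow> carrier N.
        (\<forall>x\<in>carrier M. \<forall>y\<in>carrier M. f (x \<oplus>\<^bsub>M\<^esub> y) = f x \<oplus>\<^bsub>N\<^esub> f y) \<and>
        (\<forall>a\<in>carrier R. \<forall>x\<in>carrier M. f (a \<odot>\<^bsub>M\<^esub> x) = a \<odot>\<^bsub>N\<^esub> f x)}"

lemma module_homD:
  assumes "f \<in> module_hom R M N"
  shows "x \<in> carrier M \<Longrightarrow> f x \<in> carrier N"
    and "x \<in> carrier M \<Longrightarrow> y \<in> carrier M \<Longrightarrow> f (x \<oplus>\<^bsub>M\<^esub> y) = f x \<oplus>\<^bsub>N\<^esub> f y"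
    and "a \<in> carrier R \<Longrightarrow> x \<in> carrier M \<Longrightarrow> f (a \<odot>\<^bsub>M\<^esub> x) = a \<odot>\<^bsub>N\<^esub> f x"
  using assms unfolding module_hom_def by auto

lemma module_hom_zero_minus:
  assumes "f \<in> module_hom R M N" "left_module R M" "left_module R N"
  shows "f \<zero>\<^bsub>M\<^esub> = \<zero>\<^bsub>N\<^esub>" and "x \<in> carrier M \<Longrightarrow> f (\<ominus>\<^bsub>M\<^esub> x) = \<ominus>\<^bsub>N\<^esub> f x"
proof -
  interpret M: left_module R M by fact
  interpret N: left_module R N by fact
  note f = module_homD[OF assms(1)]
  have "f \<zero>\<^bsub>M\<^esub> \<oplus>\<^bsub>N\<^esub> f \<zero>\<^bsub>M\<^esub> = f \<zero>\<^bsub>M\<^esub>"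
    using f(2)[of "\<zero>\<^bsub>M\<^esub>" "\<zero>\<^bsub>M\<^esub>"] by simp
  then show 0: "f \<zero>\<^bsub>M\<^esub> = \<zero>\<^bsub>N\<^esub>"
    using f(1)[of "\<zero>\<^bsub>M\<^esub>"] by (simp add: N.add.r_cancel_one)
  assume x: "x \<in> carrier M"
  have "f (\<ominus>\<^bsub>M\<^esub> x) \<oplus>\<^bsub>N\<^esub> f x = \<zero>\<^bsub>N\<^esub>"
    using f(2)[of "\<ominus>\<^bsub>M\<^esub> x" x] x 0 by (simp add: M.l_neg)
  then show "f (\<ominus>\<^bsub>M\<^esub> x) = \<ominus>\<^bsub>N\<^esub> f x"
    using f(1) x by (metis M.a_inv_closed N.minus_equality)
qed

lemma (in abelian_group) minus_zero_imp_eq: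
  "\<lbrakk>x \<in> carrier G; y \<in> carrier G; x \<ominus> y = \<zero>\<rbrakk> \<Longrightarrow> x = y"
  using minus_equality[of x "\<ominus> y"] by (simp add: a_minus_def)

definition module_iso :: "'r ring \<Rightarrow> ('r, 'a) module \<Rightarrow> ('r, 'b) module \<Rightarrow> ('a \<Rightarrow> 'b) set" where
  "module_iso R M N = {f \<in> module_hom R M N. bij_betw f (carrier M) (carrier N)}"

definition hom_zero :: "'r ring \<Rightarrow> ('r, 'a) module \<Rightarrow> ('r, 'b) module \<Rightarrow> bool" where
  "hom_zero R M N \<longleftrightarrow> (\<forall>f\<in>module_hom R M N. \<forall>x\<in>carrier M. f x = \<zero>\<^bsub>N\<^esub>)"

definition short_exact ::
  "'r ring \<Rightarrow> ('r, 'a) module \<Rightarrow> ('a \<Rightarrow> 'b) \<Rightarrow> ('r, 'b) module \<Rightarrow> ('b \<Rightarrow> 'c) \<Rightarrow> ('r, 'c) module \<Rightarrow> bool"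
where
  "short_exact R A f B g C \<longleftrightarrow>
     left_module R A \<and> left_module R B \<and> left_module R C \<and>
     f \<in> module_hom R A B \<and> g \<in> module_hom R B C \<and>
     inj_on f (carrier A) \<and> g ` carrier B = carrier C \<and>
     f ` carrier A = a_kernel B C g"

definition indecomposable :: "'r ring \<Rightarrow> ('r, 'a) module \<Rightarrow> bool" where
  "indecomposable R M \<longleftrightarrow>
     carrier M \<noteq> {\<zero>\<^bsub>M\<^esub>} \<and>
     (\<forall>A B. submodule A R M \<and> submodule B R M \<and>
        A \<inter> B = {\<zero>\<^bsub>M\<^esub>} \<and> A <+>\<^bsub>M\<^esub> B = carrier M \<longrightarrow>
        A = {\<zero>\<^bsub>M\<^esub>} \<or> B = {\<zero>\<^bsub>M\<^esub>})"


section \<open>Direct sums, fibre products, push-outs and direct limits\<close>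

definition direct_sum :: "'i set \<Rightarrow> ('i \<Rightarrow> ('r, 'a) module) \<Rightarrow> ('r, 'i \<Rightarrow> 'a) module" where
  "direct_sum I M =
     \<lparr>carrier = {f \<in> (\<Pi>\<^sub>E i\<in>I. carrier (M i)). finite {i \<in> I. f i \<noteq> \<zero>\<^bsub>M i\<^esub>}},
      mult = undefined, one = undefined,
      zero = (\<lambda>i\<in>I. \<zero>\<^bsub>M i\<^esub>),
      add = (\<lambda>f g. \<lambda>i\<in>I. f i \<oplus>\<^bsub>M i\<^esub> g i),
      smult = (\<lambda>a f. \<lambda>i\<in>I. a \<odot>\<^bsub>M i\<^esub> f i)\<rparr>"

definition direct_sum_map :: "'i set \<Rightarrow> ('i \<Rightarrow> 'a \<Rightarrow> 'b) \<Rightarrow> ('i \<Rightarrow> 'a) \<Rightarrow> ('i \<Rightarrow> 'b)" where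
  "direct_sum_map I h f = (\<lambda>i\<in>I. h i (f i))"

definition summation :: "'i set \<Rightarrow> ('r, 'a) module \<Rightarrow> ('i \<Rightarrow> 'a) \<Rightarrow> 'a" where
  "summation I M f = finsum M f {i \<in> I. f i \<noteq> \<zero>\<^bsub>M\<^esub>}"

definition regular_module :: "'r ring \<Rightarrow> ('r, 'r) module" where
  "regular_module R =
     \<lparr>carrier = carrier R, mult = undefined, one = undefined,
      zero = \<zero>\<^bsub>R\<^esub>, add = add R, smult = monoid.mult R\<rparr>"

definition free_module :: "'r ring \<Rightarrow> 'i set \<Rightarrow> ('r, 'i \<Rightarrow> 'r) module" where
  "free_module R I = direct_sum I (\<lambda>_. regular_module R)"

definition fibre_product ::
  "('r, 'a) module \<Rightarrow> ('a \<Rightarrow> 'c) \<Rightarrow> ('r, 'b) module \<Rightarrow> ('b \<Rightarrow> 'c) \<Rightarrow> ('r, 'a \<times> 'b) module"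
where
  "fibre_product A f B g =
     \<lparr>carrier = {(a, b). a \<in> carrier A \<and> b \<in> carrier B \<and> f a = g b},
      mult = undefined, one = undefined,
      zero = (\<zero>\<^bsub>A\<^esub>, \<zero>\<^bsub>B\<^esub>),
      add = (\<lambda>(a, b) (a', b'). (a \<oplus>\<^bsub>A\<^esub> a', b \<oplus>\<^bsub>B\<^esub> b')),
      smult = (\<lambda>r (a, b). (r \<odot>\<^bsub>A\<^esub> a, r \<odot>\<^bsub>B\<^esub> b))\<rparr>"

text \<open>
  \<open>P\<close> with \<open>p : B \<rightarrow> P\<close> and \<open>q : C \<rightarrow> P\<close> is a push-out of \<open>f : A \<rightarrow> B\<close> and \<open>g : A \<rightarrow> C\<close>: the map
  \<open>(b, c) \<mapsto> p b + q c\<close> presents \<open>P\<close> as the quotient of \<open>B \<oplus> C\<close> by \<open>{(f a, - g a) | a \<in> A}\<close>.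
  A universal property quantifying over test modules would have to fix their carrier type;
  lemma \<open>is_pushout_universal\<close> below derives it for all types.
\<close>

definition is_pushout ::
  "'r ring \<Rightarrow> ('r, 'a) module \<Rightarrow> ('r, 'b) module \<Rightarrow> ('r, 'c) module \<Rightarrow> ('a \<Rightarrow> 'b) \<Rightarrow> ('a \<Rightarrow> 'c) \<Rightarrow>
   ('r, 'd) module \<Rightarrow> ('b \<Rightarrow> 'd) \<Rightarrow> ('c \<Rightarrow> 'd) \<Rightarrow> bool"
where
  "is_pushout R A B C f g P p q \<longleftrightarrow>
     left_module R P \<and> p \<in> module_hom R B P \<and> q \<in> module_hom R C P \<and>
     carrier P = {p b \<oplus>\<^bsub>P\<^esub> q c | b c. b \<in> carrier B \<and> c \<in> carrier C} \<and>
     (\<forall>b\<in>carrier B. \<forall>c\<in>carrier C.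
        p b \<oplus>\<^bsub>P\<^esub> q c = \<zero>\<^bsub>P\<^esub> \<longleftrightarrow> (\<exists>a\<in>carrier A. b = f a \<and> c = \<ominus>\<^bsub>C\<^esub> g a))"

lemma is_pushout_commutes:
  assumes po: "is_pushout R A B C f g P p q"
    and mods: "left_module R A" "left_module R B" "left_module R C"
    and f: "f \<in> module_hom R A B" and g: "g \<in> module_hom R A C" and a: "a \<in> carrier A"
  shows "p (f a) = q (g a)"
proof -
  interpret C: left_module R C by fact
  interpret P: left_module R P using po by (simp add: is_pushout_def)
  have p: "p \<in> module_hom R B P" and q: "q \<in> module_hom R C P"
    using po by (simp_all add: is_pushout_def)
  note hs = module_homD(1)[OF f a] module_homD(1)[OF g a]
  have "p (f a) \<oplus>\<^bsub>P\<^esub> q (\<ominus>\<^bsub>C\<^esub> g a) = \<zero>\<^bsub>P\<^esub>"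
    using hs a conjunct2[OF conjunct2[OF conjunct2[OF conjunct2[OF po[unfolded is_pushout_def]]]]]
    by auto
  then have "p (f a) \<ominus>\<^bsub>P\<^esub> q (g a) = \<zero>\<^bsub>P\<^esub>"
    using hs by (simp add: a_minus_def module_hom_zero_minus(2)[OF q mods(3) P.left_module_axioms])
  then show ?thesis
    using hs by - (rule P.minus_zero_imp_eq, simp_all add: module_homD(1)[OF p] module_homD(1)[OF q])
qed

lemma is_pushout_universal:
  assumes po: "is_pushout R A B C f g P p q"
    and mods: "left_module R A" "left_module R B" "left_module R C" "left_module R T"
    and f: "f \<in> module_hom R A B" and g: "g \<in> module_hom R A C"
    and s: "s \<in> module_hom R B T" and t: "t \<in> module_hom R C T"
    and st: "\<And>a. a \<in> carrier A \<Longrightarrow> s (f a) = t (g a)"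
  shows "\<exists>!h. h \<in> module_hom R P T \<inter> extensional (carrier P) \<and>
           (\<forall>b\<in>carrier B. h (p b) = s b) \<and> (\<forall>c\<in>carrier C. h (q c) = t c)"
proof -
  interpret A: left_module R A by fact
  interpret B: left_module R B by fact
  interpret C: left_module R C by fact
  interpret T: left_module R T by fact
  interpret P: left_module R P using po by (simp add: is_pushout_def)
  have p: "p \<in> module_hom R B P" and q: "q \<in> module_hom R C P"
    and surj: "\<And>z. z \<in> carrier P \<Longrightarrow> \<exists>b\<in>carrier B. \<exists>c\<in>carrier C. z = p b \<oplus>\<^bsub>P\<^esub> q c"
    and ker: "\<And>b c. \<lbrakk>b \<in> carrier B; c \<in> carrier C; p b \<oplus>\<^bsub>P\<^esub> q c = \<zero>\<^bsub>P\<^esub>\<rbrakk> \<Longrightarrow>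
                \<exists>a\<in>carrier A. b = f a \<and> c = \<ominus>\<^bsub>C\<^esub> g a"
    using po unfolding is_pushout_def by blast+
  note hs = module_homD[OF f] module_homD[OF g] module_homD[OF s] module_homD[OF t]
    module_homD[OF p] module_homD[OF q]
  note zs = module_hom_zero_minus[OF s mods(2,4)] module_hom_zero_minus[OF t mods(3,4)]
    module_hom_zero_minus[OF p mods(2) P.left_module_axioms]
    module_hom_zero_minus[OF q mods(3) P.left_module_axioms]
  have wd: "s b \<oplus>\<^bsub>T\<^esub> t c = s b' \<oplus>\<^bsub>T\<^esub> t c'"
    if b: "b \<in> carrier B" "b' \<in> carrier B" and c: "c \<in> carrier C" "c' \<in> carrier C"
      and eq: "p b \<oplus>\<^bsub>P\<^esub> q c = p b' \<oplus>\<^bsub>P\<^esub> q c'" for b b' c c'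
  proof -
    have "p (b \<ominus>\<^bsub>B\<^esub> b') \<oplus>\<^bsub>P\<^esub> q (c \<ominus>\<^bsub>C\<^esub> c') = (p b \<oplus>\<^bsub>P\<^esub> q c) \<ominus>\<^bsub>P\<^esub> (p b' \<oplus>\<^bsub>P\<^esub> q c')"
      using b c by (simp add: a_minus_def hs zs P.minus_add P.a_ac)
    also have "\<dots> = \<zero>\<^bsub>P\<^esub>" using b c by (simp add: eq hs P.r_neg a_minus_def)
    finally obtain a where a: "a \<in> carrier A" "b \<ominus>\<^bsub>B\<^esub> b' = f a" "c \<ominus>\<^bsub>C\<^esub> c' = \<ominus>\<^bsub>C\<^esub> g a"
      using ker[of "b \<ominus>\<^bsub>B\<^esub> b'" "c \<ominus>\<^bsub>C\<^esub> c'"] b c by auto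
    have "(s b \<oplus>\<^bsub>T\<^esub> t c) \<ominus>\<^bsub>T\<^esub> (s b' \<oplus>\<^bsub>T\<^esub> t c') = s (b \<ominus>\<^bsub>B\<^esub> b') \<oplus>\<^bsub>T\<^esub> t (c \<ominus>\<^bsub>C\<^esub> c')"
      using b c by (simp add: a_minus_def hs zs T.minus_add T.a_ac)
    also have "\<dots> = \<zero>\<^bsub>T\<^esub>" using a(1) by (simp add: a(2,3) zs hs st T.r_neg)
    finally show ?thesis using b c by - (rule T.minus_zero_imp_eq, simp_all add: hs)
  qed
  define h where "h = (\<lambda>z\<in>carrier P. THE w. \<exists>b\<in>carrier B. \<exists>c\<in>carrier C. z = p b \<oplus>\<^bsub>P\<^esub> q c \<and> w = s b \<oplus>\<^bsub>T\<^esub> t c)"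
  have h: "h (p b \<oplus>\<^bsub>P\<^esub> q c) = s b \<oplus>\<^bsub>T\<^esub> t c" if "b \<in> carrier B" "c \<in> carrier C" for b c
  proof -
    have "(THE w. \<exists>b'\<in>carrier B. \<exists>c'\<in>carrier C. p b \<oplus>\<^bsub>P\<^esub> q c = p b' \<oplus>\<^bsub>P\<^esub> q c' \<and> w = s b' \<oplus>\<^bsub>T\<^esub> t c') = s b \<oplus>\<^bsub>T\<^esub> t c"
    proof (rule the_equality)
      fix w assume "\<exists>b'\<in>carrier B. \<exists>c'\<in>carrier C. p b \<oplus>\<^bsub>P\<^esub> q c = p b' \<oplus>\<^bsub>P\<^esub> q c' \<and> w = s b' \<oplus>\<^bsub>T\<^esub> t c'"
      then obtain b' c' where b': "b' \<in> carrier B" "c' \<in> carrier C"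
        "p b \<oplus>\<^bsub>P\<^esub> q c = p b' \<oplus>\<^bsub>P\<^esub> q c'" "w = s b' \<oplus>\<^bsub>T\<^esub> t c'"
        by (elim bexE conjE)
      show "w = s b \<oplus>\<^bsub>T\<^esub> t c"
        unfolding b'(4) by (rule wd[OF that(1) b'(1) that(2) b'(2,3), symmetric])
    qed (rule bexI[OF _ that(1)], rule bexI[OF _ that(2)], simp)
    then show ?thesis using that by (simp add: h_def hs)
  qed
  have hh: "h \<in> module_hom R P T"
    unfolding module_hom_def
  proof (intro CollectI conjI ballI Pi_I)
    fix x assume "x \<in> carrier P"
    then obtain b c where x: "b \<in> carrier B" "c \<in> carrier C" "x = p b \<oplus>\<^bsub>P\<^esub> q c" using surj by blast
    then show "h x \<in> carrier T" by (simp add: h hs)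
    { fix y assume "y \<in> carrier P"
      then obtain b' c' where y: "b' \<in> carrier B" "c' \<in> carrier C" "y = p b' \<oplus>\<^bsub>P\<^esub> q c'" using surj by blast
      have "x \<oplus>\<^bsub>P\<^esub> y = p (b \<oplus>\<^bsub>B\<^esub> b') \<oplus>\<^bsub>P\<^esub> q (c \<oplus>\<^bsub>C\<^esub> c')"
        using x y by (simp add: hs P.a_ac)
      then have "h (x \<oplus>\<^bsub>P\<^esub> y) = s (b \<oplus>\<^bsub>B\<^esub> b') \<oplus>\<^bsub>T\<^esub> t (c \<oplus>\<^bsub>C\<^esub> c')"
        using h[of "b \<oplus>\<^bsub>B\<^esub> b'" "c \<oplus>\<^bsub>C\<^esub> c'"] x(1,2) y(1,2) by simp
      also have "\<dots> = h x \<oplus>\<^bsub>T\<^esub> h y"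
        unfolding x(3) y(3) using x(1,2) y(1,2) by (simp add: h hs T.a_ac)
      finally show "h (x \<oplus>\<^bsub>P\<^esub> y) = h x \<oplus>\<^bsub>T\<^esub> h y" . }
    fix a assume a: "a \<in> carrier R"
    have "a \<odot>\<^bsub>P\<^esub> x = p (a \<odot>\<^bsub>B\<^esub> b) \<oplus>\<^bsub>P\<^esub> q (a \<odot>\<^bsub>C\<^esub> c)"
      using x a by (simp add: hs P.smult_r_distr)
    then have "h (a \<odot>\<^bsub>P\<^esub> x) = s (a \<odot>\<^bsub>B\<^esub> b) \<oplus>\<^bsub>T\<^esub> t (a \<odot>\<^bsub>C\<^esub> c)"
      using h[of "a \<odot>\<^bsub>B\<^esub> b" "a \<odot>\<^bsub>C\<^esub> c"] x(1,2) a by simp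
    also have "\<dots> = a \<odot>\<^bsub>T\<^esub> h x"
      unfolding x(3) using x(1,2) a by (simp add: h hs T.smult_r_distr)
    finally show "h (a \<odot>\<^bsub>P\<^esub> x) = a \<odot>\<^bsub>T\<^esub> h x" .
  qed
  show ?thesis
  proof (rule ex1I[of _ h])
    have "h (p b) = s b" if "b \<in> carrier B" for b
      using h[of b "\<zero>\<^bsub>C\<^esub>"] that by (simp add: zs hs)
    moreover have "h (q c) = t c" if "c \<in> carrier C" for c
      using h[of "\<zero>\<^bsub>B\<^esub>" c] that by (simp add: zs hs)
    ultimately show "h \<in> module_hom R P T \<inter> extensional (carrier P) \<and>
           (\<forall>b\<in>carrier B. h (p b) = s b) \<and> (\<forall>c\<in>carrier C. h (q c) = t c)"
      using hh by (simp add: h_def)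
  next
    fix k assume k: "k \<in> module_hom R P T \<inter> extensional (carrier P) \<and>
           (\<forall>b\<in>carrier B. k (p b) = s b) \<and> (\<forall>c\<in>carrier C. k (q c) = t c)"
    have "k z = h z" if z: "z \<in> carrier P" for z
    proof -
      obtain b c where x: "b \<in> carrier B" "c \<in> carrier C" "z = p b \<oplus>\<^bsub>P\<^esub> q c" using surj z by blast
      then show ?thesis using k module_homD(2)[of k R P T "p b" "q c"] by (simp add: h hs)
    qed
    then show "k = h" using k by (intro extensionalityI[of _ "carrier P"]) (auto simp: h_def)
  qed
qed

fun tower_map :: "(nat \<Rightarrow> 'a \<Rightarrow> 'a) \<Rightarrow> nat \<Rightarrow> nat \<Rightarrow> 'a \<Rightarrow> 'a" where
  "tower_map u n 0 x = x"
| "tower_map u n (Suc k) x = u (n + k) (tower_map u n k x)"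

text \<open>
  \<open>P\<close> with the maps \<open>c n : M n \<rightarrow> P\<close> is a direct limit of \<open>M 0 \<rightarrow> M 1 \<rightarrow> \<dots>\<close> with transition maps
  \<open>u n : M n \<rightarrow> M (n + 1)\<close>; see \<open>is_direct_limit_universal\<close> for the universal property.
\<close>

definition is_direct_limit ::
  "'r ring \<Rightarrow> (nat \<Rightarrow> ('r, 'a) module) \<Rightarrow> (nat \<Rightarrow> 'a \<Rightarrow> 'a) \<Rightarrow> ('r, 'b) module \<Rightarrow> (nat \<Rightarrow> 'a \<Rightarrow> 'b) \<Rightarrow> bool"
where
  "is_direct_limit R M u P c \<longleftrightarrow>
     left_module R P \<and>
     (\<forall>n. c n \<in> module_hom R (M n) P) \<and>
     (\<forall>n. \<forall>x\<in>carrier (M n). c (Suc n) (u n x) = c n x) \<and>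
     carrier P = (\<Union>n. c n ` carrier (M n)) \<and>
     (\<forall>n. \<forall>x\<in>carrier (M n). c n x = \<zero>\<^bsub>P\<^esub> \<longrightarrow> (\<exists>k. tower_map u n k x = \<zero>\<^bsub>M (n + k)\<^esub>))"

lemma is_direct_limit_universal:
  assumes dl: "is_direct_limit R M u P c"
    and mods: "\<And>n. left_module R (M n)" "left_module R T"
    and u: "\<And>n. u n \<in> module_hom R (M n) (M (Suc n))"
    and t: "\<And>n. t n \<in> module_hom R (M n) T"
    and tu: "\<And>n x. x \<in> carrier (M n) \<Longrightarrow> t (Suc n) (u n x) = t n x"
  shows "\<exists>!h. h \<in> module_hom R P T \<inter> extensional (carrier P) \<and>
           (\<forall>n. \<forall>x\<in>carrier (M n). h (c n x) = t n x)"
proof -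
  interpret T: left_module R T by fact
  interpret P: left_module R P using dl by (simp add: is_direct_limit_def)
  have c: "\<And>n. c n \<in> module_hom R (M n) P"
    and cu: "\<And>n x. x \<in> carrier (M n) \<Longrightarrow> c (Suc n) (u n x) = c n x"
    and surj: "carrier P = (\<Union>n. c n ` carrier (M n))"
    and ker: "\<And>n x. \<lbrakk>x \<in> carrier (M n); c n x = \<zero>\<^bsub>P\<^esub>\<rbrakk> \<Longrightarrow> \<exists>k. tower_map u n k x = \<zero>\<^bsub>M (n + k)\<^esub>"
    using dl unfolding is_direct_limit_def by (elim conjE; simp)+
  note hs = module_homD[OF t] module_homD[OF c]
  have up: "tower_map u n k x \<in> carrier (M (n + k)) \<and> t (n + k) (tower_map u n k x) = t n x \<and>
      c (n + k) (tower_map u n k x) = c n x" if "x \<in> carrier (M n)" for n k x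
    using that by (induction k) (auto simp: tu cu module_homD(1)[OF u])
  have lift: "\<exists>y\<in>carrier (M m). c m y = c n x \<and> t m y = t n x" if "x \<in> carrier (M n)" "n \<le> m" for n m x
    using up[OF that(1), of "m - n"] that(2) by auto
  have wd0: "t n x = \<zero>\<^bsub>T\<^esub>" if "x \<in> carrier (M n)" "c n x = \<zero>\<^bsub>P\<^esub>" for n x
  proof -
    note prem = that
    obtain k where "tower_map u n k x = \<zero>\<^bsub>M (n + k)\<^esub>"
      using ker[OF prem] by (elim exE)
    then show ?thesis
      using up[OF prem(1), of k] module_hom_zero_minus(1)[OF t mods(1,2), of "n + k"] by simp
  qed
  have wd1: "t n x = t n y" if x: "x \<in> carrier (M n)" and y: "y \<in> carrier (M n)" and eq: "c n x = c n y" for n x y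
  proof -
    interpret M: left_module R "M n" by (rule mods)
    have "c n (x \<ominus>\<^bsub>M n\<^esub> y) = \<zero>\<^bsub>P\<^esub>"
      using x y eq by (simp add: a_minus_def hs module_hom_zero_minus(2)[OF c mods(1) P.left_module_axioms] P.r_neg)
    then have "t n (x \<ominus>\<^bsub>M n\<^esub> y) = \<zero>\<^bsub>T\<^esub>" using wd0 x y by simp
    then have "t n x \<ominus>\<^bsub>T\<^esub> t n y = \<zero>\<^bsub>T\<^esub>"
      using x y by (simp add: a_minus_def hs module_hom_zero_minus(2)[OF t mods(1,2)])
    then show ?thesis using x y by - (rule T.minus_zero_imp_eq, simp_all add: hs)
  qed
  have wd: "t n x = t m y" if "x \<in> carrier (M n)" "y \<in> carrier (M m)" "c n x = c m y" for n m x y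
  proof -
    note prem = that
    obtain x' where x': "x' \<in> carrier (M (max n m))" "c (max n m) x' = c n x" "t (max n m) x' = t n x"
      using lift[OF prem(1), of "max n m"] by auto
    obtain y' where y': "y' \<in> carrier (M (max n m))" "c (max n m) y' = c m y" "t (max n m) y' = t m y"
      using lift[OF prem(2), of "max n m"] by auto
    show ?thesis using wd1[OF x'(1) y'(1)] x' y' prem(3) by simp
  qed
  define h where "h = (\<lambda>z\<in>carrier P. THE w. \<exists>n. \<exists>x\<in>carrier (M n). z = c n x \<and> w = t n x)"
  have h: "h (c n x) = t n x" if "x \<in> carrier (M n)" for n x
  proof -
    have "(THE w. \<exists>m. \<exists>y\<in>carrier (M m). c n x = c m y \<and> w = t m y) = t n x"
    proof (rule the_equality)
      fix w assume "\<exists>m. \<exists>y\<in>carrier (M m). c n x = c m y \<and> w = t m y"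
      then obtain m y where y: "y \<in> carrier (M m)" "c n x = c m y" "w = t m y"
        by (elim exE bexE conjE)
      show "w = t n x"
        unfolding y(3) by (rule wd[OF that y(1,2), symmetric])
    qed (rule exI[of _ n], rule bexI[OF _ that], simp)
    then show ?thesis using that by (simp add: h_def hs)
  qed
  have hh: "h \<in> module_hom R P T"
    unfolding module_hom_def
  proof (intro CollectI conjI ballI Pi_I)
    fix x assume "x \<in> carrier P"
    then obtain n x' where x: "x' \<in> carrier (M n)" "x = c n x'" using surj by blast
    then show "h x \<in> carrier T" by (simp add: h hs)
    { fix y assume "y \<in> carrier P"
      then obtain m y' where y: "y' \<in> carrier (M m)" "y = c m y'" using surj by blast
      obtain x'' where x'': "x'' \<in> carrier (M (max n m))" "c (max n m) x'' = x"
        using lift[OF x(1), of "max n m"] x(2) by auto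
      obtain y'' where y'': "y'' \<in> carrier (M (max n m))" "c (max n m) y'' = y"
        using lift[OF y(1), of "max n m"] y(2) by auto
      interpret M: left_module R "M (max n m)" by (rule mods)
      have "x \<oplus>\<^bsub>P\<^esub> y = c (max n m) (x'' \<oplus>\<^bsub>M (max n m)\<^esub> y'')" using x'' y'' by (simp add: hs)
      then have "h (x \<oplus>\<^bsub>P\<^esub> y) = t (max n m) (x'' \<oplus>\<^bsub>M (max n m)\<^esub> y'')"
        using h[of "x'' \<oplus>\<^bsub>M (max n m)\<^esub> y''" "max n m"] x''(1) y''(1) by simp
      also have "\<dots> = t (max n m) x'' \<oplus>\<^bsub>T\<^esub> t (max n m) y''"
        by (rule module_homD(2)[OF t x''(1) y''(1)])
      finally show "h (x \<oplus>\<^bsub>P\<^esub> y) = h x \<oplus>\<^bsub>T\<^esub> h y"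
        using h[OF x''(1)] h[OF y''(1)] x''(2) y''(2) by simp }
    fix a assume a: "a \<in> carrier R"
    interpret M: left_module R "M n" by (rule mods)
    have "a \<odot>\<^bsub>P\<^esub> x = c n (a \<odot>\<^bsub>M n\<^esub> x')" using x a by (simp add: hs)
    then have "h (a \<odot>\<^bsub>P\<^esub> x) = t n (a \<odot>\<^bsub>M n\<^esub> x')"
      using h[of "a \<odot>\<^bsub>M n\<^esub> x'" n] x(1) a by simp
    then show "h (a \<odot>\<^bsub>P\<^esub> x) = a \<odot>\<^bsub>T\<^esub> h x"
      using h[OF x(1)] x a module_homD(3)[OF t a x(1)] by simp
  qed
  show ?thesis
  proof (rule ex1I[of _ h])
    show "h \<in> module_hom R P T \<inter> extensional (carrier P) \<and>
           (\<forall>n. \<forall>x\<in>carrier (M n). h (c n x) = t n x)"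
      using hh h by (simp add: h_def)
  next
    fix k assume k: "k \<in> module_hom R P T \<inter> extensional (carrier P) \<and>
           (\<forall>n. \<forall>x\<in>carrier (M n). k (c n x) = t n x)"
    have "k z = h z" if z: "z \<in> carrier P" for z
      using z k h unfolding surj by auto
    then show "k = h" using k by (intro extensionalityI[of _ "carrier P"]) (auto simp: h_def)
  qed
qed


section \<open>Finite presentation and projective dimension\<close>

definition finitely_presented :: "'r ring \<Rightarrow> ('r, 'a) module \<Rightarrow> bool" where
  "finitely_presented R M \<longleftrightarrow>
     left_module R M \<and>
     (\<exists>(m::nat) (n::nat) h g.
        h \<in> module_hom R (free_module R {..<m}) (free_module R {..<n}) \<and>
        g \<in> module_hom R (free_module R {..<n}) M \<and>
        g ` carrier (free_module R {..<n}) = carrier M \<and>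
        h ` carrier (free_module R {..<m}) = a_kernel (free_module R {..<n}) M g)"

text \<open>
  The carrier types of the test modules are no restriction: the free module on the carrier of \<open>P\<close>
  has carrier type \<open>'a \<Rightarrow> 'r\<close> and maps onto \<open>P\<close>, and lifting the identity of \<open>P\<close> along this map makes
  \<open>P\<close> a direct summand of a free module.
\<close>

definition projective :: "'r ring \<Rightarrow> ('r, 'a) module \<Rightarrow> bool" where
  "projective R P \<longleftrightarrow>
     left_module R P \<and>
     (\<forall>(B :: ('r, 'a \<Rightarrow> 'r) module) (C :: ('r, 'a) module) g f.
        left_module R B \<and> left_module R C \<and>
        g \<in> module_hom R B C \<and> g ` carrier B = carrier C \<and> f \<in> module_hom R P C \<longrightarrow>
        (\<exists>h\<in>module_hom R P B. \<forall>x\<in>carrier P. g (h x) = f x))"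

text \<open>
  Again the carrier type is no restriction: the free module on the carrier of \<open>M\<close> has carrier type
  \<open>'a \<Rightarrow> 'r\<close>, and by Schanuel's lemma the kernel of its canonical map onto \<open>M\<close> is projective as soon
  as some projective resolution of length at most one exists.
\<close>

definition proj_dim_le_one :: "'r ring \<Rightarrow> ('r, 'a) module \<Rightarrow> bool" where
  "proj_dim_le_one R M \<longleftrightarrow>
     (\<exists>(P1 :: ('r, 'a \<Rightarrow> 'r) module) (P0 :: ('r, 'a \<Rightarrow> 'r) module) f g.
        projective R P1 \<and> projective R P0 \<and> short_exact R P1 f P0 g M)"


section \<open>Endomorphism rings and bases\<close>

text \<open>Compositions are written from left to right: the product of \<open>f\<close> and \<open>g\<close> applies \<open>f\<close> first.\<close>

definition End_ring :: "'r ring \<Rightarrow> ('r, 'a) module \<Rightarrow> ('a \<Rightarrow> 'a) ring" where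
  "End_ring R M =
     \<lparr>carrier = module_hom R M M \<inter> extensional (carrier M),
      mult = (\<lambda>f g. compose (carrier M) g f),
      one = (\<lambda>x\<in>carrier M. x),
      zero = (\<lambda>x\<in>carrier M. \<zero>\<^bsub>M\<^esub>),
      add = (\<lambda>f g. \<lambda>x\<in>carrier M. f x \<oplus>\<^bsub>M\<^esub> g x)\<rparr>"

definition division_ring :: "'k ring \<Rightarrow> bool" where
  "division_ring K \<longleftrightarrow> ring K \<and> \<one>\<^bsub>K\<^esub> \<noteq> \<zero>\<^bsub>K\<^esub> \<and> Units K = carrier K - {\<zero>\<^bsub>K\<^esub>}"

definition is_basis :: "'k ring \<Rightarrow> ('k, 'v) module \<Rightarrow> 'i set \<Rightarrow> ('i \<Rightarrow> 'v) \<Rightarrow> bool" where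
  "is_basis K V I b \<longleftrightarrow>
     b \<in> I \<rightarrow> carrier V \<and>
     (\<forall>v\<in>carrier V. \<exists>!c. c \<in> (\<Pi>\<^sub>E i\<in>I. carrier K) \<and> finite {i \<in> I. c i \<noteq> \<zero>\<^bsub>K\<^esub>} \<and>
        v = finsum V (\<lambda>i. c i \<odot>\<^bsub>V\<^esub> b i) {i \<in> I. c i \<noteq> \<zero>\<^bsub>K\<^esub>})"


section \<open>Extensions and \<open>Ext\<^sup>1\<close>\<close>

text \<open>
  An extension of \<open>X\<close> by \<open>Y\<close> is a short exact sequence \<open>0 \<rightarrow> Y \<rightarrow> E \<rightarrow> X \<rightarrow> 0\<close>, given as a triple of \<open>E\<close>
  and the two maps. As a set, \<open>E\<close> is in bijection with \<open>Y \<times> X\<close>, so every extension is equivalent to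
  one whose middle term has carrier type \<open>'y \<times> 'x\<close>.
\<close>

type_synonym ('r, 'y, 'x) extn =
  "('r, 'y \<times> 'x) module \<times> ('y \<Rightarrow> 'y \<times> 'x) \<times> ('y \<times> 'x \<Rightarrow> 'x)"

definition mid :: "('r, 'y, 'x) extn \<Rightarrow> ('r, 'y \<times> 'x) module" where
  "mid \<xi> = fst \<xi>"

definition incl :: "('r, 'y, 'x) extn \<Rightarrow> 'y \<Rightarrow> 'y \<times> 'x" where
  "incl \<xi> = fst (snd \<xi>)"

definition proj :: "('r, 'y, 'x) extn \<Rightarrow> 'y \<times> 'x \<Rightarrow> 'x" where
  "proj \<xi> = snd (snd \<xi>)"

definition extensions :: "'r ring \<Rightarrow> ('r, 'x) module \<Rightarrow> ('r, 'y) module \<Rightarrow> ('r, 'y, 'x) extn set" where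
  "extensions R X Y = {\<xi>. short_exact R Y (incl \<xi>) (mid \<xi>) (proj \<xi>) X}"

definition ext_equiv ::
  "'r ring \<Rightarrow> ('r, 'y) module \<Rightarrow> ('r, 'y, 'x) extn \<Rightarrow> ('r, 'y, 'x) extn \<Rightarrow> bool"
where
  "ext_equiv R Y \<xi> \<xi>' \<longleftrightarrow>
     (\<exists>h\<in>module_hom R (mid \<xi>) (mid \<xi>').
        (\<forall>y\<in>carrier Y. h (incl \<xi> y) = incl \<xi>' y) \<and>
        (\<forall>e\<in>carrier (mid \<xi>). proj \<xi>' (h e) = proj \<xi> e))"

definition ext_class ::
  "'r ring \<Rightarrow> ('r, 'x) module \<Rightarrow> ('r, 'y) module \<Rightarrow> ('r, 'y, 'x) extn \<Rightarrow> ('r, 'y, 'x) extn set"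
where
  "ext_class R X Y \<xi> = {\<xi>' \<in> extensions R X Y. ext_equiv R Y \<xi> \<xi>'}"

definition splits :: "'r ring \<Rightarrow> ('r, 'x) module \<Rightarrow> ('r, 'y, 'x) extn \<Rightarrow> bool" where
  "splits R X \<xi> \<longleftrightarrow> (\<exists>s\<in>module_hom R X (mid \<xi>). \<forall>x\<in>carrier X. proj \<xi> (s x) = x)"

text \<open>
  \<open>\<xi>\<close> is a Baer sum of \<open>\<xi>\<^sub>1\<close> and \<open>\<xi>\<^sub>2\<close>: its middle term is, via \<open>h\<close>, the quotient of the fibre product
  \<open>E\<^sub>1 \<times>\<^sub>X E\<^sub>2\<close> by the submodule of all \<open>(i\<^sub>1 y, - i\<^sub>2 y)\<close>, with the induced maps.
\<close>

definition is_baer_sum ::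
  "'r ring \<Rightarrow> ('r, 'y) module \<Rightarrow>
   ('r, 'y, 'x) extn \<Rightarrow> ('r, 'y, 'x) extn \<Rightarrow> ('r, 'y, 'x) extn \<Rightarrow> bool"
where
  "is_baer_sum R Y \<xi>\<^sub>1 \<xi>\<^sub>2 \<xi> \<longleftrightarrow>
     (let F = fibre_product (mid \<xi>\<^sub>1) (proj \<xi>\<^sub>1) (mid \<xi>\<^sub>2) (proj \<xi>\<^sub>2) in
      \<exists>h\<in>module_hom R F (mid \<xi>).
        h ` carrier F = carrier (mid \<xi>) \<and>
        a_kernel F (mid \<xi>) h = (\<lambda>y. (incl \<xi>\<^sub>1 y, \<ominus>\<^bsub>mid \<xi>\<^sub>2\<^esub> incl \<xi>\<^sub>2 y)) ` carrier Y \<and>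
        (\<forall>y\<in>carrier Y. incl \<xi> y = h (incl \<xi>\<^sub>1 y, \<zero>\<^bsub>mid \<xi>\<^sub>2\<^esub>)) \<and>
        (\<forall>(a, b)\<in>carrier F. proj \<xi> (h (a, b)) = proj \<xi>\<^sub>1 a))"

text \<open>
  \<open>\<xi>'\<close> is a pull-back of \<open>\<xi>\<close> along \<open>\<phi> : X \<rightarrow> X\<close>: via \<open>h\<close> its middle term is the fibre product
  \<open>E \<times>\<^sub>X X\<close>, with the induced maps.
\<close>

definition is_ext_pullback ::
  "'r ring \<Rightarrow> ('r, 'x) module \<Rightarrow> ('r, 'y) module \<Rightarrow> ('x \<Rightarrow> 'x) \<Rightarrow>
   ('r, 'y, 'x) extn \<Rightarrow> ('r, 'y, 'x) extn \<Rightarrow> bool"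
where
  "is_ext_pullback R X Y \<phi> \<xi> \<xi>' \<longleftrightarrow>
     (let F = fibre_product (mid \<xi>) (proj \<xi>) X \<phi> in
      \<exists>h\<in>module_iso R F (mid \<xi>').
        (\<forall>y\<in>carrier Y. incl \<xi>' y = h (incl \<xi> y, \<zero>\<^bsub>X\<^esub>)) \<and>
        (\<forall>(e, x)\<in>carrier F. proj \<xi>' (h (e, x)) = x))"

text \<open>\<open>Ext\<^sup>1(X, Y)\<close> as a left module over \<^term>\<open>End_ring R X\<close>.\<close>

definition Ext1 ::
  "'r ring \<Rightarrow> ('r, 'x) module \<Rightarrow> ('r, 'y) module \<Rightarrow> ('x \<Rightarrow> 'x, ('r, 'y, 'x) extn set) module"
where
  "Ext1 R X Y =
     \<lparr>carrier = ext_class R X Y ` extensions R X Y,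
      mult = undefined, one = undefined,
      zero = {\<xi> \<in> extensions R X Y. splits R X \<xi>},
      add = (\<lambda>C D. {\<xi> \<in> extensions R X Y. \<exists>\<xi>\<^sub>1\<in>C. \<exists>\<xi>\<^sub>2\<in>D. is_baer_sum R Y \<xi>\<^sub>1 \<xi>\<^sub>2 \<xi>}),
      smult = (\<lambda>\<phi> C. {\<xi>' \<in> extensions R X Y. \<exists>\<xi>\<in>C. is_ext_pullback R X Y \<phi> \<xi> \<xi>'})\<rparr>"


section \<open>Semibricks and Pruefer modules\<close>

definition brick :: "'r ring \<Rightarrow> ('r, 'a) module \<Rightarrow> bool" where
  "brick R X \<longleftrightarrow> finitely_presented R X \<and> division_ring (End_ring R X)"

definition semibrick :: "'r ring \<Rightarrow> ('r, 'a) module set \<Rightarrow> bool" where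
  "semibrick R \<X> \<longleftrightarrow>
     (\<forall>X\<in>\<X>. brick R X) \<and>
     (\<forall>X\<in>\<X>. \<forall>X'\<in>\<X>. X \<noteq> X' \<longrightarrow> module_iso R X X' = {} \<and> hom_zero R X X')"

definition divisible :: "'r ring \<Rightarrow> ('r, 'a) module set \<Rightarrow> ('r, 'b) module \<Rightarrow> bool" where
  "divisible R \<X> M \<longleftrightarrow>
     left_module R M \<and> (\<forall>X\<in>\<X>. carrier (Ext1 R X M) = {\<zero>\<^bsub>Ext1 R X M\<^esub>})"

text \<open>
  A basis of \<open>Ext\<^sup>1(X, Y)\<close> is chosen as a set \<open>B X\<close> of extensions, indexed by itself. The universal
  sequence \<open>0 \<rightarrow> Y \<rightarrow> M \<rightarrow> \<Oplus>\<^sub>X X\<^bsup>(B X)\<^esup> \<rightarrow> 0\<close> is then the push-out along the summation map of the direct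
  sum of all chosen extensions; \<open>g\<close> is the induced map from the sum of their middle terms to \<open>M\<close>.
\<close>

definition universal_sequence ::
  "'r ring \<Rightarrow> ('r, 'a) module set \<Rightarrow> (('r, 'a) module \<Rightarrow> ('r, 'm, 'a) extn set) \<Rightarrow>
   ('r, 'm) module \<Rightarrow> ('m \<Rightarrow> 'n) \<Rightarrow> ('r, 'n) module \<Rightarrow>
   ('n \<Rightarrow> ('r, 'a) module \<times> ('r, 'm, 'a) extn \<Rightarrow> 'a) \<Rightarrow> bool"
where
  "universal_sequence R \<X> B Y i M p \<longleftrightarrow>
     (\<forall>X\<in>\<X>. B X \<subseteq> extensions R X Y \<and>
        is_basis (End_ring R X) (Ext1 R X Y) (B X) (ext_class R X Y)) \<and>
     (let K = Sigma \<X> B;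
          YK = direct_sum K (\<lambda>_. Y);
          MK = direct_sum K (\<lambda>(X, \<xi>). mid \<xi>);
          XK = direct_sum K (\<lambda>(X, \<xi>). X)
      in short_exact R Y i M p XK \<and>
         (\<exists>g. is_pushout R YK MK Y
                (direct_sum_map K (\<lambda>(X, \<xi>). incl \<xi>)) (summation K Y) M g i \<and>
              (\<forall>e\<in>carrier MK. p (g e) = direct_sum_map K (\<lambda>(X, \<xi>). proj \<xi>) e)))"

text \<open>
  \<open>P\<close> is the module \<open>Y\<^sub>\<X>(\<infinity>)\<close>, unique only up to the choices in its construction, and \<open>\<iota> : Y \<rightarrow> P\<close> is the
  canonical embedding. Here \<open>M n\<close> stands for \<open>Y\<^sub>\<X>(n + 1)\<close>; as \<open>M n\<close> embeds into \<open>P\<close>, the carrier type of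
  \<open>P\<close> can be used for all \<open>M n\<close>, with \<open>M 0\<close> identified with \<open>Y\<close> through \<open>e\<close>.
\<close>

definition universal_limit ::
  "'r ring \<Rightarrow> ('r, 'a) module set \<Rightarrow> ('r, 'y) module \<Rightarrow> ('r, 'p) module \<Rightarrow> ('y \<Rightarrow> 'p) \<Rightarrow> bool"
where
  "universal_limit R \<X> Y P \<iota> \<longleftrightarrow>
     (\<exists>(M :: nat \<Rightarrow> ('r, 'p) module) u c e.
        e \<in> module_iso R Y (M 0) \<and>
        (\<forall>n. \<exists>B p. universal_sequence R \<X> B (M n) (u n) (M (Suc n)) p) \<and>
        is_direct_limit R M u P c \<and>
        (\<forall>y\<in>carrier Y. \<iota> y = c 0 (e y)))"

definition pruefer_module :: "'r ring \<Rightarrow> ('r, 'a) module set \<Rightarrow> ('r, 'p) module \<Rightarrow> bool" where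
  "pruefer_module R \<X> P \<longleftrightarrow> (\<exists>Y\<in>\<X>. \<exists>\<iota>. universal_limit R \<X> Y P \<iota>)"

text \<open>The sum of all images of maps \<open>X \<rightarrow> M\<close>, as the smallest submodule containing all of them.\<close>

definition soc :: "'r ring \<Rightarrow> ('r, 'a) module set \<Rightarrow> ('r, 'b) module \<Rightarrow> 'b set" where
  "soc R \<X> M =
     \<Inter> {N. submodule N R M \<and> (\<forall>X\<in>\<X>. \<forall>f\<in>module_hom R X M. f ` carrier X \<subseteq> N)}"

end

theory Submission
  imports Defs
begin

text \<open>
  For \<open>Z \<in> \<X>\<close> and a universal sequence \<open>0 \<rightarrow> Y \<rightarrow> M \<rightarrow> \<Oplus>\<^sub>X X\<^bsup>(I\<^sub>X)\<^esup> \<rightarrow> 0\<close>, the connecting map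
  \<open>Hom(Z, \<Oplus>\<^sub>X X\<^bsup>(I\<^sub>X)\<^esup>) = End(Z)\<^bsup>(I\<^sub>Z)\<^esup> \<rightarrow> Ext\<^sup>1(Z, Y)\<close> maps the standard basis to the chosen basis of
  \<open>Ext\<^sup>1(Z, Y)\<close>, so it is injective and every map \<open>Z \<rightarrow> M\<close> has image in \<open>Y\<close>. As \<open>Z\<close> is finitely
  generated, a map from \<open>Z\<close> to the direct limit factors through a finite stage and hence has image in
  the first stage; this is the statement on the socle. A nonzero direct summand \<open>A\<close> of the limit meets
  \<open>Y\<close>: at the first stage on which the projection to \<open>A\<close> does not vanish, it induces a nonzero map
  \<open>X \<rightarrow> A\<close> for some \<open>X \<in> \<X>\<close>. If there were two nonzero complementary summands, the projection onto one of
  them would restrict to an endomorphism of \<open>Y\<close> that is neither injective nor zero, although \<open>Y\<close> is a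
  brick.
\<close>

section \<open>Left modules and their maps\<close>

text \<open>The sum and the scalar product of \<open>Ext1\<close> are sets of extensions described
  through the existence of suitable maps, which gives no formula for a linear combination of
  classes. Each class is therefore named by a pair of factor sets (\<alpha>, \<beta>), recording how
  far a section is from being additive and \<open>R\<close>-linear. Sums of classes become pointwise
  sums, and pull-back along \<phi> becomes composition with \<phi>. With this, the connecting map
  need not be constructed. Given \<open>f\<close> from \<open>Z\<close> to the middle term, lift
  \<open>p (f z)\<close> through chosen sections to a non-linear family \<open>e z\<close>. Then
  \<open>f z\<close> and \<open>g (e z)\<close> differ by some \<open>i (h z)\<close>, and linearity
  of \<open>f\<close> forces the defect of \<open>h\<close> to be the sum of the factor sets pulled
  back along the components of \<open>p (f z)\<close>. That sum is thus a coboundary, the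
  corresponding combination of basis classes is zero, and the uniqueness clause of
  \<open>is_basis\<close> makes every component vanish.\<close>

context left_module
begin

lemma smult_zero_right: assumes "a \<in> carrier R" shows "a \<odot>\<^bsub>M\<^esub> \<zero>\<^bsub>M\<^esub> = \<zero>\<^bsub>M\<^esub>"
proof -
  have "a \<odot>\<^bsub>M\<^esub> \<zero>\<^bsub>M\<^esub> \<oplus>\<^bsub>M\<^esub> a \<odot>\<^bsub>M\<^esub> \<zero>\<^bsub>M\<^esub> = a \<odot>\<^bsub>M\<^esub> \<zero>\<^bsub>M\<^esub>"
    using smult_r_distr[OF assms, of "\<zero>\<^bsub>M\<^esub>" "\<zero>\<^bsub>M\<^esub>"] by simp
  then show ?thesis using assms by (simp add: M.add.r_cancel_one)
qed

lemma smult_zero_left: assumes "x \<in> carrier M" shows "\<zero>\<^bsub>R\<^esub> \<odot>\<^bsub>M\<^esub> x = \<zero>\<^bsub>M\<^esub>"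
proof -
  have "\<zero>\<^bsub>R\<^esub> \<odot>\<^bsub>M\<^esub> x \<oplus>\<^bsub>M\<^esub> \<zero>\<^bsub>R\<^esub> \<odot>\<^bsub>M\<^esub> x = \<zero>\<^bsub>R\<^esub> \<odot>\<^bsub>M\<^esub> x"
    using smult_l_distr[OF _ _ assms, of "\<zero>\<^bsub>R\<^esub>" "\<zero>\<^bsub>R\<^esub>"] by simp
  then show ?thesis using assms by (simp add: M.add.r_cancel_one)
qed

text \<open>The library notion asks for an additive subgroup. Closure under negatives follows from
  closure under scalars, since \<open>\<ominus> x\<close> is the multiple of \<open>x\<close> by
  \<open>\<ominus> \<one>\<close>.\<close>

lemma submodule_intro:
  assumes "H \<subseteq> carrier M" "\<zero>\<^bsub>M\<^esub> \<in> H"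
    and "\<And>x y. x \<in> H \<Longrightarrow> y \<in> H \<Longrightarrow> x \<oplus>\<^bsub>M\<^esub> y \<in> H"
    and sm: "\<And>a x. a \<in> carrier R \<Longrightarrow> x \<in> H \<Longrightarrow> a \<odot>\<^bsub>M\<^esub> x \<in> H"
  shows "submodule H R M"
proof -
  have "\<ominus>\<^bsub>M\<^esub> x \<in> H" if x: "x \<in> H" for x
  proof -
    have xM: "x \<in> carrier M" using x assms(1) by blast
    have "(\<ominus>\<^bsub>R\<^esub> \<one>\<^bsub>R\<^esub>) \<odot>\<^bsub>M\<^esub> x \<oplus>\<^bsub>M\<^esub> x = \<zero>\<^bsub>M\<^esub>"
      using smult_l_distr[of "\<ominus>\<^bsub>R\<^esub> \<one>\<^bsub>R\<^esub>" "\<one>\<^bsub>R\<^esub>" x] xM by (simp add: R.l_neg smult_zero_left)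
    then have "\<ominus>\<^bsub>M\<^esub> x = (\<ominus>\<^bsub>R\<^esub> \<one>\<^bsub>R\<^esub>) \<odot>\<^bsub>M\<^esub> x"
      using xM by (intro M.minus_equality) auto
    then show ?thesis using sm[of "\<ominus>\<^bsub>R\<^esub> \<one>\<^bsub>R\<^esub>" x] x by simp
  qed
  then show ?thesis
    using assms by (intro submodule.intro subgroup.intro submodule_axioms.intro)
      (auto simp: a_inv_def)
qed

end

lemma submoduleD:
  assumes "submodule N R M"
  shows "N \<subseteq> carrier M" "\<zero>\<^bsub>M\<^esub> \<in> N"
    and "\<And>x y. x \<in> N \<Longrightarrow> y \<in> N \<Longrightarrow> x \<oplus>\<^bsub>M\<^esub> y \<in> N"
    and "\<And>a x. a \<in> carrier R \<Longrightarrow> x \<in> N \<Longrightarrow> a \<odot>\<^bsub>M\<^esub> x \<in> N"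
    and "\<And>x. x \<in> N \<Longrightarrow> \<ominus>\<^bsub>M\<^esub> x \<in> N"
proof -
  interpret submodule N R M by fact
  show "N \<subseteq> carrier M" "\<zero>\<^bsub>M\<^esub> \<in> N"
    and "\<And>x y. x \<in> N \<Longrightarrow> y \<in> N \<Longrightarrow> x \<oplus>\<^bsub>M\<^esub> y \<in> N"
    and "\<And>a x. a \<in> carrier R \<Longrightarrow> x \<in> N \<Longrightarrow> a \<odot>\<^bsub>M\<^esub> x \<in> N"
    and "\<And>x. x \<in> N \<Longrightarrow> \<ominus>\<^bsub>M\<^esub> x \<in> N"
    using subset one_closed m_closed smult_closed m_inv_closed
    by (auto simp: a_inv_def)
qed

section \<open>Homomorphisms, fibre products and short exact sequences\<close>

lemma module_hom_preimage_submodule: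
  assumes f: "f \<in> module_hom R M N" and M: "left_module R M" and N: "left_module R N"
    and H: "submodule H R N"
  shows "submodule {x \<in> carrier M. f x \<in> H} R M"
proof -
  interpret M: left_module R M by fact
  show ?thesis
    using submoduleD[OF H] module_homD[OF f] module_hom_zero_minus(1)[OF f M N]
    by (intro M.submodule_intro) auto
qed

lemma module_hom_image_submodule:
  assumes f: "f \<in> module_hom R M N" and M: "left_module R M" and N: "left_module R N"
  shows "submodule (f ` carrier M) R N"
proof -
  interpret M: left_module R M by fact
  interpret N: left_module R N by fact
  show ?thesis
  proof (rule N.submodule_intro)
    show "f ` carrier M \<subseteq> carrier N" using module_homD(1)[OF f] by auto
    show "\<zero>\<^bsub>N\<^esub> \<in> f ` carrier M"
      using module_hom_zero_minus(1)[OF f M N] by (metis M.zero_closed imageI)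
    fix x y assume "x \<in> f ` carrier M" "y \<in> f ` carrier M"
    then obtain x' y' where xy: "x' \<in> carrier M" "y' \<in> carrier M" "x = f x'" "y = f y'" by blast
    then show "x \<oplus>\<^bsub>N\<^esub> y \<in> f ` carrier M"
      by (intro image_eqI[of _ _ "x' \<oplus>\<^bsub>M\<^esub> y'"]) (simp_all add: module_homD(2)[OF f])
  next
    fix a x assume a: "a \<in> carrier R" and "x \<in> f ` carrier M"
    then obtain x' where x: "x' \<in> carrier M" "x = f x'" by blast
    then show "a \<odot>\<^bsub>N\<^esub> x \<in> f ` carrier M"
      using a by (intro image_eqI[of _ _ "a \<odot>\<^bsub>M\<^esub> x'"]) (simp_all add: module_homD(3)[OF f])
  qed
qed

lemma module_hom_comp:
  "f \<in> module_hom R A B \<Longrightarrow> g \<in> module_hom R B C \<Longrightarrow> (\<lambda>x. g (f x)) \<in> module_hom R A C"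
  unfolding module_hom_def by (auto simp: Pi_iff)

text \<open>\<open>E\<close> may be any record: \<open>module_hom\<close> only asks \<open>k\<close>
  to respect the operations, so every module axiom is inherited through preimages. The value of
  \<open>k\<close> at zero is an assumption because it cannot be derived before \<open>E\<close> is
  known to be a group.\<close>

lemma left_module_surjective_image:
  assumes F: "left_module R F" and k: "k \<in> module_hom R F E"
    and surj: "k ` carrier F = carrier E" and zero: "k \<zero>\<^bsub>F\<^esub> = \<zero>\<^bsub>E\<^esub>"
  shows "left_module R E"
proof -
  interpret F: left_module R F by fact
  note ks = module_homD[OF k]
  have ex: "\<exists>a\<in>carrier F. x = k a" if "x \<in> carrier E" for x using that surj by auto
  have add: "abelian_group E"
  proof (rule abelian_groupI)
    fix x y assume "x \<in> carrier E" "y \<in> carrier E"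
    then obtain a b where ab: "a \<in> carrier F" "b \<in> carrier F" "x = k a" "y = k b" using ex by metis
    show "x \<oplus>\<^bsub>E\<^esub> y \<in> carrier E"
      using ab ks(1)[of "a \<oplus>\<^bsub>F\<^esub> b"] by (simp add: ks(2))
    show "x \<oplus>\<^bsub>E\<^esub> y = y \<oplus>\<^bsub>E\<^esub> x"
      using ab by (simp flip: ks(2) add: F.a_comm)
    fix z assume "z \<in> carrier E"
    then obtain c where c: "c \<in> carrier F" "z = k c" using ex by metis
    show "x \<oplus>\<^bsub>E\<^esub> y \<oplus>\<^bsub>E\<^esub> z = x \<oplus>\<^bsub>E\<^esub> (y \<oplus>\<^bsub>E\<^esub> z)"
      using ab c by (simp flip: ks(2) add: F.a_assoc)
  next
    show "\<zero>\<^bsub>E\<^esub> \<in> carrier E" using ks(1)[of "\<zero>\<^bsub>F\<^esub>"] zero by simp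
    fix x assume "x \<in> carrier E"
    then obtain a where a: "a \<in> carrier F" "x = k a" using ex by metis
    show "\<zero>\<^bsub>E\<^esub> \<oplus>\<^bsub>E\<^esub> x = x" using a by (simp flip: ks(2) zero)
    show "\<exists>y\<in>carrier E. y \<oplus>\<^bsub>E\<^esub> x = \<zero>\<^bsub>E\<^esub>"
      using a ks(1) by (intro bexI[of _ "k (\<ominus>\<^bsub>F\<^esub> a)"]) (simp_all flip: ks(2) zero add: F.l_neg)
  qed
  show ?thesis
  proof (intro left_module.intro left_module_axioms.intro add)
    show "ring R" by (rule F.R.ring_axioms)
    fix a x assume a: "a \<in> carrier R" and "x \<in> carrier E"
    then obtain u where u: "u \<in> carrier F" "x = k u" using ex by metis
    show "a \<odot>\<^bsub>E\<^esub> x \<in> carrier E" using a u ks(1)[of "a \<odot>\<^bsub>F\<^esub> u"] by (simp add: ks(3))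
    { fix b assume b: "b \<in> carrier R"
      show "(a \<oplus>\<^bsub>R\<^esub> b) \<odot>\<^bsub>E\<^esub> x = a \<odot>\<^bsub>E\<^esub> x \<oplus>\<^bsub>E\<^esub> b \<odot>\<^bsub>E\<^esub> x"
        using a b u by (simp flip: ks(2,3) add: F.smult_l_distr)
      show "(a \<otimes>\<^bsub>R\<^esub> b) \<odot>\<^bsub>E\<^esub> x = a \<odot>\<^bsub>E\<^esub> (b \<odot>\<^bsub>E\<^esub> x)"
        using a b u by (simp flip: ks(3) add: F.smult_assoc) }
    fix y assume "y \<in> carrier E"
    then obtain v where v: "v \<in> carrier F" "y = k v" using ex by metis
    show "a \<odot>\<^bsub>E\<^esub> (x \<oplus>\<^bsub>E\<^esub> y) = a \<odot>\<^bsub>E\<^esub> x \<oplus>\<^bsub>E\<^esub> a \<odot>\<^bsub>E\<^esub> y"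
      using a u v by (simp flip: ks(2,3) add: F.smult_r_distr)
  next
    fix x assume "x \<in> carrier E"
    then obtain u where u: "u \<in> carrier F" "x = k u" using ex by metis
    then show "\<one>\<^bsub>R\<^esub> \<odot>\<^bsub>E\<^esub> x = x" by (simp flip: ks(3))
  qed
qed

lemma fibre_product_left_module:
  assumes A: "left_module R A" and B: "left_module R B" and C: "left_module R C"
    and f: "f \<in> module_hom R A C" and g: "g \<in> module_hom R B C"
  shows "left_module R (fibre_product A f B g)"
proof -
  interpret A: left_module R A by fact
  interpret B: left_module R B by fact
  note hs = module_homD[OF f] module_homD[OF g]
    module_hom_zero_minus[OF f A C] module_hom_zero_minus[OF g B C]
  show ?thesis
  proof (intro left_module.intro left_module_axioms.intro abelian_groupI)
    show "ring R" by (rule A.R.ring_axioms)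
  next
    fix x assume "x \<in> carrier (fibre_product A f B g)"
    then show "\<exists>y\<in>carrier (fibre_product A f B g).
        y \<oplus>\<^bsub>fibre_product A f B g\<^esub> x = \<zero>\<^bsub>fibre_product A f B g\<^esub>"
      by (intro bexI[of _ "(\<ominus>\<^bsub>A\<^esub> fst x, \<ominus>\<^bsub>B\<^esub> snd x)"])
        (auto simp: fibre_product_def hs A.l_neg B.l_neg)
  qed (auto simp: fibre_product_def hs A.a_ac B.a_ac A.smult_l_distr
      B.smult_l_distr A.smult_r_distr B.smult_r_distr A.smult_assoc B.smult_assoc)
qed

lemma short_exactD:
  assumes "short_exact R A f B g C"
  shows "left_module R A" "left_module R B" "left_module R C"
    "f \<in> module_hom R A B" "g \<in> module_hom R B C" "inj_on f (carrier A)"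
    "g ` carrier B = carrier C"
    and "b \<in> carrier B \<Longrightarrow> g b = \<zero>\<^bsub>C\<^esub> \<longleftrightarrow> b \<in> f ` carrier A"
    and "a \<in> carrier A \<Longrightarrow> g (f a) = \<zero>\<^bsub>C\<^esub>"
  using assms unfolding short_exact_def a_kernel_def' by auto

lemma short_exact_factor:
  assumes ex: "short_exact R A f B g C" and T: "left_module R T"
    and h: "h \<in> module_hom R B T" and hf: "\<And>a. a \<in> carrier A \<Longrightarrow> h (f a) = \<zero>\<^bsub>T\<^esub>"
  shows "\<exists>k\<in>module_hom R C T. \<forall>b\<in>carrier B. k (g b) = h b"
proof -
  note ex = short_exactD[OF ex]
  interpret B: left_module R B by (rule ex)
  interpret C: left_module R C by (rule ex)
  interpret T: left_module R T by fact
  note hs = module_homD[OF h] module_homD[OF ex(5)]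
  \<comment> \<open>Any preimage of \<open>c\<close> may be used: two of them differ by some
    \<open>f a\<close>, on which \<open>h\<close> vanishes.\<close>
  define k where "k c = h (inv_into (carrier B) g c)" for c
  have k: "k (g b) = h b" if b: "b \<in> carrier B" for b
  proof -
    define b' where "b' = inv_into (carrier B) g (g b)"
    have b': "b' \<in> carrier B" "g b' = g b"
      using b unfolding b'_def by (auto intro: inv_into_into f_inv_into_f)
    have "g (b' \<ominus>\<^bsub>B\<^esub> b) = \<zero>\<^bsub>C\<^esub>"
      using b b' by (simp add: a_minus_def hs module_hom_zero_minus[OF ex(5,2,3)] C.r_neg)
    then obtain a where "a \<in> carrier A" "b' \<ominus>\<^bsub>B\<^esub> b = f a"
      using ex(8)[of "b' \<ominus>\<^bsub>B\<^esub> b"] b b' by auto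
    then have "h b' \<ominus>\<^bsub>T\<^esub> h b = \<zero>\<^bsub>T\<^esub>"
      using hf b b' hs(2)[of b' "\<ominus>\<^bsub>B\<^esub> b"]
      by (simp add: a_minus_def module_hom_zero_minus[OF h ex(2) T])
    then show ?thesis
      using b b' by (simp add: k_def flip: b'_def) (rule T.minus_zero_imp_eq, simp_all add: hs)
  qed
  have "k \<in> module_hom R C T"
    unfolding module_hom_def
  proof (intro CollectI conjI Pi_I ballI)
    fix x assume "x \<in> carrier C"
    then obtain b where b: "b \<in> carrier B" "x = g b" using ex(7) by blast
    then show "k x \<in> carrier T" by (simp add: k hs)
    { fix y assume "y \<in> carrier C"
      then obtain b' where b': "b' \<in> carrier B" "y = g b'" using ex(7) by blast
      then show "k (x \<oplus>\<^bsub>C\<^esub> y) = k x \<oplus>\<^bsub>T\<^esub> k y"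
        using b k[of "b \<oplus>\<^bsub>B\<^esub> b'"] by (simp add: k hs) }
    fix a assume "a \<in> carrier R"
    then show "k (a \<odot>\<^bsub>C\<^esub> x) = a \<odot>\<^bsub>T\<^esub> k x"
      using b k[of "a \<odot>\<^bsub>B\<^esub> b"] by (simp add: k hs)
  qed
  then show ?thesis using k by blast
qed

text \<open>Moves a map from a later stage of the tower back to an earlier one, once its image is
  known to lie there. The pointwise preimages form a homomorphism because \<open>j\<close> reflects
  equations.\<close>

lemma module_hom_lift_inj:
  assumes A: "left_module R A" and j: "j \<in> module_hom R A B" and inj: "inj_on j (carrier A)"
    and f: "f \<in> module_hom R Z B" and sub: "f ` carrier Z \<subseteq> j ` carrier A" and Z: "left_module R Z"
  shows "\<exists>h\<in>module_hom R Z A. \<forall>z\<in>carrier Z. j (h z) = f z"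
proof -
  interpret A: left_module R A by fact
  interpret Z: left_module R Z by fact
  define h where "h z = inv_into (carrier A) j (f z)" for z
  have h: "h z \<in> carrier A" "j (h z) = f z" if "z \<in> carrier Z" for z
    using subsetD[OF sub imageI[OF that]] unfolding h_def
    by (auto simp: inv_into_f_f[OF inj])
  have "h \<in> module_hom R Z A"
    unfolding module_hom_def
    by (auto intro!: inj_onD[OF inj] simp: h module_homD[OF j] module_homD[OF f])
  then show ?thesis using h by blast
qed

section \<open>Factor sets of extensions\<close>

text \<open>
  A normalised set-theoretic section \<open>s\<close> determines the extension up to equivalence through its factor
  sets \<open>\<alpha>\<close> and \<open>\<beta>\<close>, on which Baer sums and pull-backs act pointwise.
\<close>

locale ext_section =
  fixes R :: "'r ring" and Y :: "('r, 'y) module" and E :: "('r, 'e) module"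
    and X :: "('r, 'x) module" and i :: "'y \<Rightarrow> 'e" and q :: "'e \<Rightarrow> 'x" and s :: "'x \<Rightarrow> 'e"
    and \<alpha> :: "'x \<Rightarrow> 'x \<Rightarrow> 'y" and \<beta> :: "'r \<Rightarrow> 'x \<Rightarrow> 'y"
  assumes exact: "short_exact R Y i E q X"
    and s_closed: "x \<in> carrier X \<Longrightarrow> s x \<in> carrier E"
    and q_s: "x \<in> carrier X \<Longrightarrow> q (s x) = x"
    and s_zero: "s \<zero>\<^bsub>X\<^esub> = \<zero>\<^bsub>E\<^esub>"
    and alpha_closed: "\<lbrakk>x \<in> carrier X; x' \<in> carrier X\<rbrakk> \<Longrightarrow> \<alpha> x x' \<in> carrier Y"
    and beta_closed: "\<lbrakk>a \<in> carrier R; x \<in> carrier X\<rbrakk> \<Longrightarrow> \<beta> a x \<in> carrier Y"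
    and s_add: "\<lbrakk>x \<in> carrier X; x' \<in> carrier X\<rbrakk> \<Longrightarrow> s x \<oplus>\<^bsub>E\<^esub> s x' = i (\<alpha> x x') \<oplus>\<^bsub>E\<^esub> s (x \<oplus>\<^bsub>X\<^esub> x')"
    and s_smult: "\<lbrakk>a \<in> carrier R; x \<in> carrier X\<rbrakk> \<Longrightarrow> a \<odot>\<^bsub>E\<^esub> s x = i (\<beta> a x) \<oplus>\<^bsub>E\<^esub> s (a \<odot>\<^bsub>X\<^esub> x)"
begin

sublocale Y: left_module R Y by (rule short_exactD(1)[OF exact])
sublocale E: left_module R E by (rule short_exactD(2)[OF exact])
sublocale X: left_module R X by (rule short_exactD(3)[OF exact])

lemmas i_hom = short_exactD(4)[OF exact]
lemmas q_hom = short_exactD(5)[OF exact]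
lemmas i_simps = module_homD[OF i_hom] module_hom_zero_minus[OF i_hom Y.left_module_axioms E.left_module_axioms]
lemmas q_simps = module_homD[OF q_hom] module_hom_zero_minus[OF q_hom E.left_module_axioms X.left_module_axioms]

lemma q_i: "y \<in> carrier Y \<Longrightarrow> q (i y) = \<zero>\<^bsub>X\<^esub>"
  by (rule short_exactD(9)[OF exact])

lemma i_eq_iff: "y \<in> carrier Y \<Longrightarrow> y' \<in> carrier Y \<Longrightarrow> i y = i y' \<longleftrightarrow> y = y'"
  using short_exactD(6)[OF exact] by (auto dest: inj_onD)

text \<open>The \<open>Y\<close>-coordinate of \<open>e\<close> with respect to the section. It is a
  retraction of \<open>i\<close> that fails to be linear exactly by \<alpha> and \<beta>, as
  \<open>r_add\<close> and \<open>r_smult\<close> record.\<close>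

definition r :: "'e \<Rightarrow> 'y" where
  "r e = (THE y. y \<in> carrier Y \<and> e = i y \<oplus>\<^bsub>E\<^esub> s (q e))"

lemma r_unique:
  assumes "y \<in> carrier Y" "x \<in> carrier X"
  shows "r (i y \<oplus>\<^bsub>E\<^esub> s x) = y"
proof -
  have "q (i y \<oplus>\<^bsub>E\<^esub> s x) = x" using assms by (simp add: q_simps i_simps s_closed q_i q_s)
  then show ?thesis
    unfolding r_def using assms
    by (intro the_equality) (auto simp: i_simps s_closed i_eq_iff)
qed

lemma r_decomp:
  assumes "e \<in> carrier E"
  shows "r e \<in> carrier Y" "i (r e) \<oplus>\<^bsub>E\<^esub> s (q e) = e"
proof -
  have "q (e \<ominus>\<^bsub>E\<^esub> s (q e)) = \<zero>\<^bsub>X\<^esub>"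
    using assms by (simp add: a_minus_def q_simps s_closed q_s X.r_neg)
  then obtain y where y: "y \<in> carrier Y" "e \<ominus>\<^bsub>E\<^esub> s (q e) = i y"
    using short_exactD(8)[OF exact, of "e \<ominus>\<^bsub>E\<^esub> s (q e)"] assms by (auto simp: s_closed q_simps)
  have e: "i y \<oplus>\<^bsub>E\<^esub> s (q e) = e"
    unfolding y(2)[symmetric] using assms by (simp add: a_minus_def s_closed q_simps E.a_assoc E.l_neg)
  then have "r e = y" using r_unique[of y "q e"] y assms by (simp add: q_simps)
  then show "r e \<in> carrier Y" "i (r e) \<oplus>\<^bsub>E\<^esub> s (q e) = e" using y e by auto
qed

lemma r_i: "y \<in> carrier Y \<Longrightarrow> r (i y) = y"
  using r_unique[of y "\<zero>\<^bsub>X\<^esub>"] by (simp add: s_zero i_simps)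

lemma r_zero: "r \<zero>\<^bsub>E\<^esub> = \<zero>\<^bsub>Y\<^esub>"
  using r_i[of "\<zero>\<^bsub>Y\<^esub>"] by (simp add: i_simps)

lemma r_add:
  assumes e: "e \<in> carrier E" "e' \<in> carrier E"
  shows "r (e \<oplus>\<^bsub>E\<^esub> e') = r e \<oplus>\<^bsub>Y\<^esub> r e' \<oplus>\<^bsub>Y\<^esub> \<alpha> (q e) (q e')"
proof -
  note cl = r_decomp(1)[OF e(1)] r_decomp(1)[OF e(2)] q_simps(1)[OF e(1)] q_simps(1)[OF e(2)]
  have "e \<oplus>\<^bsub>E\<^esub> e' = (i (r e) \<oplus>\<^bsub>E\<^esub> s (q e)) \<oplus>\<^bsub>E\<^esub> (i (r e') \<oplus>\<^bsub>E\<^esub> s (q e'))"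
    using e by (simp add: r_decomp)
  also have "\<dots> = i (r e) \<oplus>\<^bsub>E\<^esub> i (r e') \<oplus>\<^bsub>E\<^esub> (s (q e) \<oplus>\<^bsub>E\<^esub> s (q e'))"
    using cl by (simp add: E.a_ac i_simps s_closed)
  also have "\<dots> = i (r e \<oplus>\<^bsub>Y\<^esub> r e' \<oplus>\<^bsub>Y\<^esub> \<alpha> (q e) (q e')) \<oplus>\<^bsub>E\<^esub> s (q e \<oplus>\<^bsub>X\<^esub> q e')"
    using cl by (simp add: E.a_assoc i_simps s_closed s_add alpha_closed)
  finally show ?thesis
    using cl by (simp add: r_unique alpha_closed)
qed

lemma r_smult:
  assumes a: "a \<in> carrier R" and e: "e \<in> carrier E"
  shows "r (a \<odot>\<^bsub>E\<^esub> e) = a \<odot>\<^bsub>Y\<^esub> r e \<oplus>\<^bsub>Y\<^esub> \<beta> a (q e)"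
proof -
  note cl = a r_decomp(1)[OF e] q_simps(1)[OF e]
  have "a \<odot>\<^bsub>E\<^esub> e = a \<odot>\<^bsub>E\<^esub> (i (r e) \<oplus>\<^bsub>E\<^esub> s (q e))"
    using e by (simp add: r_decomp)
  also have "\<dots> = i (a \<odot>\<^bsub>Y\<^esub> r e \<oplus>\<^bsub>Y\<^esub> \<beta> a (q e)) \<oplus>\<^bsub>E\<^esub> s (a \<odot>\<^bsub>X\<^esub> q e)"
    using cl by (simp add: E.a_assoc E.smult_r_distr i_simps s_closed s_smult beta_closed)
  finally show ?thesis
    using cl by (simp add: r_unique beta_closed)
qed

text \<open>Replaces an equation in the middle term by one equation in \<open>Y\<close> and one in
  \<open>X\<close>, where the factor sets can be compared directly.\<close>

lemma eqI:
  assumes "e \<in> carrier E" "e' \<in> carrier E" "r e = r e'" "q e = q e'"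
  shows "e = e'"
proof -
  have "e = i (r e') \<oplus>\<^bsub>E\<^esub> s (q e')" using r_decomp(2)[OF assms(1)] unfolding assms(3,4) ..
  then show ?thesis unfolding r_decomp(2)[OF assms(2)] .
qed

end

lemma ext_section_exists:
  assumes "short_exact R Y i E q X"
  shows "\<exists>s \<alpha> \<beta>. ext_section R Y E X i q s \<alpha> \<beta>"
proof -
  note ex = short_exactD[OF assms]
  interpret Y: left_module R Y by (rule ex)
  interpret E: left_module R E by (rule ex)
  interpret X: left_module R X by (rule ex)
  note qs = module_homD[OF ex(5)] module_hom_zero_minus[OF ex(5,2,3)]
  \<comment> \<open>\<open>inv_into\<close> might pick a nonzero preimage of zero; the case split
    enforces the normalisation \<open>s_zero\<close>.\<close>
  define s where "s x = (if x = \<zero>\<^bsub>X\<^esub> then \<zero>\<^bsub>E\<^esub> else inv_into (carrier E) q x)" for x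
  have s: "s x \<in> carrier E" "q (s x) = x" if "x \<in> carrier X" for x
    using that ex(7) unfolding s_def by (auto simp: qs intro: inv_into_into f_inv_into_f)
  \<comment> \<open>\<open>d\<close> inverts \<open>i\<close> on the kernel of \<open>q\<close>.
    Both defects of \<open>s\<close> lie in that kernel, and their preimages are the factor
    sets.\<close>
  define d where "d e = (SOME y. y \<in> carrier Y \<and> i y = e)" for e
  have d: "d e \<in> carrier Y \<and> i (d e) = e" if "e \<in> carrier E" "q e = \<zero>\<^bsub>X\<^esub>" for e
  proof -
    have "e \<in> i ` carrier Y" using ex(8)[OF that(1)] that(2) by simp
    then have "\<exists>y. y \<in> carrier Y \<and> i y = e" by blast
    then show ?thesis unfolding d_def by (rule someI_ex)
  qed
  define \<alpha> where "\<alpha> x x' = d (s x \<oplus>\<^bsub>E\<^esub> s x' \<ominus>\<^bsub>E\<^esub> s (x \<oplus>\<^bsub>X\<^esub> x'))" for x x'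
  define \<beta> where "\<beta> a x = d (a \<odot>\<^bsub>E\<^esub> s x \<ominus>\<^bsub>E\<^esub> s (a \<odot>\<^bsub>X\<^esub> x))" for a x
  have cancel: "u \<ominus>\<^bsub>E\<^esub> v \<oplus>\<^bsub>E\<^esub> v = u" if "u \<in> carrier E" "v \<in> carrier E" for u v
    using that by (simp add: a_minus_def E.a_assoc E.l_neg)
  have \<alpha>: "\<alpha> x x' \<in> carrier Y \<and> i (\<alpha> x x') = s x \<oplus>\<^bsub>E\<^esub> s x' \<ominus>\<^bsub>E\<^esub> s (x \<oplus>\<^bsub>X\<^esub> x')"
    if "x \<in> carrier X" "x' \<in> carrier X" for x x'
    unfolding \<alpha>_def using that by (intro d) (simp_all add: a_minus_def qs s X.r_neg)
  have \<beta>: "\<beta> a x \<in> carrier Y \<and> i (\<beta> a x) = a \<odot>\<^bsub>E\<^esub> s x \<ominus>\<^bsub>E\<^esub> s (a \<odot>\<^bsub>X\<^esub> x)"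
    if "a \<in> carrier R" "x \<in> carrier X" for a x
    unfolding \<beta>_def using that by (intro d) (simp_all add: a_minus_def qs s X.r_neg)
  have "ext_section R Y E X i q s \<alpha> \<beta>"
    by unfold_locales (use assms in \<open>simp_all add: s \<alpha> \<beta> cancel\<close>, simp add: s_def)
  then show ?thesis by blast
qed

text \<open>Composing a section with an equivalence \<open>t\<close> gives a section of the other
  extension. As \<open>t\<close> turns \<open>i y\<close> into \<open>i' y\<close>, its defects come
  from the same elements of \<open>Y\<close>.\<close>

lemma ext_section_transfer:
  assumes "ext_section R Y E X i q s \<alpha> \<beta>" and ex: "short_exact R Y i' E' q' X"
    and t: "t \<in> module_hom R E E'"
    and ti: "\<And>y. y \<in> carrier Y \<Longrightarrow> t (i y) = i' y" and tq: "\<And>e. e \<in> carrier E \<Longrightarrow> q' (t e) = q e"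
  shows "ext_section R Y E' X i' q' (\<lambda>x. t (s x)) \<alpha> \<beta>"
proof -
  interpret ext_section R Y E X i q s \<alpha> \<beta> by fact
  note ts = module_homD[OF t] module_hom_zero_minus(1)[OF t E.left_module_axioms short_exactD(2)[OF ex]]
  show ?thesis
  proof (unfold_locales, rule ex)
    fix x x' assume x: "x \<in> carrier X" "x' \<in> carrier X"
    show "t (s x) \<oplus>\<^bsub>E'\<^esub> t (s x') = i' (\<alpha> x x') \<oplus>\<^bsub>E'\<^esub> t (s (x \<oplus>\<^bsub>X\<^esub> x'))"
      using x by (simp flip: ts(2) ti add: s_add s_closed alpha_closed i_simps)
  next
    fix a x assume x: "a \<in> carrier R" "x \<in> carrier X"
    show "a \<odot>\<^bsub>E'\<^esub> t (s x) = i' (\<beta> a x) \<oplus>\<^bsub>E'\<^esub> t (s (a \<odot>\<^bsub>X\<^esub> x))"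
      using x by (simp flip: ts(2,3) ti add: s_smult s_closed beta_closed i_simps)
  qed (simp_all add: ts s_closed q_s tq s_zero alpha_closed beta_closed)
qed

text \<open>The map that keeps both coordinates, \<open>r\<close> and the projection to
  \<open>X\<close>, is linear because the two coordinates \<open>r\<close> have the same
  defects.\<close>

lemma ext_section_same_factors_iso:
  assumes "ext_section R Y E X i q s \<alpha> \<beta>" and "ext_section R Y E' X i' q' s' \<alpha> \<beta>"
  shows "\<exists>t\<in>module_iso R E E'. (\<forall>y\<in>carrier Y. t (i y) = i' y) \<and> (\<forall>e\<in>carrier E. q' (t e) = q e)"
proof -
  interpret E: ext_section R Y E X i q s \<alpha> \<beta> by fact
  interpret E': ext_section R Y E' X i' q' s' \<alpha> \<beta> by fact
  define t where "t e = i' (E.r e) \<oplus>\<^bsub>E'\<^esub> s' (q e)" for e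
  note simps = E.r_decomp E.q_simps E'.i_simps E'.q_simps E'.s_closed E'.q_s E'.q_i E.alpha_closed E.beta_closed
  have tc: "t e \<in> carrier E'" and rt: "E'.r (t e) = E.r e" and qt: "q' (t e) = q e" if "e \<in> carrier E" for e
    using that by (simp_all add: t_def simps E'.r_unique)
  have hom: "t \<in> module_hom R E E'"
    unfolding module_hom_def
  proof (intro CollectI conjI Pi_I ballI)
    fix e e' assume "e \<in> carrier E" "e' \<in> carrier E"
    then show "t (e \<oplus>\<^bsub>E\<^esub> e') = t e \<oplus>\<^bsub>E'\<^esub> t e'"
      by (intro E'.eqI) (simp_all add: tc rt qt E.r_add E'.r_add E.q_simps E'.q_simps)
  next
    fix a e assume "a \<in> carrier R" "e \<in> carrier E"
    then show "t (a \<odot>\<^bsub>E\<^esub> e) = a \<odot>\<^bsub>E'\<^esub> t e"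
      by (intro E'.eqI) (simp_all add: tc rt qt E.r_smult E'.r_smult E.q_simps E'.q_simps)
  qed (rule tc)
  have bij: "bij_betw t (carrier E) (carrier E')"
    unfolding bij_betw_def
  proof (intro conjI inj_onI equalityI subsetI)
    fix e e' assume "e \<in> carrier E" "e' \<in> carrier E" "t e = t e'"
    then show "e = e'" by (intro E.eqI) (simp_all flip: rt qt)
  next
    fix e assume e: "e \<in> carrier E'"
    have "e = t (i (E'.r e) \<oplus>\<^bsub>E\<^esub> s (q' e))"
      using e by (intro E'.eqI) (simp_all add: rt qt tc E'.r_decomp E'.q_simps E.i_simps E.q_simps E.s_closed E.q_i E.q_s E.r_unique)
    then show "e \<in> t ` carrier E"
      using e by (auto intro!: image_eqI simp: E'.r_decomp E'.q_simps E.i_simps E.s_closed)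
  qed (auto simp: tc)
  show ?thesis
    by (rule bexI[of _ t])
      (use hom bij qt in \<open>auto simp: module_iso_def t_def E.r_i E.q_i E'.s_zero E'.i_simps\<close>)
qed

section \<open>Extensions built from factor sets\<close>

text \<open>The crossed product of \<open>Y\<close> and \<open>X\<close>. Nothing is required of the
  pair (\<alpha>, \<beta>), so this record need not be a module.\<close>

definition factor_ext ::
  "('r, 'x) module \<Rightarrow> ('r, 'y) module \<Rightarrow> ('x \<Rightarrow> 'x \<Rightarrow> 'y) \<Rightarrow> ('r \<Rightarrow> 'x \<Rightarrow> 'y) \<Rightarrow> ('r, 'y, 'x) extn"
where
  "factor_ext X Y \<alpha> \<beta> =
     (\<lparr>carrier = carrier Y \<times> carrier X, mult = undefined, one = undefined,
       zero = (\<zero>\<^bsub>Y\<^esub>, \<zero>\<^bsub>X\<^esub>),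
       add = (\<lambda>(y, x) (y', x'). (y \<oplus>\<^bsub>Y\<^esub> y' \<oplus>\<^bsub>Y\<^esub> \<alpha> x x', x \<oplus>\<^bsub>X\<^esub> x')),
       smult = (\<lambda>a (y, x). (a \<odot>\<^bsub>Y\<^esub> y \<oplus>\<^bsub>Y\<^esub> \<beta> a x, a \<odot>\<^bsub>X\<^esub> x))\<rparr>,
      \<lambda>y. (y, \<zero>\<^bsub>X\<^esub>), snd)"

text \<open>To be read as the name of a class of \<open>Ext1\<close>. Cohomologous pairs give the
  same set, and a pair violating the cocycle identities gives the empty set, so nonemptiness serves
  as the cocycle condition from here on.\<close>

definition factor_class ::
  "'r ring \<Rightarrow> ('r, 'x) module \<Rightarrow> ('r, 'y) module \<Rightarrow> ('x \<Rightarrow> 'x \<Rightarrow> 'y) \<Rightarrow> ('r \<Rightarrow> 'x \<Rightarrow> 'y) \<Rightarrow>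
   ('r, 'y, 'x) extn set"
where
  "factor_class R X Y \<alpha> \<beta> =
     {\<xi>. \<exists>s. ext_section R Y (mid \<xi>) X (incl \<xi>) (proj \<xi>) s \<alpha> \<beta>}"

text \<open>The cocycle identities need not be stated: they follow once the twisted operations are the
  image of those of some module.\<close>

lemma factor_ext_in_class:
  fixes X :: "('r, 'x) module" and Y :: "('r, 'y) module"
    and \<alpha> :: "'x \<Rightarrow> 'x \<Rightarrow> 'y" and \<beta> :: "'r \<Rightarrow> 'x \<Rightarrow> 'y"
  defines "E \<equiv> mid (factor_ext X Y \<alpha> \<beta>)"
  assumes F: "left_module R F" and X: "left_module R X" and Y: "left_module R Y"
    and k: "k \<in> module_hom R F E" and surj: "k ` carrier F = carrier E"
    and zero: "k \<zero>\<^bsub>F\<^esub> = (\<zero>\<^bsub>Y\<^esub>, \<zero>\<^bsub>X\<^esub>)"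
    and \<alpha>: "\<And>x x'. \<lbrakk>x \<in> carrier X; x' \<in> carrier X\<rbrakk> \<Longrightarrow> \<alpha> x x' \<in> carrier Y"
    and \<beta>: "\<And>a x. \<lbrakk>a \<in> carrier R; x \<in> carrier X\<rbrakk> \<Longrightarrow> \<beta> a x \<in> carrier Y"
  shows "factor_ext X Y \<alpha> \<beta> \<in> factor_class R X Y \<alpha> \<beta>"
proof -
  interpret X: left_module R X by fact
  interpret Y: left_module R Y by fact
  have E_simps: "carrier E = carrier Y \<times> carrier X" "\<zero>\<^bsub>E\<^esub> = (\<zero>\<^bsub>Y\<^esub>, \<zero>\<^bsub>X\<^esub>)"
    "\<And>y x y' x'. (y, x) \<oplus>\<^bsub>E\<^esub> (y', x') = (y \<oplus>\<^bsub>Y\<^esub> y' \<oplus>\<^bsub>Y\<^esub> \<alpha> x x', x \<oplus>\<^bsub>X\<^esub> x')"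
    "\<And>a y x. a \<odot>\<^bsub>E\<^esub> (y, x) = (a \<odot>\<^bsub>Y\<^esub> y \<oplus>\<^bsub>Y\<^esub> \<beta> a x, a \<odot>\<^bsub>X\<^esub> x)"
    by (simp_all add: E_def factor_ext_def mid_def)
  have E: "left_module R E"
    by (rule left_module_surjective_image[OF F k surj]) (simp add: zero E_simps)
  interpret E: left_module R E by fact
  \<comment> \<open>The neutral law and the law \<open>a 0 = 0\<close>, read in the twisted module
    \<open>E\<close>, force \<alpha> and \<beta> to be normalised; otherwise
    \<open>y \<mapsto> (y, 0)\<close> would not be linear.\<close>
  have \<alpha>0: "\<alpha> \<zero>\<^bsub>X\<^esub> x = \<zero>\<^bsub>Y\<^esub>" if "x \<in> carrier X" for x
    using E.l_zero[of "(\<zero>\<^bsub>Y\<^esub>, x)"] that by (simp add: E_simps \<alpha>)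
  have \<beta>0: "\<beta> a \<zero>\<^bsub>X\<^esub> = \<zero>\<^bsub>Y\<^esub>" if "a \<in> carrier R" for a
    using E.smult_zero_right[OF that] that
    by (simp add: E_simps \<beta> Y.smult_zero_right)
  have "short_exact R Y (\<lambda>y. (y, \<zero>\<^bsub>X\<^esub>)) E snd X"
    unfolding short_exact_def
  proof (intro conjI X Y E)
    show "(\<lambda>y. (y, \<zero>\<^bsub>X\<^esub>)) \<in> module_hom R Y E"
      by (auto simp: module_hom_def E_simps \<alpha>0 \<beta>0 X.smult_zero_right)
    show "snd \<in> module_hom R E X"
      by (auto simp: module_hom_def E_simps)
    show "snd ` carrier E = carrier X" unfolding E_simps by force
  qed (auto simp: inj_on_def a_kernel_def' E_simps)
  then have "ext_section R Y E X (\<lambda>y. (y, \<zero>\<^bsub>X\<^esub>)) snd (\<lambda>x. (\<zero>\<^bsub>Y\<^esub>, x)) \<alpha> \<beta>"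
    by unfold_locales (auto simp: E_simps \<alpha> \<beta> \<alpha>0 Y.smult_zero_right)
  then show ?thesis
    unfolding factor_class_def E_def by (auto simp: incl_def proj_def factor_ext_def)
qed

lemma factor_class_subset: "factor_class R X Y \<alpha> \<beta> \<subseteq> extensions R X Y"
  unfolding factor_class_def extensions_def by (auto dest: ext_section.exact)

text \<open>Equivalences carry sections across, and equal factor sets produce an equivalence. Hence
  equivalence classes can be handled through functions with values in \<open>Y\<close>.\<close>

lemma ext_class_eq_factor_class:
  assumes "\<xi> \<in> factor_class R X Y \<alpha> \<beta>"
  shows "ext_class R X Y \<xi> = factor_class R X Y \<alpha> \<beta>"
proof -
  obtain s where s: "ext_section R Y (mid \<xi>) X (incl \<xi>) (proj \<xi>) s \<alpha> \<beta>"
    using assms by (auto simp: factor_class_def)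
  show ?thesis
  proof (intro equalityI subsetI)
    fix \<xi>' assume "\<xi>' \<in> ext_class R X Y \<xi>"
    then show "\<xi>' \<in> factor_class R X Y \<alpha> \<beta>"
      unfolding ext_class_def ext_equiv_def factor_class_def extensions_def
      using ext_section_transfer[OF s] by blast
  next
    fix \<xi>' assume \<xi>': "\<xi>' \<in> factor_class R X Y \<alpha> \<beta>"
    then obtain s' where s': "ext_section R Y (mid \<xi>') X (incl \<xi>') (proj \<xi>') s' \<alpha> \<beta>"
      by (auto simp: factor_class_def)
    show "\<xi>' \<in> ext_class R X Y \<xi>"
      using \<xi>' factor_class_subset ext_section_same_factors_iso[OF s s']
      unfolding ext_class_def ext_equiv_def module_iso_def by blast
  qed
qed

lemma factor_class_eqI:
  assumes "\<xi> \<in> factor_class R X Y \<alpha> \<beta>" "\<xi> \<in> factor_class R X Y \<alpha>' \<beta>'"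
  shows "factor_class R X Y \<alpha> \<beta> = factor_class R X Y \<alpha>' \<beta>'"
  using ext_class_eq_factor_class[OF assms(1)] ext_class_eq_factor_class[OF assms(2)] by simp

lemma factor_class_cong:
  assumes \<alpha>: "\<And>x x'. \<lbrakk>x \<in> carrier X; x' \<in> carrier X\<rbrakk> \<Longrightarrow> \<alpha> x x' = \<alpha>' x x'"
    and \<beta>: "\<And>a x. \<lbrakk>a \<in> carrier R; x \<in> carrier X\<rbrakk> \<Longrightarrow> \<beta> a x = \<beta>' a x"
  shows "factor_class R X Y \<alpha> \<beta> = factor_class R X Y \<alpha>' \<beta>'"
proof -
  have "ext_section R Y (mid \<xi>) X (incl \<xi>) (proj \<xi>) s \<alpha> \<beta> \<longleftrightarrow>
      ext_section R Y (mid \<xi>) X (incl \<xi>) (proj \<xi>) s \<alpha>' \<beta>'" for \<xi> s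
    unfolding ext_section_def using \<alpha> \<beta> by auto
  then show ?thesis by (simp add: factor_class_def)
qed

lemma carrier_Ext1:
  "carrier (Ext1 R X Y) = {factor_class R X Y \<alpha> \<beta> | \<alpha> \<beta>. factor_class R X Y \<alpha> \<beta> \<noteq> {}}"
proof (intro equalityI subsetI)
  fix C assume "C \<in> carrier (Ext1 R X Y)"
  then obtain \<xi> where \<xi>: "\<xi> \<in> extensions R X Y" "C = ext_class R X Y \<xi>" by (auto simp: Ext1_def)
  then obtain \<alpha> \<beta> where "\<xi> \<in> factor_class R X Y \<alpha> \<beta>"
    using ext_section_exists[of R Y "incl \<xi>" "mid \<xi>" "proj \<xi>" X]
    unfolding extensions_def factor_class_def by blast
  then show "C \<in> {factor_class R X Y \<alpha> \<beta> | \<alpha> \<beta>. factor_class R X Y \<alpha> \<beta> \<noteq> {}}"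
    using ext_class_eq_factor_class[of \<xi> R X Y \<alpha> \<beta>] \<xi>(2) by blast
next
  fix C assume "C \<in> {factor_class R X Y \<alpha> \<beta> | \<alpha> \<beta>. factor_class R X Y \<alpha> \<beta> \<noteq> {}}"
  then obtain \<alpha> \<beta> \<xi> where "C = factor_class R X Y \<alpha> \<beta>" "\<xi> \<in> factor_class R X Y \<alpha> \<beta>" by blast
  then show "C \<in> carrier (Ext1 R X Y)"
    using factor_class_subset[of R X Y \<alpha> \<beta>] ext_class_eq_factor_class[of \<xi> R X Y \<alpha> \<beta>]
    by (auto simp: Ext1_def)
qed

section \<open>Addition and scalar multiplication of \<open>Ext\<^sup>1\<close> on factor sets\<close>

text \<open>The pair \<open>(s\<^sub>1 x, s\<^sub>2 x)\<close> lies in the fibre product, and its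
  image under \<open>h\<close> is a section. The defect of that section comes from pairs of elements
  of \<open>Y\<close>, which \<open>h\<close> identifies with their sum.\<close>

lemma baer_sum_section:
  assumes e1: "ext_section R Y (mid \<xi>\<^sub>1) X (incl \<xi>\<^sub>1) (proj \<xi>\<^sub>1) s\<^sub>1 \<alpha>\<^sub>1 \<beta>\<^sub>1"
    and e2: "ext_section R Y (mid \<xi>\<^sub>2) X (incl \<xi>\<^sub>2) (proj \<xi>\<^sub>2) s\<^sub>2 \<alpha>\<^sub>2 \<beta>\<^sub>2"
    and bs: "is_baer_sum R Y \<xi>\<^sub>1 \<xi>\<^sub>2 \<xi>" and \<xi>: "\<xi> \<in> extensions R X Y"
  shows "\<xi> \<in> factor_class R X Y (\<lambda>x x'. \<alpha>\<^sub>1 x x' \<oplus>\<^bsub>Y\<^esub> \<alpha>\<^sub>2 x x') (\<lambda>a x. \<beta>\<^sub>1 a x \<oplus>\<^bsub>Y\<^esub> \<beta>\<^sub>2 a x)"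
proof -
  interpret A: ext_section R Y "mid \<xi>\<^sub>1" X "incl \<xi>\<^sub>1" "proj \<xi>\<^sub>1" s\<^sub>1 \<alpha>\<^sub>1 \<beta>\<^sub>1 by fact
  interpret B: ext_section R Y "mid \<xi>\<^sub>2" X "incl \<xi>\<^sub>2" "proj \<xi>\<^sub>2" s\<^sub>2 \<alpha>\<^sub>2 \<beta>\<^sub>2 by fact
  have ex: "short_exact R Y (incl \<xi>) (mid \<xi>) (proj \<xi>) X" using \<xi> by (simp add: extensions_def)
  interpret E: left_module R "mid \<xi>" by (rule short_exactD(2)[OF ex])
  define F where "F = fibre_product (mid \<xi>\<^sub>1) (proj \<xi>\<^sub>1) (mid \<xi>\<^sub>2) (proj \<xi>\<^sub>2)"
  have Fm: "left_module R F"
    unfolding F_def by (rule fibre_product_left_module[OF A.E.left_module_axioms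
        B.E.left_module_axioms A.X.left_module_axioms A.q_hom B.q_hom])
  obtain h where h: "h \<in> module_hom R F (mid \<xi>)"
    and ker: "a_kernel F (mid \<xi>) h = (\<lambda>y. (incl \<xi>\<^sub>1 y, \<ominus>\<^bsub>mid \<xi>\<^sub>2\<^esub> incl \<xi>\<^sub>2 y)) ` carrier Y"
    and hi: "\<And>y. y \<in> carrier Y \<Longrightarrow> incl \<xi> y = h (incl \<xi>\<^sub>1 y, \<zero>\<^bsub>mid \<xi>\<^sub>2\<^esub>)"
    and hp: "\<And>a b. (a, b) \<in> carrier F \<Longrightarrow> proj \<xi> (h (a, b)) = proj \<xi>\<^sub>1 a"
    using bs unfolding is_baer_sum_def Let_def F_def by blast
  have FI: "(a, b) \<in> carrier F \<longleftrightarrow> a \<in> carrier (mid \<xi>\<^sub>1) \<and> b \<in> carrier (mid \<xi>\<^sub>2) \<and> proj \<xi>\<^sub>1 a = proj \<xi>\<^sub>2 b" for a b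
    by (simp add: F_def fibre_product_def)
  have F_simps: "\<And>a b a' b'. (a, b) \<oplus>\<^bsub>F\<^esub> (a', b') = (a \<oplus>\<^bsub>mid \<xi>\<^sub>1\<^esub> a', b \<oplus>\<^bsub>mid \<xi>\<^sub>2\<^esub> b')"
    "\<And>r a b. r \<odot>\<^bsub>F\<^esub> (a, b) = (r \<odot>\<^bsub>mid \<xi>\<^sub>1\<^esub> a, r \<odot>\<^bsub>mid \<xi>\<^sub>2\<^esub> b)"
    "\<zero>\<^bsub>F\<^esub> = (\<zero>\<^bsub>mid \<xi>\<^sub>1\<^esub>, \<zero>\<^bsub>mid \<xi>\<^sub>2\<^esub>)"
    by (simp_all add: F_def fibre_product_def)
  note hs = module_homD[OF h]
  define s where "s x = h (s\<^sub>1 x, s\<^sub>2 x)" for x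
  have sF: "(s\<^sub>1 x, s\<^sub>2 x) \<in> carrier F" if "x \<in> carrier X" for x
    using that by (simp add: FI A.s_closed B.s_closed A.q_s B.q_s)
  have iF: "(incl \<xi>\<^sub>1 y, incl \<xi>\<^sub>2 y') \<in> carrier F" if "y \<in> carrier Y" "y' \<in> carrier Y" for y y'
    using that by (simp add: FI A.i_simps B.i_simps A.q_i B.q_i)
  \<comment> \<open>The pairs \<open>(incl \<xi>\<^sub>1 y, incl \<xi>\<^sub>2 y')\<close> and
    \<open>(incl \<xi>\<^sub>1 (y + y'), 0)\<close> differ by
    \<open>(incl \<xi>\<^sub>1 (-y'), incl \<xi>\<^sub>2 y')\<close>, an element of the antidiagonal
    that \<open>h\<close> kills.\<close>
  have hii: "h (incl \<xi>\<^sub>1 y, incl \<xi>\<^sub>2 y') = incl \<xi> (y \<oplus>\<^bsub>Y\<^esub> y')" if y: "y \<in> carrier Y" "y' \<in> carrier Y" for y y'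
  proof -
    have k: "(incl \<xi>\<^sub>1 (\<ominus>\<^bsub>Y\<^esub> y'), incl \<xi>\<^sub>2 y') \<in> a_kernel F (mid \<xi>) h"
      unfolding ker using y by (intro image_eqI[of _ _ "\<ominus>\<^bsub>Y\<^esub> y'"]) (simp_all add: B.i_simps)
    have "(incl \<xi>\<^sub>1 y, incl \<xi>\<^sub>2 y') =
        (incl \<xi>\<^sub>1 (y \<oplus>\<^bsub>Y\<^esub> y'), \<zero>\<^bsub>mid \<xi>\<^sub>2\<^esub>) \<oplus>\<^bsub>F\<^esub> (incl \<xi>\<^sub>1 (\<ominus>\<^bsub>Y\<^esub> y'), incl \<xi>\<^sub>2 y')"
      using y by (simp add: F_simps A.i_simps B.i_simps A.E.a_assoc A.E.r_neg)
    moreover have "(incl \<xi>\<^sub>1 (y \<oplus>\<^bsub>Y\<^esub> y'), \<zero>\<^bsub>mid \<xi>\<^sub>2\<^esub>) \<in> carrier F"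
      using iF[of "y \<oplus>\<^bsub>Y\<^esub> y'" "\<zero>\<^bsub>Y\<^esub>"] y by (simp add: B.i_simps)
    ultimately show ?thesis
      using y k hi[of "y \<oplus>\<^bsub>Y\<^esub> y'"] by (simp add: hs a_kernel_def' )
  qed
  have "ext_section R Y (mid \<xi>) X (incl \<xi>) (proj \<xi>) s
      (\<lambda>x x'. \<alpha>\<^sub>1 x x' \<oplus>\<^bsub>Y\<^esub> \<alpha>\<^sub>2 x x') (\<lambda>a x. \<beta>\<^sub>1 a x \<oplus>\<^bsub>Y\<^esub> \<beta>\<^sub>2 a x)"
  proof (unfold_locales, rule ex)
    fix x x' assume x: "x \<in> carrier X" "x' \<in> carrier X"
    show "s x \<oplus>\<^bsub>mid \<xi>\<^esub> s x' = incl \<xi> (\<alpha>\<^sub>1 x x' \<oplus>\<^bsub>Y\<^esub> \<alpha>\<^sub>2 x x') \<oplus>\<^bsub>mid \<xi>\<^esub> s (x \<oplus>\<^bsub>X\<^esub> x')"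
      unfolding s_def using x
      by (simp flip: hii hs(2) add: sF iF F_simps A.s_add B.s_add A.alpha_closed B.alpha_closed)
  next
    fix a x assume x: "a \<in> carrier R" "x \<in> carrier X"
    show "a \<odot>\<^bsub>mid \<xi>\<^esub> s x = incl \<xi> (\<beta>\<^sub>1 a x \<oplus>\<^bsub>Y\<^esub> \<beta>\<^sub>2 a x) \<oplus>\<^bsub>mid \<xi>\<^esub> s (a \<odot>\<^bsub>X\<^esub> x)"
      unfolding s_def using x
      by (simp flip: hii hs(2,3) add: sF iF F_simps A.s_smult B.s_smult A.beta_closed B.beta_closed)
  next
    show "s \<zero>\<^bsub>X\<^esub> = \<zero>\<^bsub>mid \<xi>\<^esub>"
      using module_hom_zero_minus(1)[OF h Fm E.left_module_axioms]
      by (simp add: s_def A.s_zero B.s_zero F_simps)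
  qed (simp_all add: s_def hs hp sF A.q_s A.alpha_closed B.alpha_closed A.beta_closed B.beta_closed)
  then show ?thesis by (auto simp: factor_class_def)
qed

text \<open>Converse of \<open>baer_sum_section\<close>, for any given representatives of the two
  classes. The required map adds the two \<open>Y\<close>-coordinates and keeps the common
  \<open>X\<close>-coordinate; it is linear because the defects of \<xi> are the sums of the two
  given ones.\<close>

lemma factor_class_baer_sum:
  assumes e1: "ext_section R Y (mid \<xi>\<^sub>1) X (incl \<xi>\<^sub>1) (proj \<xi>\<^sub>1) s\<^sub>1 \<alpha>\<^sub>1 \<beta>\<^sub>1"
    and e2: "ext_section R Y (mid \<xi>\<^sub>2) X (incl \<xi>\<^sub>2) (proj \<xi>\<^sub>2) s\<^sub>2 \<alpha>\<^sub>2 \<beta>\<^sub>2"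
    and \<xi>: "\<xi> \<in> factor_class R X Y (\<lambda>x x'. \<alpha>\<^sub>1 x x' \<oplus>\<^bsub>Y\<^esub> \<alpha>\<^sub>2 x x') (\<lambda>a x. \<beta>\<^sub>1 a x \<oplus>\<^bsub>Y\<^esub> \<beta>\<^sub>2 a x)"
  shows "is_baer_sum R Y \<xi>\<^sub>1 \<xi>\<^sub>2 \<xi>"
proof -
  obtain s where s: "ext_section R Y (mid \<xi>) X (incl \<xi>) (proj \<xi>) s
      (\<lambda>x x'. \<alpha>\<^sub>1 x x' \<oplus>\<^bsub>Y\<^esub> \<alpha>\<^sub>2 x x') (\<lambda>a x. \<beta>\<^sub>1 a x \<oplus>\<^bsub>Y\<^esub> \<beta>\<^sub>2 a x)"
    using \<xi> by (auto simp: factor_class_def)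
  interpret A: ext_section R Y "mid \<xi>\<^sub>1" X "incl \<xi>\<^sub>1" "proj \<xi>\<^sub>1" s\<^sub>1 \<alpha>\<^sub>1 \<beta>\<^sub>1 by fact
  interpret B: ext_section R Y "mid \<xi>\<^sub>2" X "incl \<xi>\<^sub>2" "proj \<xi>\<^sub>2" s\<^sub>2 \<alpha>\<^sub>2 \<beta>\<^sub>2 by fact
  interpret C: ext_section R Y "mid \<xi>" X "incl \<xi>" "proj \<xi>" s
    "\<lambda>x x'. \<alpha>\<^sub>1 x x' \<oplus>\<^bsub>Y\<^esub> \<alpha>\<^sub>2 x x'" "\<lambda>a x. \<beta>\<^sub>1 a x \<oplus>\<^bsub>Y\<^esub> \<beta>\<^sub>2 a x" by fact
  define F where "F = fibre_product (mid \<xi>\<^sub>1) (proj \<xi>\<^sub>1) (mid \<xi>\<^sub>2) (proj \<xi>\<^sub>2)"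
  have FI: "(a, b) \<in> carrier F \<longleftrightarrow> a \<in> carrier (mid \<xi>\<^sub>1) \<and> b \<in> carrier (mid \<xi>\<^sub>2) \<and> proj \<xi>\<^sub>1 a = proj \<xi>\<^sub>2 b" for a b
    by (simp add: F_def fibre_product_def)
  have F_simps: "\<And>a b a' b'. (a, b) \<oplus>\<^bsub>F\<^esub> (a', b') = (a \<oplus>\<^bsub>mid \<xi>\<^sub>1\<^esub> a', b \<oplus>\<^bsub>mid \<xi>\<^sub>2\<^esub> b')"
    "\<And>r a b. r \<odot>\<^bsub>F\<^esub> (a, b) = (r \<odot>\<^bsub>mid \<xi>\<^sub>1\<^esub> a, r \<odot>\<^bsub>mid \<xi>\<^sub>2\<^esub> b)"
    by (simp_all add: F_def fibre_product_def)
  define h where "h = (\<lambda>(a, b). incl \<xi> (A.r a \<oplus>\<^bsub>Y\<^esub> B.r b) \<oplus>\<^bsub>mid \<xi>\<^esub> s (proj \<xi>\<^sub>1 a))"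
  have hc: "h (a, b) \<in> carrier (mid \<xi>)" and hr: "C.r (h (a, b)) = A.r a \<oplus>\<^bsub>Y\<^esub> B.r b"
    and hq: "proj \<xi> (h (a, b)) = proj \<xi>\<^sub>1 a" if "(a, b) \<in> carrier F" for a b
  proof -
    have "A.r a \<oplus>\<^bsub>Y\<^esub> B.r b \<in> carrier Y" "proj \<xi>\<^sub>1 a \<in> carrier X"
      using that FI[of a b] by (simp_all add: A.r_decomp B.r_decomp A.q_simps(1) B.q_simps(1))
    then show "h (a, b) \<in> carrier (mid \<xi>)" "C.r (h (a, b)) = A.r a \<oplus>\<^bsub>Y\<^esub> B.r b"
      "proj \<xi> (h (a, b)) = proj \<xi>\<^sub>1 a"
      by (simp_all add: h_def C.i_simps(1) C.q_simps(2) C.s_closed C.q_s C.q_i C.r_unique)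
  qed
  have F_add: "(a \<oplus>\<^bsub>mid \<xi>\<^sub>1\<^esub> a', b \<oplus>\<^bsub>mid \<xi>\<^sub>2\<^esub> b') \<in> carrier F" if "(a, b) \<in> carrier F" "(a', b') \<in> carrier F" for a b a' b'
    using that by (simp add: FI A.q_simps B.q_simps)
  have F_smult: "(r \<odot>\<^bsub>mid \<xi>\<^sub>1\<^esub> a, r \<odot>\<^bsub>mid \<xi>\<^sub>2\<^esub> b) \<in> carrier F" if "r \<in> carrier R" "(a, b) \<in> carrier F" for r a b
    using that by (simp add: FI A.q_simps B.q_simps)
  have hom: "h \<in> module_hom R F (mid \<xi>)"
    unfolding module_hom_def
  proof (intro CollectI conjI Pi_I ballI)
    fix u v assume "u \<in> carrier F" "v \<in> carrier F"
    then obtain a b a' b' where u: "u = (a, b)" "v = (a', b')" "(a, b) \<in> carrier F" "(a', b') \<in> carrier F"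
      by (metis surj_pair)
    have "h (a \<oplus>\<^bsub>mid \<xi>\<^sub>1\<^esub> a', b \<oplus>\<^bsub>mid \<xi>\<^sub>2\<^esub> b') = h (a, b) \<oplus>\<^bsub>mid \<xi>\<^esub> h (a', b')"
      using F_add[OF u(3,4)] u(3,4) FI[of a b] FI[of a' b']
      by (intro C.eqI) (simp_all add: hc hr hq C.r_add C.q_simps A.q_simps A.r_add B.r_add A.Y.a_ac
          A.r_decomp B.r_decomp A.alpha_closed B.alpha_closed B.q_simps)
    then show "h (u \<oplus>\<^bsub>F\<^esub> v) = h u \<oplus>\<^bsub>mid \<xi>\<^esub> h v" by (simp add: u F_simps)
  next
    fix r u assume r: "r \<in> carrier R" and "u \<in> carrier F"
    then obtain a b where u: "u = (a, b)" "(a, b) \<in> carrier F" by (metis surj_pair)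
    have "h (r \<odot>\<^bsub>mid \<xi>\<^sub>1\<^esub> a, r \<odot>\<^bsub>mid \<xi>\<^sub>2\<^esub> b) = r \<odot>\<^bsub>mid \<xi>\<^esub> h (a, b)"
      using F_smult[OF r u(2)] u(2) r FI[of a b]
      by (intro C.eqI) (simp_all add: hc hr hq C.r_smult C.q_simps A.q_simps A.r_smult B.r_smult A.Y.a_ac
          A.Y.smult_r_distr A.r_decomp B.r_decomp A.beta_closed B.beta_closed B.q_simps)
    then show "h (r \<odot>\<^bsub>F\<^esub> u) = r \<odot>\<^bsub>mid \<xi>\<^esub> h u" by (simp add: u F_simps)
  qed (use hc in auto)
  have hi: "h (incl \<xi>\<^sub>1 y, incl \<xi>\<^sub>2 y') = incl \<xi> (y \<oplus>\<^bsub>Y\<^esub> y')" if "y \<in> carrier Y" "y' \<in> carrier Y" for y y'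
    using that by (simp add: h_def A.r_i B.r_i A.q_i C.s_zero C.i_simps)
  have surj: "h ` carrier F = carrier (mid \<xi>)"
  proof (intro equalityI subsetI)
    fix e assume e: "e \<in> carrier (mid \<xi>)"
    define x where "x = proj \<xi> e"
    have x: "x \<in> carrier X" using e by (simp add: x_def C.q_simps)
    \<comment> \<open>The preimage carries the whole \<open>Y\<close>-coordinate of \<open>e\<close>
      in its first component; the second component \<open>s\<^sub>2 x\<close> has
      \<open>Y\<close>-coordinate zero.\<close>
    let ?u = "(incl \<xi>\<^sub>1 (C.r e) \<oplus>\<^bsub>mid \<xi>\<^sub>1\<^esub> s\<^sub>1 x, s\<^sub>2 x)"
    have u: "?u \<in> carrier F"
      using e x by (simp add: FI A.q_simps A.i_simps A.s_closed B.s_closed A.q_i A.q_s B.q_s C.r_decomp)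
    have "B.r (s\<^sub>2 x) = \<zero>\<^bsub>Y\<^esub>" using B.r_unique[of "\<zero>\<^bsub>Y\<^esub>" x] x by (simp add: B.i_simps B.s_closed)
    then have "h ?u = e"
      using u e x by (intro C.eqI) (simp_all add: hc hr hq A.r_unique C.r_decomp A.q_simps A.i_simps
          A.s_closed A.q_i A.q_s flip: x_def)
    then show "e \<in> h ` carrier F" using u by (metis imageI)
  qed (use hc in auto)
  have ker: "a_kernel F (mid \<xi>) h = (\<lambda>y. (incl \<xi>\<^sub>1 y, \<ominus>\<^bsub>mid \<xi>\<^sub>2\<^esub> incl \<xi>\<^sub>2 y)) ` carrier Y"
  proof (intro equalityI subsetI)
    fix u assume "u \<in> a_kernel F (mid \<xi>) h"
    then obtain a b where u: "u = (a, b)" "(a, b) \<in> carrier F" "h (a, b) = \<zero>\<^bsub>mid \<xi>\<^esub>"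
      unfolding a_kernel_def' by (cases u) blast
    have ab: "a \<in> carrier (mid \<xi>\<^sub>1)" "b \<in> carrier (mid \<xi>\<^sub>2)" using u by (auto simp: FI)
    have q: "proj \<xi>\<^sub>1 a = \<zero>\<^bsub>X\<^esub>" "proj \<xi>\<^sub>2 b = \<zero>\<^bsub>X\<^esub>"
      using hq[OF u(2)] u FI[of a b] by (simp_all add: C.q_simps)
    have "A.r a \<oplus>\<^bsub>Y\<^esub> B.r b = \<zero>\<^bsub>Y\<^esub>" using hr[OF u(2)] u by (simp add: C.r_zero)
    then have r: "B.r b = \<ominus>\<^bsub>Y\<^esub> A.r a"
      using ab by (metis A.Y.minus_equality A.Y.a_comm A.r_decomp(1) B.r_decomp(1))
    have "a = incl \<xi>\<^sub>1 (A.r a)" using A.r_decomp[OF ab(1)] by (simp add: q A.s_zero A.i_simps)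
    moreover have "b = \<ominus>\<^bsub>mid \<xi>\<^sub>2\<^esub> incl \<xi>\<^sub>2 (A.r a)"
      using B.r_decomp(2)[OF ab(2)] A.r_decomp(1)[OF ab(1)] by (simp add: q B.s_zero B.i_simps r)
    ultimately show "u \<in> (\<lambda>y. (incl \<xi>\<^sub>1 y, \<ominus>\<^bsub>mid \<xi>\<^sub>2\<^esub> incl \<xi>\<^sub>2 y)) ` carrier Y"
      using A.r_decomp(1)[OF ab(1)] unfolding u(1) by (intro image_eqI[of _ _ "A.r a"]) auto
  next
    fix u assume "u \<in> (\<lambda>y. (incl \<xi>\<^sub>1 y, \<ominus>\<^bsub>mid \<xi>\<^sub>2\<^esub> incl \<xi>\<^sub>2 y)) ` carrier Y"
    then obtain y where y: "y \<in> carrier Y" "u = (incl \<xi>\<^sub>1 y, incl \<xi>\<^sub>2 (\<ominus>\<^bsub>Y\<^esub> y))"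
      by (auto simp: B.i_simps)
    then show "u \<in> a_kernel F (mid \<xi>) h"
      using hi[of y "\<ominus>\<^bsub>Y\<^esub> y"]
      by (simp add: a_kernel_def' FI A.i_simps(1) B.i_simps(1) A.q_i B.q_i C.i_simps(4) A.Y.r_neg)
  qed
  have hi0: "incl \<xi> y = h (incl \<xi>\<^sub>1 y, \<zero>\<^bsub>mid \<xi>\<^sub>2\<^esub>)" if "y \<in> carrier Y" for y
    using hi[of y "\<zero>\<^bsub>Y\<^esub>"] that by (simp add: B.i_simps)
  show ?thesis
    unfolding is_baer_sum_def Let_def F_def[symmetric]
    by (rule bexI[OF _ hom]) (use surj ker hi0 hq in auto)
qed

text \<open>Existence of Baer sums. Adding \<open>Y\<close>-coordinates maps the fibre product,
  already known to be a module, onto the crossed product of the summed factor sets, which settles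
  the cocycle identities for them.\<close>

lemma factor_class_sum_nonempty:
  assumes e1: "ext_section R Y E\<^sub>1 X i\<^sub>1 q\<^sub>1 s\<^sub>1 \<alpha>\<^sub>1 \<beta>\<^sub>1" and e2: "ext_section R Y E\<^sub>2 X i\<^sub>2 q\<^sub>2 s\<^sub>2 \<alpha>\<^sub>2 \<beta>\<^sub>2"
  shows "factor_class R X Y (\<lambda>x x'. \<alpha>\<^sub>1 x x' \<oplus>\<^bsub>Y\<^esub> \<alpha>\<^sub>2 x x') (\<lambda>a x. \<beta>\<^sub>1 a x \<oplus>\<^bsub>Y\<^esub> \<beta>\<^sub>2 a x) \<noteq> {}"
proof -
  interpret A: ext_section R Y E\<^sub>1 X i\<^sub>1 q\<^sub>1 s\<^sub>1 \<alpha>\<^sub>1 \<beta>\<^sub>1 by fact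
  interpret B: ext_section R Y E\<^sub>2 X i\<^sub>2 q\<^sub>2 s\<^sub>2 \<alpha>\<^sub>2 \<beta>\<^sub>2 by fact
  define F where "F = fibre_product E\<^sub>1 q\<^sub>1 E\<^sub>2 q\<^sub>2"
  define k where "k = (\<lambda>(a, b). (A.r a \<oplus>\<^bsub>Y\<^esub> B.r b, q\<^sub>1 a))"
  have "factor_ext X Y (\<lambda>x x'. \<alpha>\<^sub>1 x x' \<oplus>\<^bsub>Y\<^esub> \<alpha>\<^sub>2 x x') (\<lambda>a x. \<beta>\<^sub>1 a x \<oplus>\<^bsub>Y\<^esub> \<beta>\<^sub>2 a x) \<in>
      factor_class R X Y (\<lambda>x x'. \<alpha>\<^sub>1 x x' \<oplus>\<^bsub>Y\<^esub> \<alpha>\<^sub>2 x x') (\<lambda>a x. \<beta>\<^sub>1 a x \<oplus>\<^bsub>Y\<^esub> \<beta>\<^sub>2 a x)"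
    (is "?\<xi> \<in> _")
  proof (rule factor_ext_in_class)
    show "left_module R F"
      unfolding F_def by (rule fibre_product_left_module[OF A.E.left_module_axioms
          B.E.left_module_axioms A.X.left_module_axioms A.q_hom B.q_hom])
    show "k \<in> module_hom R F (mid ?\<xi>)"
      by (auto simp: module_hom_def k_def F_def fibre_product_def mid_def factor_ext_def A.r_decomp
          B.r_decomp A.q_simps A.r_add B.r_add A.r_smult B.r_smult A.Y.smult_r_distr A.Y.a_ac B.q_simps
          A.alpha_closed B.alpha_closed A.beta_closed B.beta_closed)
    show "k ` carrier F = carrier (mid ?\<xi>)"
    proof (intro equalityI subsetI)
      fix u assume "u \<in> carrier (mid ?\<xi>)"
      then obtain y x where u: "u = (y, x)" "y \<in> carrier Y" "x \<in> carrier X"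
        by (auto simp: mid_def factor_ext_def)
      have "B.r (s\<^sub>2 x) = \<zero>\<^bsub>Y\<^esub>" using B.r_unique[of "\<zero>\<^bsub>Y\<^esub>" x] u by (simp add: B.i_simps B.s_closed)
      then show "u \<in> k ` carrier F"
        using u by (intro image_eqI[of _ _ "(i\<^sub>1 y \<oplus>\<^bsub>E\<^sub>1\<^esub> s\<^sub>1 x, s\<^sub>2 x)"])
          (auto simp: k_def F_def fibre_product_def A.r_unique A.q_simps A.i_simps A.s_closed B.s_closed
            A.q_i A.q_s B.q_s)
    qed (auto simp: k_def F_def fibre_product_def mid_def factor_ext_def A.r_decomp B.r_decomp A.q_simps B.q_simps)
    show "k \<zero>\<^bsub>F\<^esub> = (\<zero>\<^bsub>Y\<^esub>, \<zero>\<^bsub>X\<^esub>)"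
      by (simp add: k_def F_def fibre_product_def A.r_zero B.r_zero A.q_simps)
  qed (simp_all add: A.X.left_module_axioms A.Y.left_module_axioms A.alpha_closed B.alpha_closed
      A.beta_closed B.beta_closed)
  then show ?thesis by blast
qed

text \<open>The sum in \<open>Ext1\<close> lets both representatives vary. One inclusion holds for
  every choice of them; for the other a fixed choice suffices, since each extension with the summed
  factor sets is a Baer sum of that one pair.\<close>

lemma Ext1_add_factor_class:
  assumes "factor_class R X Y \<alpha>\<^sub>1 \<beta>\<^sub>1 \<noteq> {}" "factor_class R X Y \<alpha>\<^sub>2 \<beta>\<^sub>2 \<noteq> {}"
  shows "factor_class R X Y \<alpha>\<^sub>1 \<beta>\<^sub>1 \<oplus>\<^bsub>Ext1 R X Y\<^esub> factor_class R X Y \<alpha>\<^sub>2 \<beta>\<^sub>2 =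
      factor_class R X Y (\<lambda>x x'. \<alpha>\<^sub>1 x x' \<oplus>\<^bsub>Y\<^esub> \<alpha>\<^sub>2 x x') (\<lambda>a x. \<beta>\<^sub>1 a x \<oplus>\<^bsub>Y\<^esub> \<beta>\<^sub>2 a x)"
    and "factor_class R X Y (\<lambda>x x'. \<alpha>\<^sub>1 x x' \<oplus>\<^bsub>Y\<^esub> \<alpha>\<^sub>2 x x') (\<lambda>a x. \<beta>\<^sub>1 a x \<oplus>\<^bsub>Y\<^esub> \<beta>\<^sub>2 a x) \<noteq> {}"
proof -
  obtain \<xi>\<^sub>1 s\<^sub>1 \<xi>\<^sub>2 s\<^sub>2 where e: "ext_section R Y (mid \<xi>\<^sub>1) X (incl \<xi>\<^sub>1) (proj \<xi>\<^sub>1) s\<^sub>1 \<alpha>\<^sub>1 \<beta>\<^sub>1"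
    "ext_section R Y (mid \<xi>\<^sub>2) X (incl \<xi>\<^sub>2) (proj \<xi>\<^sub>2) s\<^sub>2 \<alpha>\<^sub>2 \<beta>\<^sub>2"
    using assms unfolding factor_class_def by blast
  show "factor_class R X Y (\<lambda>x x'. \<alpha>\<^sub>1 x x' \<oplus>\<^bsub>Y\<^esub> \<alpha>\<^sub>2 x x') (\<lambda>a x. \<beta>\<^sub>1 a x \<oplus>\<^bsub>Y\<^esub> \<beta>\<^sub>2 a x) \<noteq> {}"
    by (rule factor_class_sum_nonempty[OF e])
  show "factor_class R X Y \<alpha>\<^sub>1 \<beta>\<^sub>1 \<oplus>\<^bsub>Ext1 R X Y\<^esub> factor_class R X Y \<alpha>\<^sub>2 \<beta>\<^sub>2 =
      factor_class R X Y (\<lambda>x x'. \<alpha>\<^sub>1 x x' \<oplus>\<^bsub>Y\<^esub> \<alpha>\<^sub>2 x x') (\<lambda>a x. \<beta>\<^sub>1 a x \<oplus>\<^bsub>Y\<^esub> \<beta>\<^sub>2 a x)"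
    (is "?l = ?r")
  proof (intro equalityI subsetI)
    fix \<xi> assume "\<xi> \<in> ?l"
    then obtain \<eta>\<^sub>1 \<eta>\<^sub>2 where \<eta>: "\<xi> \<in> extensions R X Y" "is_baer_sum R Y \<eta>\<^sub>1 \<eta>\<^sub>2 \<xi>"
      "\<eta>\<^sub>1 \<in> factor_class R X Y \<alpha>\<^sub>1 \<beta>\<^sub>1" "\<eta>\<^sub>2 \<in> factor_class R X Y \<alpha>\<^sub>2 \<beta>\<^sub>2"
      by (auto simp: Ext1_def)
    then show "\<xi> \<in> ?r"
      using baer_sum_section[OF _ _ \<eta>(2,1)] by (fastforce simp: factor_class_def[of R X Y \<alpha>\<^sub>1] factor_class_def[of R X Y \<alpha>\<^sub>2])
  next
    fix \<xi> assume \<xi>: "\<xi> \<in> ?r"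
    have "\<xi>\<^sub>1 \<in> factor_class R X Y \<alpha>\<^sub>1 \<beta>\<^sub>1" "\<xi>\<^sub>2 \<in> factor_class R X Y \<alpha>\<^sub>2 \<beta>\<^sub>2"
      using e by (auto simp: factor_class_def)
    then show "\<xi> \<in> ?l"
      using factor_class_baer_sum[OF e \<xi>] subsetD[OF factor_class_subset \<xi>] by (auto simp: Ext1_def)
  qed
qed

text \<open>A section whose factor sets vanish is a homomorphism, hence a splitting, and every
  splitting is such a section.\<close>

lemma zero_Ext1:
  fixes X :: "('r, 'x) module" and Y :: "('r, 'y) module"
  assumes X: "left_module R X" and Y: "left_module R Y"
  shows "\<zero>\<^bsub>Ext1 R X Y\<^esub> = factor_class R X Y (\<lambda>_ _. \<zero>\<^bsub>Y\<^esub>) (\<lambda>_ _. \<zero>\<^bsub>Y\<^esub>)"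
    and "factor_class R X Y (\<lambda>_ _. \<zero>\<^bsub>Y\<^esub>) (\<lambda>_ _. \<zero>\<^bsub>Y\<^esub>) \<noteq> {}"
proof -
  interpret X: left_module R X by fact
  interpret Y: left_module R Y by fact
  let ?\<xi> = "factor_ext X Y (\<lambda>_ _. \<zero>\<^bsub>Y\<^esub>) (\<lambda>_ _. \<zero>\<^bsub>Y\<^esub>)"
  have "?\<xi> \<in> factor_class R X Y (\<lambda>_ _. \<zero>\<^bsub>Y\<^esub>) (\<lambda>_ _. \<zero>\<^bsub>Y\<^esub>)"
  proof (rule factor_ext_in_class)
    \<comment> \<open>Over two zero maps the fibre product is the full product of \<open>Y\<close>
      and \<open>X\<close>, so the module structure is available from the general lemma; the crossed
      product with zero factor sets has the same operations.\<close>
    show "left_module R (fibre_product Y (\<lambda>_. \<zero>\<^bsub>X\<^esub>) X (\<lambda>_. \<zero>\<^bsub>X\<^esub>))"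
      by (rule fibre_product_left_module[OF Y X X]) (auto simp: module_hom_def X.smult_zero_right)
    show "(\<lambda>u. u) \<in> module_hom R (fibre_product Y (\<lambda>_. \<zero>\<^bsub>X\<^esub>) X (\<lambda>_. \<zero>\<^bsub>X\<^esub>)) (mid ?\<xi>)"
      by (auto simp: module_hom_def fibre_product_def mid_def factor_ext_def)
    show "(\<lambda>u. u) ` carrier (fibre_product Y (\<lambda>_. \<zero>\<^bsub>X\<^esub>) X (\<lambda>_. \<zero>\<^bsub>X\<^esub>)) = carrier (mid ?\<xi>)"
      by (auto simp: fibre_product_def mid_def factor_ext_def)
  qed (simp_all add: X Y fibre_product_def)
  then show "factor_class R X Y (\<lambda>_ _. \<zero>\<^bsub>Y\<^esub>) (\<lambda>_ _. \<zero>\<^bsub>Y\<^esub>) \<noteq> {}" by blast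
  have "\<xi> \<in> factor_class R X Y (\<lambda>_ _. \<zero>\<^bsub>Y\<^esub>) (\<lambda>_ _. \<zero>\<^bsub>Y\<^esub>) \<longleftrightarrow> splits R X \<xi>" if "\<xi> \<in> extensions R X Y" for \<xi>
  proof -
    have ex: "short_exact R Y (incl \<xi>) (mid \<xi>) (proj \<xi>) X" using that by (simp add: extensions_def)
    interpret E: left_module R "mid \<xi>" by (rule short_exactD(2)[OF ex])
    have i0: "incl \<xi> \<zero>\<^bsub>Y\<^esub> = \<zero>\<^bsub>mid \<xi>\<^esub>"
      by (rule module_hom_zero_minus(1)[OF short_exactD(4,1,2)[OF ex]])
    show ?thesis
    proof
      assume "\<xi> \<in> factor_class R X Y (\<lambda>_ _. \<zero>\<^bsub>Y\<^esub>) (\<lambda>_ _. \<zero>\<^bsub>Y\<^esub>)"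
      then obtain s where "ext_section R Y (mid \<xi>) X (incl \<xi>) (proj \<xi>) s (\<lambda>_ _. \<zero>\<^bsub>Y\<^esub>) (\<lambda>_ _. \<zero>\<^bsub>Y\<^esub>)"
        by (auto simp: factor_class_def)
      then interpret S: ext_section R Y "mid \<xi>" X "incl \<xi>" "proj \<xi>" s "\<lambda>_ _. \<zero>\<^bsub>Y\<^esub>" "\<lambda>_ _. \<zero>\<^bsub>Y\<^esub>" .
      have "s \<in> module_hom R X (mid \<xi>)"
        by (auto simp: module_hom_def S.s_closed S.s_add S.s_smult i0)
      then show "splits R X \<xi>" unfolding splits_def using S.q_s by blast
    next
      assume "splits R X \<xi>"
      then obtain s where s: "s \<in> module_hom R X (mid \<xi>)" "\<And>x. x \<in> carrier X \<Longrightarrow> proj \<xi> (s x) = x"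
        unfolding splits_def by blast
      have "ext_section R Y (mid \<xi>) X (incl \<xi>) (proj \<xi>) s (\<lambda>_ _. \<zero>\<^bsub>Y\<^esub>) (\<lambda>_ _. \<zero>\<^bsub>Y\<^esub>)"
        by unfold_locales (simp_all add: ex s(2) module_homD[OF s(1)] i0
            module_hom_zero_minus(1)[OF s(1) X E.left_module_axioms])
      then show "\<xi> \<in> factor_class R X Y (\<lambda>_ _. \<zero>\<^bsub>Y\<^esub>) (\<lambda>_ _. \<zero>\<^bsub>Y\<^esub>)" by (auto simp: factor_class_def)
    qed
  qed
  then show "\<zero>\<^bsub>Ext1 R X Y\<^esub> = factor_class R X Y (\<lambda>_ _. \<zero>\<^bsub>Y\<^esub>) (\<lambda>_ _. \<zero>\<^bsub>Y\<^esub>)"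
    using factor_class_subset[of R X Y "\<lambda>_ _. \<zero>\<^bsub>Y\<^esub>" "\<lambda>_ _. \<zero>\<^bsub>Y\<^esub>"] by (auto simp: Ext1_def)
qed

text \<open>Adding \<open>incl \<xi> (h x)\<close> to the section \<open>s x\<close> cancels its
  defects, so the corrected section is a splitting. This criterion later makes the linear
  combination attached to a map into a universal sequence vanish.\<close>

lemma factor_class_coboundary:
  assumes X: "left_module R X" and Y: "left_module R Y"
    and ne: "factor_class R X Y \<alpha> \<beta> \<noteq> {}"
    and h: "\<And>x. x \<in> carrier X \<Longrightarrow> h x \<in> carrier Y"
    and \<alpha>: "\<And>x x'. \<lbrakk>x \<in> carrier X; x' \<in> carrier X\<rbrakk> \<Longrightarrow> h (x \<oplus>\<^bsub>X\<^esub> x') = h x \<oplus>\<^bsub>Y\<^esub> h x' \<oplus>\<^bsub>Y\<^esub> \<alpha> x x'"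
    and \<beta>: "\<And>a x. \<lbrakk>a \<in> carrier R; x \<in> carrier X\<rbrakk> \<Longrightarrow> h (a \<odot>\<^bsub>X\<^esub> x) = a \<odot>\<^bsub>Y\<^esub> h x \<oplus>\<^bsub>Y\<^esub> \<beta> a x"
  shows "factor_class R X Y \<alpha> \<beta> = \<zero>\<^bsub>Ext1 R X Y\<^esub>"
proof -
  obtain \<xi> s where \<xi>: "\<xi> \<in> factor_class R X Y \<alpha> \<beta>"
    and "ext_section R Y (mid \<xi>) X (incl \<xi>) (proj \<xi>) s \<alpha> \<beta>"
    using ne unfolding factor_class_def by blast
  then interpret S: ext_section R Y "mid \<xi>" X "incl \<xi>" "proj \<xi>" s \<alpha> \<beta> by simp
  define s' where "s' x = incl \<xi> (h x) \<oplus>\<^bsub>mid \<xi>\<^esub> s x" for x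
  have "s' \<in> module_hom R X (mid \<xi>)"
    unfolding module_hom_def
  proof (intro CollectI conjI Pi_I ballI)
    fix x x' assume x: "x \<in> carrier X" "x' \<in> carrier X"
    have "s' x \<oplus>\<^bsub>mid \<xi>\<^esub> s' x' = incl \<xi> (h x) \<oplus>\<^bsub>mid \<xi>\<^esub> incl \<xi> (h x') \<oplus>\<^bsub>mid \<xi>\<^esub> (s x \<oplus>\<^bsub>mid \<xi>\<^esub> s x')"
      unfolding s'_def using x by (simp add: S.E.a_ac h S.i_simps S.s_closed)
    also have "\<dots> = s' (x \<oplus>\<^bsub>X\<^esub> x')"
      unfolding s'_def using x
      by (simp add: S.E.a_assoc h S.i_simps S.s_closed S.s_add \<alpha> S.alpha_closed)
    finally show "s' (x \<oplus>\<^bsub>X\<^esub> x') = s' x \<oplus>\<^bsub>mid \<xi>\<^esub> s' x'" ..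
  next
    fix a x assume x: "a \<in> carrier R" "x \<in> carrier X"
    then show "s' (a \<odot>\<^bsub>X\<^esub> x) = a \<odot>\<^bsub>mid \<xi>\<^esub> s' x"
      unfolding s'_def
      by (simp add: S.E.a_assoc S.E.smult_r_distr h S.i_simps S.s_closed S.s_smult \<beta> S.beta_closed)
  qed (simp add: s'_def h S.i_simps S.s_closed)
  then have "splits R X \<xi>"
    unfolding splits_def
    by (rule bexI[rotated]) (simp add: s'_def S.q_simps h S.i_simps S.s_closed S.q_i S.q_s)
  then have "\<xi> \<in> \<zero>\<^bsub>Ext1 R X Y\<^esub>"
    using subsetD[OF factor_class_subset \<xi>] by (simp add: Ext1_def)
  then show ?thesis
    using factor_class_eqI[OF \<xi>] zero_Ext1(1)[OF X Y] by simp
qed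

text \<open>The expansions in \<open>is_basis\<close> involve addition only through
  \<open>finsum\<close>, for which a commutative monoid is enough. Its laws hold pointwise on factor
  sets.\<close>

lemma abelian_monoid_Ext1:
  assumes X: "left_module R X" and Y: "left_module R Y"
  shows "abelian_monoid (Ext1 R X Y)"
proof -
  interpret Y: left_module R Y by fact
  have ex: "\<exists>\<alpha> \<beta>. C = factor_class R X Y \<alpha> \<beta> \<and> factor_class R X Y \<alpha> \<beta> \<noteq> {} \<and>
      (\<forall>x\<in>carrier X. \<forall>x'\<in>carrier X. \<alpha> x x' \<in> carrier Y) \<and>
      (\<forall>a\<in>carrier R. \<forall>x\<in>carrier X. \<beta> a x \<in> carrier Y)"
    if mem: "C \<in> carrier (Ext1 R X Y)" for C
  proof -
    obtain \<alpha> \<beta> where C: "C = factor_class R X Y \<alpha> \<beta>" "factor_class R X Y \<alpha> \<beta> \<noteq> {}"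
      using mem unfolding carrier_Ext1 by blast
    then obtain \<xi> s where "ext_section R Y (mid \<xi>) X (incl \<xi>) (proj \<xi>) s \<alpha> \<beta>"
      unfolding factor_class_def by blast
    then interpret S: ext_section R Y "mid \<xi>" X "incl \<xi>" "proj \<xi>" s \<alpha> \<beta> .
    show ?thesis
      by (intro exI[of _ \<alpha>] exI[of _ \<beta>]) (simp add: C S.alpha_closed S.beta_closed)
  qed
  show ?thesis
  proof (rule abelian_monoidI)
    show "\<zero>\<^bsub>Ext1 R X Y\<^esub> \<in> carrier (Ext1 R X Y)"
      unfolding zero_Ext1(1)[OF X Y] carrier_Ext1 using zero_Ext1(2)[OF X Y] by blast
  next
    fix C D assume CD: "C \<in> carrier (Ext1 R X Y)" "D \<in> carrier (Ext1 R X Y)"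
    obtain \<alpha> \<beta> where C: "C = factor_class R X Y \<alpha> \<beta>" "factor_class R X Y \<alpha> \<beta> \<noteq> {}"
      "\<forall>x\<in>carrier X. \<forall>x'\<in>carrier X. \<alpha> x x' \<in> carrier Y" "\<forall>a\<in>carrier R. \<forall>x\<in>carrier X. \<beta> a x \<in> carrier Y"
      using ex[OF CD(1)] by blast
    obtain \<alpha>' \<beta>' where D: "D = factor_class R X Y \<alpha>' \<beta>'" "factor_class R X Y \<alpha>' \<beta>' \<noteq> {}"
      "\<forall>x\<in>carrier X. \<forall>x'\<in>carrier X. \<alpha>' x x' \<in> carrier Y" "\<forall>a\<in>carrier R. \<forall>x\<in>carrier X. \<beta>' a x \<in> carrier Y"
      using ex[OF CD(2)] by blast
    note CD = Ext1_add_factor_class[OF C(2) D(2)]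
    show "C \<oplus>\<^bsub>Ext1 R X Y\<^esub> D \<in> carrier (Ext1 R X Y)"
      unfolding C(1) D(1) CD(1) carrier_Ext1 using CD(2) by blast
    show "C \<oplus>\<^bsub>Ext1 R X Y\<^esub> D = D \<oplus>\<^bsub>Ext1 R X Y\<^esub> C"
      unfolding C(1) D(1) CD(1) Ext1_add_factor_class(1)[OF D(2) C(2)]
      using C D by (intro factor_class_cong) (auto intro: Y.a_comm)
    fix F assume "F \<in> carrier (Ext1 R X Y)"
    from ex[OF this] obtain \<alpha>'' \<beta>'' where F: "F = factor_class R X Y \<alpha>'' \<beta>''" "factor_class R X Y \<alpha>'' \<beta>'' \<noteq> {}"
      "\<forall>x\<in>carrier X. \<forall>x'\<in>carrier X. \<alpha>'' x x' \<in> carrier Y" "\<forall>a\<in>carrier R. \<forall>x\<in>carrier X. \<beta>'' a x \<in> carrier Y"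
      by blast
    note DF = Ext1_add_factor_class[OF D(2) F(2)]
    show "C \<oplus>\<^bsub>Ext1 R X Y\<^esub> D \<oplus>\<^bsub>Ext1 R X Y\<^esub> F = C \<oplus>\<^bsub>Ext1 R X Y\<^esub> (D \<oplus>\<^bsub>Ext1 R X Y\<^esub> F)"
      unfolding C(1) D(1) F(1) CD(1) DF(1) Ext1_add_factor_class(1)[OF CD(2) F(2)]
        Ext1_add_factor_class(1)[OF C(2) DF(2)]
      using C D F by (intro factor_class_cong) (auto intro: Y.a_assoc)
  next
    fix C assume "C \<in> carrier (Ext1 R X Y)"
    from ex[OF this] obtain \<alpha> \<beta> where C: "C = factor_class R X Y \<alpha> \<beta>" "factor_class R X Y \<alpha> \<beta> \<noteq> {}"
      "\<forall>x\<in>carrier X. \<forall>x'\<in>carrier X. \<alpha> x x' \<in> carrier Y" "\<forall>a\<in>carrier R. \<forall>x\<in>carrier X. \<beta> a x \<in> carrier Y"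
      by blast
    show "\<zero>\<^bsub>Ext1 R X Y\<^esub> \<oplus>\<^bsub>Ext1 R X Y\<^esub> C = C"
      unfolding C(1) zero_Ext1(1)[OF X Y] Ext1_add_factor_class(1)[OF zero_Ext1(2)[OF X Y] C(2)]
      using C by (intro factor_class_cong) auto
  qed
qed

text \<open>The pull-back has the section \<open>x \<mapsto> (s (\<phi> x), x)\<close>, and its
  defects are those of \<open>s\<close> at the arguments \<open>\<phi> x\<close>.\<close>

lemma Ext1_smult_factor_class:
  assumes \<phi>: "\<phi> \<in> module_hom R X X" and ne: "factor_class R X Y \<alpha> \<beta> \<noteq> {}"
  shows "\<phi> \<odot>\<^bsub>Ext1 R X Y\<^esub> factor_class R X Y \<alpha> \<beta> =
      factor_class R X Y (\<lambda>x x'. \<alpha> (\<phi> x) (\<phi> x')) (\<lambda>a x. \<beta> a (\<phi> x))"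
    and "factor_class R X Y (\<lambda>x x'. \<alpha> (\<phi> x) (\<phi> x')) (\<lambda>a x. \<beta> a (\<phi> x)) \<noteq> {}"
proof -
  obtain \<xi>\<^sub>0 s\<^sub>0 where \<xi>\<^sub>0: "\<xi>\<^sub>0 \<in> factor_class R X Y \<alpha> \<beta>"
    and s\<^sub>0: "ext_section R Y (mid \<xi>\<^sub>0) X (incl \<xi>\<^sub>0) (proj \<xi>\<^sub>0) s\<^sub>0 \<alpha> \<beta>"
    using ne unfolding factor_class_def by blast
  interpret A: ext_section R Y "mid \<xi>\<^sub>0" X "incl \<xi>\<^sub>0" "proj \<xi>\<^sub>0" s\<^sub>0 \<alpha> \<beta> by fact
  note \<phi>s = module_homD[OF \<phi>] module_hom_zero_minus[OF \<phi> A.X.left_module_axioms A.X.left_module_axioms]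
  let ?\<alpha> = "\<lambda>x x'. \<alpha> (\<phi> x) (\<phi> x')" and ?\<beta> = "\<lambda>a x. \<beta> a (\<phi> x)"
  define F where "F = fibre_product (mid \<xi>\<^sub>0) (proj \<xi>\<^sub>0) X \<phi>"
  have Fm: "left_module R F"
    unfolding F_def by (rule fibre_product_left_module[OF A.E.left_module_axioms
        A.X.left_module_axioms A.X.left_module_axioms A.q_hom \<phi>])
  have FI: "(e, x) \<in> carrier F \<longleftrightarrow> e \<in> carrier (mid \<xi>\<^sub>0) \<and> x \<in> carrier X \<and> proj \<xi>\<^sub>0 e = \<phi> x" for e x
    by (simp add: F_def fibre_product_def)
  have F_simps: "\<And>a b a' b'. (a, b) \<oplus>\<^bsub>F\<^esub> (a', b') = (a \<oplus>\<^bsub>mid \<xi>\<^sub>0\<^esub> a', b \<oplus>\<^bsub>X\<^esub> b')"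
    "\<And>r a b. r \<odot>\<^bsub>F\<^esub> (a, b) = (r \<odot>\<^bsub>mid \<xi>\<^sub>0\<^esub> a, r \<odot>\<^bsub>X\<^esub> b)" "\<zero>\<^bsub>F\<^esub> = (\<zero>\<^bsub>mid \<xi>\<^sub>0\<^esub>, \<zero>\<^bsub>X\<^esub>)"
    by (simp_all add: F_def fibre_product_def)
  \<comment> \<open>The pull-back of one fixed representative. It shows that the class on the right
    is nonempty and, by comparison of factor sets, is isomorphic to the middle term of each member
    of that class.\<close>
  have Fsec: "ext_section R Y F X (\<lambda>y. (incl \<xi>\<^sub>0 y, \<zero>\<^bsub>X\<^esub>)) snd (\<lambda>x. (s\<^sub>0 (\<phi> x), x)) ?\<alpha> ?\<beta>"
  proof unfold_locales
    show "short_exact R Y (\<lambda>y. (incl \<xi>\<^sub>0 y, \<zero>\<^bsub>X\<^esub>)) F snd X"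
      unfolding short_exact_def
    proof (intro conjI Fm A.X.left_module_axioms A.Y.left_module_axioms)
      show "(\<lambda>y. (incl \<xi>\<^sub>0 y, \<zero>\<^bsub>X\<^esub>)) \<in> module_hom R Y F"
        by (auto simp: module_hom_def FI F_simps A.i_simps A.q_i \<phi>s A.X.smult_zero_right)
      show "snd \<in> module_hom R F X" by (auto simp: module_hom_def FI F_simps)
      show "inj_on (\<lambda>y. (incl \<xi>\<^sub>0 y, \<zero>\<^bsub>X\<^esub>)) (carrier Y)" by (auto simp: inj_on_def A.i_eq_iff)
      have "x \<in> snd ` carrier F" if "x \<in> carrier X" for x
        using that by (intro image_eqI[of _ _ "(s\<^sub>0 (\<phi> x), x)"]) (auto simp: FI A.s_closed \<phi>s A.q_s)
      then show "snd ` carrier F = carrier X" by (auto simp: FI)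
      show "(\<lambda>y. (incl \<xi>\<^sub>0 y, \<zero>\<^bsub>X\<^esub>)) ` carrier Y = a_kernel F X snd"
      proof (intro equalityI subsetI)
        fix u assume "u \<in> a_kernel F X snd"
        then obtain e where e: "u = (e, \<zero>\<^bsub>X\<^esub>)" "e \<in> carrier (mid \<xi>\<^sub>0)" "proj \<xi>\<^sub>0 e = \<zero>\<^bsub>X\<^esub>"
          by (cases u) (auto simp: a_kernel_def' FI \<phi>s)
        then show "u \<in> (\<lambda>y. (incl \<xi>\<^sub>0 y, \<zero>\<^bsub>X\<^esub>)) ` carrier Y"
          using short_exactD(8)[OF A.exact e(2)] by auto
      qed (auto simp: a_kernel_def' FI A.i_simps A.q_i \<phi>s)
    qed
  qed (auto simp: FI F_simps A.s_closed A.q_s \<phi>s A.s_zero A.s_add A.s_smult A.alpha_closed A.beta_closed)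
  then interpret F: ext_section R Y F X "\<lambda>y. (incl \<xi>\<^sub>0 y, \<zero>\<^bsub>X\<^esub>)" snd "\<lambda>x. (s\<^sub>0 (\<phi> x), x)" ?\<alpha> ?\<beta> .
  have "factor_ext X Y ?\<alpha> ?\<beta> \<in> factor_class R X Y ?\<alpha> ?\<beta>"
  proof (rule factor_ext_in_class[OF Fm])
    let ?k = "\<lambda>u. (F.r u, snd u)"
    show "?k \<in> module_hom R F (mid (factor_ext X Y ?\<alpha> ?\<beta>))"
      using F.r_add F.r_smult F.r_decomp(1) F.q_simps
      by (auto simp: module_hom_def mid_def factor_ext_def)
    show "?k ` carrier F = carrier (mid (factor_ext X Y ?\<alpha> ?\<beta>))"
    proof (intro equalityI subsetI)
      fix u assume "u \<in> carrier (mid (factor_ext X Y ?\<alpha> ?\<beta>))"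
      then obtain y x where u: "u = (y, x)" "y \<in> carrier Y" "x \<in> carrier X"
        by (auto simp: mid_def factor_ext_def)
      then show "u \<in> ?k ` carrier F"
        using F.r_unique[of y x] F.i_simps(1)[of y] F.s_closed[of x] F.q_simps(2) F.q_s[of x] F.q_i[of y]
        by (intro image_eqI[of _ _ "(incl \<xi>\<^sub>0 y, \<zero>\<^bsub>X\<^esub>) \<oplus>\<^bsub>F\<^esub> (s\<^sub>0 (\<phi> x), x)"]) auto
    next
      fix u assume "u \<in> ?k ` carrier F"
      then show "u \<in> carrier (mid (factor_ext X Y ?\<alpha> ?\<beta>))"
        using F.r_decomp(1) F.q_simps(1) by (auto simp: mid_def factor_ext_def)
    qed
    show "?k \<zero>\<^bsub>F\<^esub> = (\<zero>\<^bsub>Y\<^esub>, \<zero>\<^bsub>X\<^esub>)" using F.r_zero F.q_simps(4) by simp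
  qed (use F.alpha_closed F.beta_closed A.X.left_module_axioms A.Y.left_module_axioms in auto)
  then show "factor_class R X Y ?\<alpha> ?\<beta> \<noteq> {}" by blast
  show "\<phi> \<odot>\<^bsub>Ext1 R X Y\<^esub> factor_class R X Y \<alpha> \<beta> = factor_class R X Y ?\<alpha> ?\<beta>"
  proof (intro equalityI subsetI)
    fix \<xi>' assume "\<xi>' \<in> \<phi> \<odot>\<^bsub>Ext1 R X Y\<^esub> factor_class R X Y \<alpha> \<beta>"
    then obtain \<xi> where \<xi>': "\<xi>' \<in> extensions R X Y" and \<xi>: "\<xi> \<in> factor_class R X Y \<alpha> \<beta>"
      and pb: "is_ext_pullback R X Y \<phi> \<xi> \<xi>'"
      by (auto simp: Ext1_def)
    obtain s where s: "ext_section R Y (mid \<xi>) X (incl \<xi>) (proj \<xi>) s \<alpha> \<beta>"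
      using \<xi> by (auto simp: factor_class_def)
    interpret S: ext_section R Y "mid \<xi>" X "incl \<xi>" "proj \<xi>" s \<alpha> \<beta> by fact
    have ex: "short_exact R Y (incl \<xi>') (mid \<xi>') (proj \<xi>') X" using \<xi>' by (simp add: extensions_def)
    define G where "G = fibre_product (mid \<xi>) (proj \<xi>) X \<phi>"
    have Gm: "left_module R G"
      unfolding G_def by (rule fibre_product_left_module[OF S.E.left_module_axioms
          A.X.left_module_axioms A.X.left_module_axioms S.q_hom \<phi>])
    obtain h where h: "h \<in> module_hom R G (mid \<xi>')"
      and hi: "\<And>y. y \<in> carrier Y \<Longrightarrow> incl \<xi>' y = h (incl \<xi> y, \<zero>\<^bsub>X\<^esub>)"
      and hp: "\<And>e x. (e, x) \<in> carrier G \<Longrightarrow> proj \<xi>' (h (e, x)) = x"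
      using pb unfolding is_ext_pullback_def Let_def G_def module_iso_def by blast
    have GI: "(e, x) \<in> carrier G \<longleftrightarrow> e \<in> carrier (mid \<xi>) \<and> x \<in> carrier X \<and> proj \<xi> e = \<phi> x" for e x
      by (simp add: G_def fibre_product_def)
    have G_simps: "\<And>a b a' b'. (a, b) \<oplus>\<^bsub>G\<^esub> (a', b') = (a \<oplus>\<^bsub>mid \<xi>\<^esub> a', b \<oplus>\<^bsub>X\<^esub> b')"
      "\<And>r a b. r \<odot>\<^bsub>G\<^esub> (a, b) = (r \<odot>\<^bsub>mid \<xi>\<^esub> a, r \<odot>\<^bsub>X\<^esub> b)" "\<zero>\<^bsub>G\<^esub> = (\<zero>\<^bsub>mid \<xi>\<^esub>, \<zero>\<^bsub>X\<^esub>)"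
      by (simp_all add: G_def fibre_product_def)
    have sG: "(s (\<phi> x), x) \<in> carrier G" if "x \<in> carrier X" for x
      using that by (simp add: GI S.s_closed \<phi>s S.q_s)
    have iG: "(incl \<xi> y, \<zero>\<^bsub>X\<^esub>) \<in> carrier G" if "y \<in> carrier Y" for y
      using that by (simp add: GI S.i_simps \<phi>s S.q_i)
    note hs = module_homD[OF h] module_hom_zero_minus(1)[OF h Gm short_exactD(2)[OF ex]]
    have "ext_section R Y (mid \<xi>') X (incl \<xi>') (proj \<xi>') (\<lambda>x. h (s (\<phi> x), x)) ?\<alpha> ?\<beta>"
    proof (unfold_locales, rule ex)
      fix x x' assume x: "x \<in> carrier X" "x' \<in> carrier X"
      show "h (s (\<phi> x), x) \<oplus>\<^bsub>mid \<xi>'\<^esub> h (s (\<phi> x'), x') =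
          incl \<xi>' (\<alpha> (\<phi> x) (\<phi> x')) \<oplus>\<^bsub>mid \<xi>'\<^esub> h (s (\<phi> (x \<oplus>\<^bsub>X\<^esub> x')), x \<oplus>\<^bsub>X\<^esub> x')"
        using x sG[of "x \<oplus>\<^bsub>X\<^esub> x'"]
        by (simp add: hi S.alpha_closed \<phi>s sG iG G_simps S.s_add flip: hs(2))
    next
      fix a x assume x: "a \<in> carrier R" "x \<in> carrier X"
      show "a \<odot>\<^bsub>mid \<xi>'\<^esub> h (s (\<phi> x), x) =
          incl \<xi>' (\<beta> a (\<phi> x)) \<oplus>\<^bsub>mid \<xi>'\<^esub> h (s (\<phi> (a \<odot>\<^bsub>X\<^esub> x)), a \<odot>\<^bsub>X\<^esub> x)"
        using x sG[of "a \<odot>\<^bsub>X\<^esub> x"]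
        by (simp add: hi S.beta_closed \<phi>s sG iG G_simps S.s_smult flip: hs(2,3))
    next
      show "h (s (\<phi> \<zero>\<^bsub>X\<^esub>), \<zero>\<^bsub>X\<^esub>) = \<zero>\<^bsub>mid \<xi>'\<^esub>"
        using hs(4) by (simp add: G_simps \<phi>s S.s_zero)
    qed (simp_all add: hs(1) sG hp S.alpha_closed S.beta_closed \<phi>s)
    then show "\<xi>' \<in> factor_class R X Y ?\<alpha> ?\<beta>" by (auto simp: factor_class_def)
  next
    fix \<xi>' assume \<xi>': "\<xi>' \<in> factor_class R X Y ?\<alpha> ?\<beta>"
    then obtain s' where "ext_section R Y (mid \<xi>') X (incl \<xi>') (proj \<xi>') s' ?\<alpha> ?\<beta>"
      by (auto simp: factor_class_def)
    from ext_section_same_factors_iso[OF Fsec this] obtain t where t: "t \<in> module_iso R F (mid \<xi>')"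
      "\<And>y. y \<in> carrier Y \<Longrightarrow> t (incl \<xi>\<^sub>0 y, \<zero>\<^bsub>X\<^esub>) = incl \<xi>' y"
      "\<And>u. u \<in> carrier F \<Longrightarrow> proj \<xi>' (t u) = snd u" by blast
    have "is_ext_pullback R X Y \<phi> \<xi>\<^sub>0 \<xi>'"
      unfolding is_ext_pullback_def Let_def F_def[symmetric]
      by (rule bexI[OF _ t(1)]) (use t(2,3) in auto)
    then show "\<xi>' \<in> \<phi> \<odot>\<^bsub>Ext1 R X Y\<^esub> factor_class R X Y \<alpha> \<beta>"
      using subsetD[OF factor_class_subset \<xi>'] \<xi>\<^sub>0 by (auto simp: Ext1_def)
  qed
qed

text \<open>Formula and nonemptiness are proved together because the addition formula in the
  induction step applies to nonempty classes only.\<close>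

lemma finsum_Ext1_factor_class:
  assumes X: "left_module R X" and Y: "left_module R Y" and S: "finite S"
    and ne: "\<And>j. j \<in> S \<Longrightarrow> factor_class R X Y (\<alpha> j) (\<beta> j) \<noteq> {}"
    and \<alpha>: "\<And>j x x'. \<lbrakk>j \<in> S; x \<in> carrier X; x' \<in> carrier X\<rbrakk> \<Longrightarrow> \<alpha> j x x' \<in> carrier Y"
    and \<beta>: "\<And>j a x. \<lbrakk>j \<in> S; a \<in> carrier R; x \<in> carrier X\<rbrakk> \<Longrightarrow> \<beta> j a x \<in> carrier Y"
  shows "finsum (Ext1 R X Y) (\<lambda>j. factor_class R X Y (\<alpha> j) (\<beta> j)) S =
      factor_class R X Y (\<lambda>x x'. finsum Y (\<lambda>j. \<alpha> j x x') S) (\<lambda>a x. finsum Y (\<lambda>j. \<beta> j a x) S) \<and>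
    factor_class R X Y (\<lambda>x x'. finsum Y (\<lambda>j. \<alpha> j x x') S) (\<lambda>a x. finsum Y (\<lambda>j. \<beta> j a x) S) \<noteq> {}"
  using S ne \<alpha> \<beta>
proof (induction S rule: finite_induct)
  case empty
  interpret Y: left_module R Y by fact
  interpret V: abelian_monoid "Ext1 R X Y" by (rule abelian_monoid_Ext1[OF X Y])
  show ?case using zero_Ext1[OF X Y] by simp
next
  case (insert k S)
  interpret Y: left_module R Y by fact
  interpret V: abelian_monoid "Ext1 R X Y" by (rule abelian_monoid_Ext1[OF X Y])
  have mem: "factor_class R X Y (\<alpha> j) (\<beta> j) \<in> carrier (Ext1 R X Y)" if "j \<in> insert k S" for j
    using insert.prems(1)[OF that] unfolding carrier_Ext1 by blast
  have IH: "finsum (Ext1 R X Y) (\<lambda>j. factor_class R X Y (\<alpha> j) (\<beta> j)) S =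
      factor_class R X Y (\<lambda>x x'. finsum Y (\<lambda>j. \<alpha> j x x') S) (\<lambda>a x. finsum Y (\<lambda>j. \<beta> j a x) S)"
    and IHne: "factor_class R X Y (\<lambda>x x'. finsum Y (\<lambda>j. \<alpha> j x x') S) (\<lambda>a x. finsum Y (\<lambda>j. \<beta> j a x) S) \<noteq> {}"
    using insert by auto
  have eq: "factor_class R X Y (\<lambda>x x'. finsum Y (\<lambda>j. \<alpha> j x x') (insert k S)) (\<lambda>a x. finsum Y (\<lambda>j. \<beta> j a x) (insert k S)) =
     factor_class R X Y (\<lambda>x x'. \<alpha> k x x' \<oplus>\<^bsub>Y\<^esub> finsum Y (\<lambda>j. \<alpha> j x x') S) (\<lambda>a x. \<beta> k a x \<oplus>\<^bsub>Y\<^esub> finsum Y (\<lambda>j. \<beta> j a x) S)"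
    using insert by (intro factor_class_cong) (simp_all add: Pi_iff)
  have "finsum (Ext1 R X Y) (\<lambda>j. factor_class R X Y (\<alpha> j) (\<beta> j)) (insert k S) =
      factor_class R X Y (\<alpha> k) (\<beta> k) \<oplus>\<^bsub>Ext1 R X Y\<^esub>
      finsum (Ext1 R X Y) (\<lambda>j. factor_class R X Y (\<alpha> j) (\<beta> j)) S"
    using insert.hyps mem by (intro V.finsum_insert) auto
  then show ?case
    unfolding eq IH using Ext1_add_factor_class[OF insert.prems(1)[of k] IHne] by simp
qed

section \<open>Maps into the middle term of a universal sequence\<close>

text \<open>The generators are the images of the unit vectors. Generation is phrased through
  submodules because it is applied to kernels of components and to preimages of stages of the
  tower.\<close>

lemma finitely_presented_generators:
  assumes "finitely_presented R X"
  shows "\<exists>G. finite G \<and> G \<subseteq> carrier X \<and> (\<forall>N. submodule N R X \<and> G \<subseteq> N \<longrightarrow> N = carrier X)"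
proof -
  obtain n :: nat and g where X: "left_module R X"
    and g: "g \<in> module_hom R (free_module R {..<n}) X"
    and surj: "g ` carrier (free_module R {..<n}) = carrier X"
    using assms unfolding finitely_presented_def by blast
  interpret X: left_module R X by fact
  let ?F = "free_module R {..<n}"
  have F: "carrier ?F = (\<Pi>\<^sub>E i\<in>{..<n}. carrier R)"
    "\<And>v w. v \<oplus>\<^bsub>?F\<^esub> w = (\<lambda>i\<in>{..<n}. v i \<oplus>\<^bsub>R\<^esub> w i)"
    "\<And>a v. a \<odot>\<^bsub>?F\<^esub> v = (\<lambda>i\<in>{..<n}. a \<otimes>\<^bsub>R\<^esub> v i)"
    by (simp_all add: free_module_def direct_sum_def regular_module_def)
  note gs = module_homD[OF g]
  define b where "b j = (\<lambda>i\<in>{..<n}. if i = j then \<one>\<^bsub>R\<^esub> else \<zero>\<^bsub>R\<^esub>)" for j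
  have b: "b j \<in> carrier ?F" for j by (auto simp: F b_def)
  have "N = carrier X" if N: "submodule N R X" and bN: "(\<lambda>j. g (b j)) ` {..<n} \<subseteq> N" for N
  proof -
    note Ns = submoduleD[OF N]
    \<comment> \<open>Induction on a bound \<open>m\<close> for the coordinates that may be nonzero:
      the last of them is split off as a multiple of a unit vector.\<close>
    have "g v \<in> N" if "v \<in> carrier ?F" "m \<le> n" "\<And>i. m \<le> i \<Longrightarrow> i < n \<Longrightarrow> v i = \<zero>\<^bsub>R\<^esub>" for v m
      using that
    proof (induction m arbitrary: v)
      case 0
      have "v = \<zero>\<^bsub>R\<^esub> \<odot>\<^bsub>?F\<^esub> v"
        using 0 unfolding F by (intro extensionalityI[of v "{..<n}"]) (auto simp: PiE_iff)
      then have "g v = \<zero>\<^bsub>R\<^esub> \<odot>\<^bsub>X\<^esub> g v"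
        using gs(3)[of "\<zero>\<^bsub>R\<^esub>" v] 0 by simp
      then show ?case using Ns(2) gs(1)[OF 0(1)] by (simp add: X.smult_zero_left)
    next
      case (Suc m)
      define w where "w = (\<lambda>i\<in>{..<n}. if i = m then \<zero>\<^bsub>R\<^esub> else v i)"
      have vm: "v m \<in> carrier R" using Suc.prems by (auto simp: F)
      have w: "w \<in> carrier ?F" 
        using Suc.prems(1) unfolding F w_def restrict_PiE_iff by (simp add: PiE_iff)
      have vb: "v m \<odot>\<^bsub>?F\<^esub> b m \<in> carrier ?F" using vm b[of m] by (auto simp: F)
      have "v = w \<oplus>\<^bsub>?F\<^esub> (v m \<odot>\<^bsub>?F\<^esub> b m)"
      proof
        fix i
        show "v i = (w \<oplus>\<^bsub>?F\<^esub> (v m \<odot>\<^bsub>?F\<^esub> b m)) i"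
          using Suc.prems(1) vm by (cases "i < n") (auto simp: F w_def b_def PiE_iff extensional_def)
      qed
      then have "g v = g w \<oplus>\<^bsub>X\<^esub> v m \<odot>\<^bsub>X\<^esub> g (b m)"
        using gs(2)[OF w vb] gs(3)[OF vm b] by simp
      moreover have "g w \<in> N"
        using Suc.prems by (intro Suc.IH w) (auto simp: w_def)
      moreover have "g (b m) \<in> N" using bN Suc.prems(2) by auto
      ultimately show ?case using Ns(3,4) vm by simp
    qed
    then have "g v \<in> N" if "v \<in> carrier ?F" for v using that by (metis le_refl not_le)
    then show ?thesis using Ns(1) unfolding surj[symmetric] by blast
  qed
  then show ?thesis
    using gs(1)[OF b] by (intro exI[of _ "(\<lambda>j. g (b j)) ` {..<n}"]) auto
qed

section \<open>Direct sums and the summation map\<close>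

definition dsum_single :: "'i set \<Rightarrow> ('i \<Rightarrow> ('r, 'a) module) \<Rightarrow> 'i \<Rightarrow> 'a \<Rightarrow> 'i \<Rightarrow> 'a" where
  "dsum_single I M k x = (\<lambda>i\<in>I. if i = k then x else \<zero>\<^bsub>M i\<^esub>)"

lemma direct_sum_simps:
  "v \<in> carrier (direct_sum I M) \<longleftrightarrow> v \<in> (\<Pi>\<^sub>E i\<in>I. carrier (M i)) \<and> finite {i \<in> I. v i \<noteq> \<zero>\<^bsub>M i\<^esub>}"
  "\<zero>\<^bsub>direct_sum I M\<^esub> = (\<lambda>i\<in>I. \<zero>\<^bsub>M i\<^esub>)"
  "v \<oplus>\<^bsub>direct_sum I M\<^esub> w = (\<lambda>i\<in>I. v i \<oplus>\<^bsub>M i\<^esub> w i)"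
  "a \<odot>\<^bsub>direct_sum I M\<^esub> v = (\<lambda>i\<in>I. a \<odot>\<^bsub>M i\<^esub> v i)"
  by (simp_all add: direct_sum_def)

lemma dsum_single_hom:
  assumes M: "\<And>i. i \<in> I \<Longrightarrow> left_module R (M i)" and k: "k \<in> I"
  shows "dsum_single I M k \<in> module_hom R (M k) (direct_sum I M)"
proof -
  have z: "\<zero>\<^bsub>M i\<^esub> \<in> carrier (M i)" "\<zero>\<^bsub>M i\<^esub> \<oplus>\<^bsub>M i\<^esub> \<zero>\<^bsub>M i\<^esub> = \<zero>\<^bsub>M i\<^esub>"
    "\<And>a. a \<in> carrier R \<Longrightarrow> a \<odot>\<^bsub>M i\<^esub> \<zero>\<^bsub>M i\<^esub> = \<zero>\<^bsub>M i\<^esub>" if "i \<in> I" for i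
  proof -
    interpret left_module R "M i" by (rule M[OF that])
    show "\<zero>\<^bsub>M i\<^esub> \<in> carrier (M i)" "\<zero>\<^bsub>M i\<^esub> \<oplus>\<^bsub>M i\<^esub> \<zero>\<^bsub>M i\<^esub> = \<zero>\<^bsub>M i\<^esub>"
      "\<And>a. a \<in> carrier R \<Longrightarrow> a \<odot>\<^bsub>M i\<^esub> \<zero>\<^bsub>M i\<^esub> = \<zero>\<^bsub>M i\<^esub>"
      by (simp_all add: smult_zero_right)
  qed
  have "finite {i \<in> I. dsum_single I M k x i \<noteq> \<zero>\<^bsub>M i\<^esub>}" for x
    by (rule finite_subset[of _ "{k}"]) (auto simp: dsum_single_def)
  then show ?thesis
    using z k unfolding module_hom_def direct_sum_simps
    by (auto simp: dsum_single_def direct_sum_simps intro!: restrict_ext)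
qed

lemma module_hom_direct_sum_zero:
  assumes M: "\<And>i. i \<in> I \<Longrightarrow> left_module R (M i)" and D: "left_module R (direct_sum I M)"
    and T: "left_module R T" and h: "h \<in> module_hom R (direct_sum I M) T"
    and single: "\<And>k x. k \<in> I \<Longrightarrow> x \<in> carrier (M k) \<Longrightarrow> h (dsum_single I M k x) = \<zero>\<^bsub>T\<^esub>"
    and v: "v \<in> carrier (direct_sum I M)"
  shows "h v = \<zero>\<^bsub>T\<^esub>"
proof -
  interpret T: left_module R T by fact
  \<comment> \<open>The induction runs over a finite set containing the support rather than over the
    support itself, so that clearing coordinate \<open>k\<close> fits the induction hypothesis
    whatever its value was.\<close>
  have "h v = \<zero>\<^bsub>T\<^esub>" if "finite A" "v \<in> carrier (direct_sum I M)" "{i \<in> I. v i \<noteq> \<zero>\<^bsub>M i\<^esub>} \<subseteq> A" for A v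
    using that
  proof (induction A arbitrary: v rule: finite_induct)
    case empty
    then have "v = \<zero>\<^bsub>direct_sum I M\<^esub>"
      by (auto simp: direct_sum_simps PiE_iff extensional_def)
    then show ?case using module_hom_zero_minus(1)[OF h D T] by simp
  next
    case (insert k A)
    show ?case
    proof (cases "k \<in> I")
      case False
      then show ?thesis using insert.prems by (intro insert.IH) auto
    next
      case True
      define w where "w = (\<lambda>i\<in>I. if i = k then \<zero>\<^bsub>M i\<^esub> else v i)"
      have zc: "\<zero>\<^bsub>M i\<^esub> \<in> carrier (M i)" and lz: "\<And>x. x \<in> carrier (M i) \<Longrightarrow> \<zero>\<^bsub>M i\<^esub> \<oplus>\<^bsub>M i\<^esub> x = x"
        and rz: "\<And>x. x \<in> carrier (M i) \<Longrightarrow> x \<oplus>\<^bsub>M i\<^esub> \<zero>\<^bsub>M i\<^esub> = x" if "i \<in> I" for i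
      proof -
        interpret left_module R "M i" by (rule M[OF that])
        show "\<zero>\<^bsub>M i\<^esub> \<in> carrier (M i)" "\<And>x. x \<in> carrier (M i) \<Longrightarrow> \<zero>\<^bsub>M i\<^esub> \<oplus>\<^bsub>M i\<^esub> x = x"
          "\<And>x. x \<in> carrier (M i) \<Longrightarrow> x \<oplus>\<^bsub>M i\<^esub> \<zero>\<^bsub>M i\<^esub> = x" by simp_all
      qed
      have vi: "v i \<in> carrier (M i)" if "i \<in> I" for i using insert.prems(1) that by (auto simp: direct_sum_simps)
      have fin: "finite {i \<in> I. w i \<noteq> \<zero>\<^bsub>M i\<^esub>}"
        by (rule finite_subset[of _ "insert k A"]) (use insert.prems(2) insert.hyps(1) in \<open>auto simp: w_def\<close>)
      have w: "w \<in> carrier (direct_sum I M)"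
        using fin zc vi by (auto simp: direct_sum_simps w_def)
      have sk: "dsum_single I M k (v k) \<in> carrier (direct_sum I M)"
        by (rule module_homD(1)[OF dsum_single_hom[where R = R and M = M, OF M True] vi[OF True]])
      have "v = w \<oplus>\<^bsub>direct_sum I M\<^esub> dsum_single I M k (v k)"
      proof
        fix i
        show "v i = (w \<oplus>\<^bsub>direct_sum I M\<^esub> dsum_single I M k (v k)) i"
          using insert.prems(1) vi lz rz
          by (cases "i \<in> I") (auto simp: direct_sum_simps w_def dsum_single_def PiE_iff extensional_def)
      qed
      then have "h v = h w \<oplus>\<^bsub>T\<^esub> h (dsum_single I M k (v k))"
        using module_homD(2)[OF h w sk] by simp
      moreover have "h w = \<zero>\<^bsub>T\<^esub>"
      proof (rule insert.IH[OF w])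
        show "{i \<in> I. w i \<noteq> \<zero>\<^bsub>M i\<^esub>} \<subseteq> A" using insert.prems(2) by (auto simp: w_def)
      qed
      ultimately show ?thesis using single[OF True vi[OF True]] by simp
    qed
  qed
  then show ?thesis using v by (auto simp: direct_sum_simps)
qed

text \<open>\<open>summation\<close> runs over the exact support, which changes with the values,
  whereas factor sets have to be added over one index set \<open>S\<close> for all arguments at
  once.\<close>

lemma summation_eq_finsum:
  assumes Y: "left_module R Y" and S: "finite S" "inj_on j S" "j ` S \<subseteq> K"
    and v: "v \<in> K \<rightarrow> carrier Y" and off: "\<And>k. k \<in> K \<Longrightarrow> k \<notin> j ` S \<Longrightarrow> v k = \<zero>\<^bsub>Y\<^esub>"
  shows "summation K Y v = finsum Y (\<lambda>x. v (j x)) S"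
proof -
  interpret Y: left_module R Y by fact
  have "summation K Y v = finsum Y v (j ` S)"
    unfolding summation_def
  proof (rule Y.add.finprod_mono_neutral_cong_left)
    show "{k \<in> K. v k \<noteq> \<zero>\<^bsub>Y\<^esub>} \<subseteq> j ` S" using off by blast
  qed (use S v in auto)
  also have "\<dots> = finsum Y (\<lambda>x. v (j x)) S"
    using S v by (intro Y.finsum_reindex) auto
  finally show ?thesis .
qed

text \<open>
  The connecting map \<open>Hom(Z, \<Oplus> X) \<rightarrow> Ext\<^sup>1(Z, Y)\<close> of a universal sequence is injective, because its
  value at \<open>(\<phi>\<^sub>\<xi>)\<close> is the linear combination of the basis elements \<open>\<xi>\<close> with coefficients \<open>\<phi>\<^sub>\<xi>\<close>.
\<close>

lemma universal_sequence_hom_image: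
  fixes Z :: "('r, 'a) module"
  assumes sb: "semibrick R \<X>" and us: "universal_sequence R \<X> B Y i M p"
    and Z: "Z \<in> \<X>" and f: "f \<in> module_hom R Z M"
  shows "f ` carrier Z \<subseteq> i ` carrier Y"
proof -
  define K where "K = Sigma \<X> B"
  define YK where "YK = direct_sum K (\<lambda>_. Y)"
  define MK where "MK = direct_sum K (\<lambda>(X, \<xi>). mid \<xi>)"
  define XK where "XK = direct_sum K (\<lambda>(X, \<xi>). X)"
  obtain g where ex: "short_exact R Y i M p XK"
    and po: "is_pushout R YK MK Y (direct_sum_map K (\<lambda>(X, \<xi>). incl \<xi>)) (summation K Y) M g i"
    and pg: "\<And>e. e \<in> carrier MK \<Longrightarrow> p (g e) = direct_sum_map K (\<lambda>(X, \<xi>). proj \<xi>) e"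
    and BZ: "B Z \<subseteq> extensions R Z Y"
    and basis: "is_basis (End_ring R Z) (Ext1 R Z Y) (B Z) (ext_class R Z Y)"
    using us Z unfolding universal_sequence_def Let_def K_def YK_def MK_def XK_def by blast
  note exs = short_exactD[OF ex]
  interpret Y: left_module R Y by (rule exs)
  interpret M: left_module R M by (rule exs)
  interpret XK: left_module R XK by (rule exs)
  have Xm: "left_module R X" if "X \<in> \<X>" for X
    using sb that by (auto simp: semibrick_def brick_def finitely_presented_def)
  interpret Z: left_module R Z by (rule Xm[OF Z])
  note pf = module_hom_comp[OF f exs(5)]
  note ins = module_homD[OF exs(4)] module_hom_zero_minus[OF exs(4,1,2)]
  have g: "g \<in> module_hom R MK M" using po by (simp add: is_pushout_def)
  note gs = module_homD[OF g] and fs = module_homD[OF f]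
  have comp: "(\<lambda>z. p (f z) (X, \<xi>)) \<in> module_hom R Z X" if "(X, \<xi>) \<in> K" for X \<xi>
  proof -
    have "p (f z) (X, \<xi>) \<in> carrier X" if "z \<in> carrier Z" for z
      using module_homD(1)[OF pf that] \<open>(X, \<xi>) \<in> K\<close> by (auto simp: XK_def direct_sum_simps PiE_iff)
    then show ?thesis
      using that module_homD(2,3)[OF pf] unfolding module_hom_def by (simp add: XK_def direct_sum_simps)
  qed
  \<comment> \<open>There are no nonzero maps between distinct members of a semibrick, so only the
    summands that are copies of \<open>Z\<close> receive anything from \<open>Z\<close>.\<close>
  have off: "p (f z) (X, \<xi>) = \<zero>\<^bsub>X\<^esub>" if "(X, \<xi>) \<in> K" "X \<noteq> Z" "z \<in> carrier Z" for X \<xi> z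
  proof -
    have "hom_zero R Z X" using sb that(1,2) Z by (auto simp: semibrick_def K_def)
    then have "\<forall>h\<in>module_hom R Z X. \<forall>x\<in>carrier Z. h x = \<zero>\<^bsub>X\<^esub>" by (simp add: hom_zero_def)
    from bspec[OF bspec[OF this comp[OF that(1)]] that(3)] show ?thesis .
  qed
  \<comment> \<open>The components at the copies of \<open>Z\<close>. Both restrictions are there
    for extensionality: the outer one for the coefficient families of \<open>is_basis\<close>, the
    inner one for membership in \<open>End_ring R Z\<close>.\<close>
  define c where "c = (\<lambda>\<xi>\<in>B Z. \<lambda>z\<in>carrier Z. p (f z) (Z, \<xi>))"
  have ZK: "(Z, \<xi>) \<in> K" if "\<xi> \<in> B Z" for \<xi> using that Z by (simp add: K_def)
  have c_hom: "c \<xi> \<in> module_hom R Z Z" if "\<xi> \<in> B Z" for \<xi>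
    using comp[OF ZK[OF that]] that by (auto simp: module_hom_def c_def)
  have c_End: "c \<in> (\<Pi>\<^sub>E \<xi>\<in>B Z. carrier (End_ring R Z))"
    using c_hom by (auto simp: End_ring_def c_def)
  define S where "S = {\<xi> \<in> B Z. c \<xi> \<noteq> \<zero>\<^bsub>End_ring R Z\<^esub>}"
  have S: "finite S"
  proof -
    have "finitely_presented R Z" using sb Z by (simp add: semibrick_def brick_def)
    from finitely_presented_generators[OF this] obtain G where G: "finite G" "G \<subseteq> carrier Z"
      and gen: "\<forall>N. submodule N R Z \<and> G \<subseteq> N \<longrightarrow> N = carrier Z" by blast
    \<comment> \<open>The support of \<open>p (f z)\<close> is finite for each single
      \<open>z\<close>, but \<open>S\<close> has to be finite for all \<open>z\<close> together. A
      component vanishing on the finite generating set \<open>G\<close> vanishes altogether, so the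
      supports at \<open>G\<close> account for all of \<open>S\<close>.\<close>
    define U where "U = (\<Union>z\<in>G. {k \<in> K. p (f z) k \<noteq> \<zero>\<^bsub>fst k\<^esub>})"
    have "finite {k \<in> K. p (f z) k \<noteq> \<zero>\<^bsub>fst k\<^esub>}" if "z \<in> G" for z
      using module_homD(1)[OF pf, of z] that G(2) by (auto simp: XK_def direct_sum_simps case_prod_unfold)
    then have U: "finite U" using G(1) by (auto simp: U_def)
    have "Pair Z ` S \<subseteq> U"
    proof (rule ccontr)
      assume "\<not> Pair Z ` S \<subseteq> U"
      then obtain \<xi> where \<xi>: "\<xi> \<in> B Z" "c \<xi> \<noteq> \<zero>\<^bsub>End_ring R Z\<^esub>" "(Z, \<xi>) \<notin> U" by (auto simp: S_def)
      have zero: "submodule {\<zero>\<^bsub>Z\<^esub>} R Z" by (rule Z.submodule_intro) (auto simp: Z.smult_zero_right)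
      have "{z \<in> carrier Z. c \<xi> z \<in> {\<zero>\<^bsub>Z\<^esub>}} = carrier Z"
      proof (rule gen[rule_format], rule conjI)
        show "submodule {z \<in> carrier Z. c \<xi> z \<in> {\<zero>\<^bsub>Z\<^esub>}} R Z"
          by (rule module_hom_preimage_submodule[OF c_hom[OF \<xi>(1)] Xm[OF Z] Xm[OF Z] zero])
        show "G \<subseteq> {z \<in> carrier Z. c \<xi> z \<in> {\<zero>\<^bsub>Z\<^esub>}}"
          using \<xi>(1,3) G(2) ZK[OF \<xi>(1)] by (auto simp: U_def c_def)
      qed
      then have "c \<xi> z = \<zero>\<^bsub>Z\<^esub>" if "z \<in> carrier Z" for z using that by blast
      then have "c \<xi> = \<zero>\<^bsub>End_ring R Z\<^esub>"
        using \<xi>(1) by (auto simp: End_ring_def c_def intro!: restrict_ext)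
      then show False using \<xi>(2) by simp
    qed
    then have "finite (Pair Z ` S)" using U by (rule finite_subset)
    then show ?thesis by (rule finite_imageD) (simp add: inj_on_def)
  qed
  have SB: "S \<subseteq> B Z" by (auto simp: S_def)
  have c_zero: "p (f z) (Z, \<xi>) = \<zero>\<^bsub>Z\<^esub>" if "\<xi> \<in> B Z" "\<xi> \<notin> S" "z \<in> carrier Z" for \<xi> z
  proof -
    have "c \<xi> z = \<zero>\<^bsub>Z\<^esub>" using that by (simp add: S_def End_ring_def)
    then show ?thesis using that by (simp add: c_def)
  qed
  have "\<forall>\<xi>\<in>B Z. \<exists>t. ext_section R Y (mid \<xi>) Z (incl \<xi>) (proj \<xi>) (fst t) (fst (snd t)) (snd (snd t))"
    using BZ ext_section_exists unfolding extensions_def by fastforce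
  then obtain t where t: "\<And>\<xi>. \<xi> \<in> B Z \<Longrightarrow>
      ext_section R Y (mid \<xi>) Z (incl \<xi>) (proj \<xi>) (fst (t \<xi>)) (fst (snd (t \<xi>))) (snd (snd (t \<xi>)))"
    by metis
  define s where "s \<xi> = fst (t \<xi>)" for \<xi>
  define \<alpha> where "\<alpha> \<xi> = fst (snd (t \<xi>))" for \<xi>
  define \<beta> where "\<beta> \<xi> = snd (snd (t \<xi>))" for \<xi>
  have sec: "ext_section R Y (mid \<xi>) Z (incl \<xi>) (proj \<xi>) (s \<xi>) (\<alpha> \<xi>) (\<beta> \<xi>)" if "\<xi> \<in> B Z" for \<xi>
    using t[OF that] by (simp add: s_def \<alpha>_def \<beta>_def)
  \<comment> \<open>The factor sets of the scalar multiple of the class of \<xi> by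
    \<open>c \<xi>\<close>.\<close>
  let ?\<alpha> = "\<lambda>\<xi> x x'. \<alpha> \<xi> (c \<xi> x) (c \<xi> x')" and ?\<beta> = "\<lambda>\<xi> a x. \<beta> \<xi> a (c \<xi> x)"
  have cc: "c \<xi> z \<in> carrier Z" if "\<xi> \<in> B Z" "z \<in> carrier Z" for \<xi> z
    using module_homD(1)[OF c_hom] that by blast
  have \<alpha>c: "?\<alpha> \<xi> x x' \<in> carrier Y" if "\<xi> \<in> B Z" "x \<in> carrier Z" "x' \<in> carrier Z" for \<xi> x x'
    using ext_section.alpha_closed[OF sec[OF that(1)]] cc that by blast
  have \<beta>c: "?\<beta> \<xi> a x \<in> carrier Y" if "\<xi> \<in> B Z" "a \<in> carrier R" "x \<in> carrier Z" for \<xi> a x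
    using ext_section.beta_closed[OF sec[OF that(1)]] cc that by blast
  have mid_module: "left_module R (mid (snd k))" if "k \<in> K" for k
    using us that unfolding universal_sequence_def K_def extensions_def
    by (fastforce dest: short_exactD(2))
  have incl_hom: "incl (snd k) \<in> module_hom R Y (mid (snd k))" if "k \<in> K" for k
    using us that unfolding universal_sequence_def K_def extensions_def
    by (fastforce dest: short_exactD(4))
  have proj_hom: "proj (snd k) \<in> module_hom R (mid (snd k)) (fst k)" if "k \<in> K" for k
    using us that unfolding universal_sequence_def K_def extensions_def
    by (fastforce dest: short_exactD(5))
  have K_X: "left_module R (fst k)" if "k \<in> K" for k using that Xm by (auto simp: K_def)
  \<comment> \<open>The finitely many indices with a nonzero component. The families below are zero
    at all other indices, which puts them into the direct sums.\<close>
  define on where "on k \<longleftrightarrow> fst k = Z \<and> snd k \<in> S" for k :: "('r, 'a) module \<times> ('r, _, 'a) extn"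
  have on_finite: "finite {k. on k}"
    by (rule finite_subset[of _ "Pair Z ` S"]) (use S in \<open>auto simp: on_def image_iff\<close>)
  \<comment> \<open>\<open>A u\<close> places the values of \<open>u\<close> in the copies of
    \<open>Y\<close>, and \<open>iA u\<close> is its image among the middle terms. In the push-out
    this image is identified with the sum of the values.\<close>
  define A where "A u = (\<lambda>k\<in>K. if on k then u (snd k) else \<zero>\<^bsub>Y\<^esub>)" for u
  define iA where "iA u = (\<lambda>k\<in>K. if on k then incl (snd k) (u (snd k)) else \<zero>\<^bsub>mid (snd k)\<^esub>)" for u
  have iA: "iA u \<in> carrier MK" "g (iA u) = i (finsum Y u S)" if u: "u \<in> S \<rightarrow> carrier Y" for u
  proof -
    have AYK: "A u \<in> carrier YK"
      unfolding YK_def direct_sum_simps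
    proof
      show "A u \<in> K \<rightarrow>\<^sub>E carrier Y" using u by (auto simp: A_def on_def)
      show "finite {k \<in> K. A u k \<noteq> \<zero>\<^bsub>Y\<^esub>}"
        by (rule finite_subset[OF _ on_finite]) (auto simp: A_def)
    qed
    have dA: "direct_sum_map K (\<lambda>(X, \<xi>). incl \<xi>) (A u) = iA u"
      unfolding direct_sum_map_def iA_def
    proof (rule restrict_ext)
      fix k assume k: "k \<in> K"
      have "incl (snd k) \<zero>\<^bsub>Y\<^esub> = \<zero>\<^bsub>mid (snd k)\<^esub>"
        by (rule module_hom_zero_minus(1)[OF incl_hom[OF k] exs(1) mid_module[OF k]])
      then show "(case k of (X, \<xi>) \<Rightarrow> incl \<xi>) (A u k) =
          (if on k then incl (snd k) (u (snd k)) else \<zero>\<^bsub>mid (snd k)\<^esub>)"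
        using k by (simp add: A_def case_prod_unfold)
    qed
    show MK: "iA u \<in> carrier MK"
    proof -
      have "iA u k \<in> carrier (mid (snd k))" if k: "k \<in> K" for k
      proof -
        interpret left_module R "mid (snd k)" by (rule mid_module[OF k])
        show ?thesis using k u module_homD(1)[OF incl_hom[OF k]] by (auto simp: iA_def on_def)
      qed
      moreover have "finite {k \<in> K. iA u k \<noteq> \<zero>\<^bsub>mid (snd k)\<^esub>}"
        by (rule finite_subset[OF _ on_finite]) (auto simp: iA_def)
      ultimately show ?thesis
        by (simp add: MK_def direct_sum_simps case_prod_unfold iA_def PiE_iff)
    qed
    have sumA: "summation K Y (A u) = finsum Y u S"
    proof -
      have "summation K Y (A u) = finsum Y (\<lambda>\<xi>. A u (Z, \<xi>)) S"
        using S SB ZK u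
        by (intro summation_eq_finsum[OF exs(1)]) (auto simp: A_def on_def inj_on_def image_iff)
      also have "\<dots> = finsum Y u S"
        using S SB ZK u by (intro Y.finsum_cong') (auto simp: A_def on_def)
      finally show ?thesis .
    qed
    have uS: "finsum Y u S \<in> carrier Y" using u by (rule Y.finsum_closed)
    \<comment> \<open>The zero criterion of the push-out, read from right to left with
      \<open>A u\<close> as the element of \<open>YK\<close>.\<close>
    have "g (iA u) \<oplus>\<^bsub>M\<^esub> i (\<ominus>\<^bsub>Y\<^esub> finsum Y u S) = \<zero>\<^bsub>M\<^esub>"
    proof -
      have "\<forall>b\<in>carrier MK. \<forall>c\<in>carrier Y. g b \<oplus>\<^bsub>M\<^esub> i c = \<zero>\<^bsub>M\<^esub> \<longleftrightarrow>
          (\<exists>a\<in>carrier YK. b = direct_sum_map K (\<lambda>(X, \<xi>). incl \<xi>) a \<and> c = \<ominus>\<^bsub>Y\<^esub> summation K Y a)"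
        using po by (simp add: is_pushout_def)
      note iff = bspec[OF bspec[OF this MK] Y.a_inv_closed[OF uS]]
      show ?thesis by (rule iff[THEN iffD2], rule bexI[OF _ AYK]) (simp add: dA sumA)
    qed
    then have d: "g (iA u) \<ominus>\<^bsub>M\<^esub> i (finsum Y u S) = \<zero>\<^bsub>M\<^esub>"
      using uS by (simp add: ins a_minus_def)
    show "g (iA u) = i (finsum Y u S)"
      by (rule M.minus_zero_imp_eq[OF gs(1)[OF MK] ins(1)[OF uS] d])
  qed
  \<comment> \<open>A lift of \<open>p (f z)\<close> through the chosen sections. It is not linear
    in \<open>z\<close>; its defects are the families \<open>iA\<close> of pulled-back factor sets,
    see \<open>e_add\<close> and \<open>e_smult\<close>.\<close>
  define e where "e z = (\<lambda>k\<in>K. if on k then s (snd k) (c (snd k) z) else \<zero>\<^bsub>mid (snd k)\<^esub>)" for z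
  have e: "e z \<in> carrier MK" if z: "z \<in> carrier Z" for z
  proof -
    have "e z k \<in> carrier (mid (snd k))" if k: "k \<in> K" for k
    proof -
      interpret left_module R "mid (snd k)" by (rule mid_module[OF k])
      show ?thesis
      proof (cases "on k")
        case True
        then have \<xi>: "snd k \<in> B Z" using SB by (auto simp: on_def)
        show ?thesis
          using k True ext_section.s_closed[OF sec[OF \<xi>] cc[OF \<xi> z]] by (simp add: e_def)
      qed (simp add: e_def k)
    qed
    moreover have "finite {k \<in> K. e z k \<noteq> \<zero>\<^bsub>mid (snd k)\<^esub>}"
      by (rule finite_subset[OF _ on_finite]) (auto simp: e_def)
    ultimately show ?thesis
      by (simp add: MK_def direct_sum_simps case_prod_unfold e_def PiE_iff)
  qed
  have pge: "p (g (e z)) = p (f z)" if z: "z \<in> carrier Z" for z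
  proof
    fix k
    have XKz: "p (f z) \<in> carrier XK" by (rule module_homD(1)[OF pf z])
    show "p (g (e z)) k = p (f z) k"
    proof (cases "k \<in> K")
      case False
      moreover have "p (f z) k = undefined"
        using XKz False unfolding XK_def direct_sum_simps by (blast intro: PiE_arb)
      ultimately show ?thesis by (simp add: pg[OF e[OF z]] direct_sum_map_def)
    next
      case True
      obtain X \<xi> where k: "k = (X, \<xi>)" by (cases k) blast
      have p0: "proj \<xi> \<zero>\<^bsub>mid \<xi>\<^esub> = \<zero>\<^bsub>X\<^esub>"
        using module_hom_zero_minus(1)[OF proj_hom[OF True] mid_module[OF True] K_X[OF True]] k by simp
      have "p (g (e z)) k = proj \<xi> (e z k)"
        using True k by (simp add: pg[OF e[OF z]] direct_sum_map_def)
      also have "\<dots> = p (f z) k"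
      proof (cases "X = Z")
        case False
        then show ?thesis using True k off[of X \<xi> z] z p0 by (simp add: e_def on_def)
      next
        case XZ: True
        then have \<xi>: "\<xi> \<in> B Z" using True k by (simp add: K_def)
        show ?thesis
        proof (cases "\<xi> \<in> S")
          case False
          then show ?thesis using True k XZ c_zero[OF \<xi> False z] p0 by (simp add: e_def on_def)
        next
          case True
          have "proj \<xi> (s \<xi> (c \<xi> z)) = c \<xi> z"
            by (rule ext_section.q_s[OF sec[OF \<xi>] cc[OF \<xi> z]])
          then show ?thesis using \<open>k \<in> K\<close> k XZ True \<xi> z by (simp add: e_def on_def c_def)
        qed
      qed
      finally show ?thesis .
    qed
  qed
  \<comment> \<open>\<open>f z\<close> and \<open>g (e z)\<close> agree under \<open>p\<close>, so
    by exactness they differ by an element of \<open>Y\<close>; choosing it for every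
    \<open>z\<close> gives the non-linear function \<open>h\<close>.\<close>
  have "\<exists>y\<in>carrier Y. f z = i y \<oplus>\<^bsub>M\<^esub> g (e z)" if z: "z \<in> carrier Z" for z
  proof -
    note cl = fs(1)[OF z] gs(1)[OF e[OF z]]
    have "p (f z \<ominus>\<^bsub>M\<^esub> g (e z)) = \<zero>\<^bsub>XK\<^esub>"
      using cl module_homD[OF exs(5)]
      by (simp add: a_minus_def module_hom_zero_minus[OF exs(5,2,3)] pge[OF z] XK.r_neg)
    then obtain y where "y \<in> carrier Y" "f z \<ominus>\<^bsub>M\<^esub> g (e z) = i y"
      using exs(8)[of "f z \<ominus>\<^bsub>M\<^esub> g (e z)"] cl by auto
    moreover have "f z = (f z \<ominus>\<^bsub>M\<^esub> g (e z)) \<oplus>\<^bsub>M\<^esub> g (e z)"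
      using cl by (simp add: a_minus_def M.a_assoc M.l_neg)
    ultimately show ?thesis by metis
  qed
  then obtain h where h: "\<And>z. z \<in> carrier Z \<Longrightarrow> h z \<in> carrier Y"
    "\<And>z. z \<in> carrier Z \<Longrightarrow> f z = i (h z) \<oplus>\<^bsub>M\<^esub> g (e z)" by metis
  have e_add: "e z \<oplus>\<^bsub>MK\<^esub> e z' = iA (\<lambda>\<xi>. ?\<alpha> \<xi> z z') \<oplus>\<^bsub>MK\<^esub> e (z \<oplus>\<^bsub>Z\<^esub> z')"
    if z: "z \<in> carrier Z" "z' \<in> carrier Z" for z z'
    unfolding MK_def direct_sum_simps
  proof (rule restrict_ext)
    fix k assume k: "k \<in> K"
    interpret E: left_module R "mid (snd k)" by (rule mid_module[OF k])
    show "e z k \<oplus>\<^bsub>case k of (X, \<xi>) \<Rightarrow> mid \<xi>\<^esub> e z' k =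
        iA (\<lambda>\<xi>. ?\<alpha> \<xi> z z') k \<oplus>\<^bsub>case k of (X, \<xi>) \<Rightarrow> mid \<xi>\<^esub> e (z \<oplus>\<^bsub>Z\<^esub> z') k"
    proof (cases "on k")
      case False
      then show ?thesis using k by (simp add: e_def iA_def case_prod_unfold)
    next
      case True
      then have \<xi>: "snd k \<in> B Z" using SB by (auto simp: on_def)
      have "s (snd k) (c (snd k) z) \<oplus>\<^bsub>mid (snd k)\<^esub> s (snd k) (c (snd k) z') =
          incl (snd k) (?\<alpha> (snd k) z z') \<oplus>\<^bsub>mid (snd k)\<^esub> s (snd k) (c (snd k) (z \<oplus>\<^bsub>Z\<^esub> z'))"
        using ext_section.s_add[OF sec[OF \<xi>] cc[OF \<xi> z(1)] cc[OF \<xi> z(2)]]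
          module_homD(2)[OF c_hom[OF \<xi>] z] by simp
      then show ?thesis using k True by (simp add: e_def iA_def case_prod_unfold)
    qed
  qed
  have e_smult: "a \<odot>\<^bsub>MK\<^esub> e z = iA (\<lambda>\<xi>. ?\<beta> \<xi> a z) \<oplus>\<^bsub>MK\<^esub> e (a \<odot>\<^bsub>Z\<^esub> z)"
    if a: "a \<in> carrier R" and z: "z \<in> carrier Z" for a z
    unfolding MK_def direct_sum_simps
  proof (rule restrict_ext)
    fix k assume k: "k \<in> K"
    interpret E: left_module R "mid (snd k)" by (rule mid_module[OF k])
    show "a \<odot>\<^bsub>case k of (X, \<xi>) \<Rightarrow> mid \<xi>\<^esub> e z k =
        iA (\<lambda>\<xi>. ?\<beta> \<xi> a z) k \<oplus>\<^bsub>case k of (X, \<xi>) \<Rightarrow> mid \<xi>\<^esub> e (a \<odot>\<^bsub>Z\<^esub> z) k"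
    proof (cases "on k")
      case False
      then show ?thesis using k a by (simp add: e_def iA_def case_prod_unfold E.smult_zero_right)
    next
      case True
      then have \<xi>: "snd k \<in> B Z" using SB by (auto simp: on_def)
      have "a \<odot>\<^bsub>mid (snd k)\<^esub> s (snd k) (c (snd k) z) =
          incl (snd k) (?\<beta> (snd k) a z) \<oplus>\<^bsub>mid (snd k)\<^esub> s (snd k) (c (snd k) (a \<odot>\<^bsub>Z\<^esub> z))"
        using ext_section.s_smult[OF sec[OF \<xi>] a cc[OF \<xi> z]]
          module_homD(3)[OF c_hom[OF \<xi>] a z] by simp
      then show ?thesis using k True by (simp add: e_def iA_def case_prod_unfold)
    qed
  qed
  have i_cancel: "y = y'" if "y \<in> carrier Y" "y' \<in> carrier Y" "m \<in> carrier M"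
    "i y \<oplus>\<^bsub>M\<^esub> m = i y' \<oplus>\<^bsub>M\<^esub> m" for y y' m
    using that inj_onD[OF exs(6)] by (simp add: ins)
  \<comment> \<open>\<open>f\<close> is additive while \<open>e\<close> is not. After cancelling the
    term in \<open>e (z + z')\<close> and the injective \<open>i\<close>, the defect of
    \<open>e\<close> reappears as the defect of \<open>h\<close>.\<close>
  have h_add: "h (z \<oplus>\<^bsub>Z\<^esub> z') = h z \<oplus>\<^bsub>Y\<^esub> h z' \<oplus>\<^bsub>Y\<^esub> finsum Y (\<lambda>\<xi>. ?\<alpha> \<xi> z z') S"
    if z: "z \<in> carrier Z" "z' \<in> carrier Z" for z z'
  proof -
    have zz: "z \<oplus>\<^bsub>Z\<^esub> z' \<in> carrier Z" using z by simp
    have u: "(\<lambda>\<xi>. ?\<alpha> \<xi> z z') \<in> S \<rightarrow> carrier Y" using \<alpha>c z SB by blast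
    note cl = h(1)[OF z(1)] h(1)[OF z(2)] h(1)[OF zz] gs(1)[OF e[OF z(1)]] gs(1)[OF e[OF z(2)]]
      gs(1)[OF e[OF zz]] Y.finsum_closed[OF u]
    have "i (h (z \<oplus>\<^bsub>Z\<^esub> z')) \<oplus>\<^bsub>M\<^esub> g (e (z \<oplus>\<^bsub>Z\<^esub> z')) = f z \<oplus>\<^bsub>M\<^esub> f z'"
      using h(2)[OF zz] fs(2)[OF z] by simp
    also have "\<dots> = i (h z) \<oplus>\<^bsub>M\<^esub> i (h z') \<oplus>\<^bsub>M\<^esub> (g (e z) \<oplus>\<^bsub>M\<^esub> g (e z'))"
      unfolding h(2)[OF z(1)] h(2)[OF z(2)] using cl by (simp add: ins(1) M.a_ac)
    also have "g (e z) \<oplus>\<^bsub>M\<^esub> g (e z') = i (finsum Y (\<lambda>\<xi>. ?\<alpha> \<xi> z z') S) \<oplus>\<^bsub>M\<^esub> g (e (z \<oplus>\<^bsub>Z\<^esub> z'))"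
      unfolding gs(2)[OF e[OF z(1)] e[OF z(2)], symmetric] e_add[OF z]
      using gs(2)[OF iA(1)[OF u] e[OF zz]] iA(2)[OF u] by simp
    also have "i (h z) \<oplus>\<^bsub>M\<^esub> i (h z') \<oplus>\<^bsub>M\<^esub> \<dots> =
        i (h z \<oplus>\<^bsub>Y\<^esub> h z' \<oplus>\<^bsub>Y\<^esub> finsum Y (\<lambda>\<xi>. ?\<alpha> \<xi> z z') S) \<oplus>\<^bsub>M\<^esub> g (e (z \<oplus>\<^bsub>Z\<^esub> z'))"
      using cl by (simp add: ins(1,2) M.a_assoc)
    finally show ?thesis using cl by (intro i_cancel) auto
  qed
  have h_smult: "h (a \<odot>\<^bsub>Z\<^esub> z) = a \<odot>\<^bsub>Y\<^esub> h z \<oplus>\<^bsub>Y\<^esub> finsum Y (\<lambda>\<xi>. ?\<beta> \<xi> a z) S"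
    if a: "a \<in> carrier R" and z: "z \<in> carrier Z" for a z
  proof -
    have az: "a \<odot>\<^bsub>Z\<^esub> z \<in> carrier Z" using a z by simp
    have u: "(\<lambda>\<xi>. ?\<beta> \<xi> a z) \<in> S \<rightarrow> carrier Y" using \<beta>c a z SB by blast
    note cl = a h(1)[OF z] h(1)[OF az] gs(1)[OF e[OF z]] gs(1)[OF e[OF az]] Y.finsum_closed[OF u]
    have "i (h (a \<odot>\<^bsub>Z\<^esub> z)) \<oplus>\<^bsub>M\<^esub> g (e (a \<odot>\<^bsub>Z\<^esub> z)) = a \<odot>\<^bsub>M\<^esub> f z"
      using h(2)[OF az] fs(3)[OF a z] by simp
    also have "\<dots> = a \<odot>\<^bsub>M\<^esub> i (h z) \<oplus>\<^bsub>M\<^esub> a \<odot>\<^bsub>M\<^esub> g (e z)"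
      unfolding h(2)[OF z] using cl by (simp add: ins(1) M.smult_r_distr)
    also have "a \<odot>\<^bsub>M\<^esub> g (e z) = i (finsum Y (\<lambda>\<xi>. ?\<beta> \<xi> a z) S) \<oplus>\<^bsub>M\<^esub> g (e (a \<odot>\<^bsub>Z\<^esub> z))"
      unfolding gs(3)[OF a e[OF z], symmetric] e_smult[OF a z]
      using gs(2)[OF iA(1)[OF u] e[OF az]] iA(2)[OF u] by simp
    also have "a \<odot>\<^bsub>M\<^esub> i (h z) \<oplus>\<^bsub>M\<^esub> \<dots> =
        i (a \<odot>\<^bsub>Y\<^esub> h z \<oplus>\<^bsub>Y\<^esub> finsum Y (\<lambda>\<xi>. ?\<beta> \<xi> a z) S) \<oplus>\<^bsub>M\<^esub> g (e (a \<odot>\<^bsub>Z\<^esub> z))"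
      using cl by (simp add: ins(1-3) M.a_assoc)
    finally show ?thesis using cl by (intro i_cancel) auto
  qed
  interpret V: abelian_monoid "Ext1 R Z Y" by (rule abelian_monoid_Ext1[OF Xm[OF Z] exs(1)])
  have fc: "\<xi> \<in> factor_class R Z Y (\<alpha> \<xi>) (\<beta> \<xi>)" if "\<xi> \<in> B Z" for \<xi>
    using sec[OF that] unfolding factor_class_def by blast
  have sm: "c \<xi> \<odot>\<^bsub>Ext1 R Z Y\<^esub> ext_class R Z Y \<xi> = factor_class R Z Y (?\<alpha> \<xi>) (?\<beta> \<xi>)"
    and ne: "factor_class R Z Y (?\<alpha> \<xi>) (?\<beta> \<xi>) \<noteq> {}" if "\<xi> \<in> B Z" for \<xi>
    using fc[OF that] Ext1_smult_factor_class[OF c_hom[OF that], of Y "\<alpha> \<xi>" "\<beta> \<xi>"]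
    unfolding ext_class_eq_factor_class[OF fc[OF that]] by blast+
  have fsum: "finsum (Ext1 R Z Y) (\<lambda>\<xi>. factor_class R Z Y (?\<alpha> \<xi>) (?\<beta> \<xi>)) S =
      factor_class R Z Y (\<lambda>x x'. finsum Y (\<lambda>\<xi>. ?\<alpha> \<xi> x x') S) (\<lambda>a x. finsum Y (\<lambda>\<xi>. ?\<beta> \<xi> a x) S) \<and>
    factor_class R Z Y (\<lambda>x x'. finsum Y (\<lambda>\<xi>. ?\<alpha> \<xi> x x') S) (\<lambda>a x. finsum Y (\<lambda>\<xi>. ?\<beta> \<xi> a x) S) \<noteq> {}"
    by (rule finsum_Ext1_factor_class[OF Xm[OF Z] exs(1) S]) (use ne \<alpha>c \<beta>c SB in blast)+
  \<comment> \<open>\<open>h\<close> exhibits the summed factor sets as a coboundary, so the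
    combination of the basis classes with coefficients \<open>c \<xi>\<close> vanishes.\<close>
  have zero_sum: "finsum (Ext1 R Z Y) (\<lambda>\<xi>. c \<xi> \<odot>\<^bsub>Ext1 R Z Y\<^esub> ext_class R Z Y \<xi>) S = \<zero>\<^bsub>Ext1 R Z Y\<^esub>"
  proof -
    have "finsum (Ext1 R Z Y) (\<lambda>\<xi>. c \<xi> \<odot>\<^bsub>Ext1 R Z Y\<^esub> ext_class R Z Y \<xi>) S =
        finsum (Ext1 R Z Y) (\<lambda>\<xi>. factor_class R Z Y (?\<alpha> \<xi>) (?\<beta> \<xi>)) S"
    proof (rule V.finsum_cong')
      show "(\<lambda>\<xi>. factor_class R Z Y (?\<alpha> \<xi>) (?\<beta> \<xi>)) \<in> S \<rightarrow> carrier (Ext1 R Z Y)"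
        using ne SB unfolding carrier_Ext1 by blast
    qed (use sm SB in auto)
    also have "\<dots> = \<zero>\<^bsub>Ext1 R Z Y\<^esub>"
      unfolding conjunct1[OF fsum]
      by (rule factor_class_coboundary[OF Xm[OF Z] exs(1) conjunct2[OF fsum], of h])
        (fact h(1) h_add h_smult)+
    finally show ?thesis .
  qed
  \<comment> \<open>The competitor of \<open>c\<close> in the uniqueness clause of
    \<open>is_basis\<close> at the zero class: its support is empty, so its sum is zero.\<close>
  define c\<^sub>0 where "c\<^sub>0 = (\<lambda>\<xi>\<in>B Z. \<zero>\<^bsub>End_ring R Z\<^esub>)"
  have "\<zero>\<^bsub>End_ring R Z\<^esub> \<in> carrier (End_ring R Z)"
    by (auto simp: End_ring_def module_hom_def Z.smult_zero_right)
  then have c0: "c\<^sub>0 \<in> (\<Pi>\<^sub>E \<xi>\<in>B Z. carrier (End_ring R Z))" by (auto simp: c\<^sub>0_def)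
  have c0S: "{\<xi> \<in> B Z. c\<^sub>0 \<xi> \<noteq> \<zero>\<^bsub>End_ring R Z\<^esub>} = {}" by (auto simp: c\<^sub>0_def)
  have "c = c\<^sub>0"
  proof -
    let ?P = "\<lambda>c. c \<in> (\<Pi>\<^sub>E \<xi>\<in>B Z. carrier (End_ring R Z)) \<and> finite {\<xi> \<in> B Z. c \<xi> \<noteq> \<zero>\<^bsub>End_ring R Z\<^esub>} \<and>
        \<zero>\<^bsub>Ext1 R Z Y\<^esub> = finsum (Ext1 R Z Y) (\<lambda>\<xi>. c \<xi> \<odot>\<^bsub>Ext1 R Z Y\<^esub> ext_class R Z Y \<xi>)
          {\<xi> \<in> B Z. c \<xi> \<noteq> \<zero>\<^bsub>End_ring R Z\<^esub>}"
    have "\<forall>v\<in>carrier (Ext1 R Z Y). \<exists>!c. c \<in> (\<Pi>\<^sub>E \<xi>\<in>B Z. carrier (End_ring R Z)) \<and>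
        finite {\<xi> \<in> B Z. c \<xi> \<noteq> \<zero>\<^bsub>End_ring R Z\<^esub>} \<and>
        v = finsum (Ext1 R Z Y) (\<lambda>\<xi>. c \<xi> \<odot>\<^bsub>Ext1 R Z Y\<^esub> ext_class R Z Y \<xi>)
          {\<xi> \<in> B Z. c \<xi> \<noteq> \<zero>\<^bsub>End_ring R Z\<^esub>}"
      using basis unfolding is_basis_def by (rule conjunct2)
    from bspec[OF this V.zero_closed] have "\<exists>!c. ?P c" .
    moreover have "?P c" using c_End S zero_sum unfolding S_def by simp
    moreover have "?P c\<^sub>0" unfolding c0S using c0 by simp
    ultimately show ?thesis by blast
  qed
  then have S_empty: "S = {}" using c0S by (simp add: S_def)
  \<comment> \<open>With \<open>S\<close> empty, the components at copies of \<open>Z\<close> vanish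
    by \<open>c_zero\<close> and the others by \<open>off\<close>. Exactness then puts the image of
    \<open>f\<close> into that of \<open>i\<close>.\<close>
  have "p (f z) = \<zero>\<^bsub>XK\<^esub>" if z: "z \<in> carrier Z" for z
  proof -
    have XKz: "p (f z) \<in> carrier XK" by (rule module_homD(1)[OF pf z])
    have "p (f z) k = \<zero>\<^bsub>fst k\<^esub>" if "k \<in> K" for k
      using that off[of "fst k" "snd k" z] c_zero[of "snd k" z] z S_empty by (cases "fst k = Z") (auto simp: K_def)
    then show ?thesis
      using XKz unfolding XK_def direct_sum_simps
      by (intro extensionalityI[of _ K]) (auto simp: PiE_iff case_prod_unfold)
  qed
  then show ?thesis using exs(8) fs(1) by blast
qed

section \<open>The direct limit\<close>

text \<open>The data behind \<open>universal_limit\<close> with the witnesses fixed. The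
  identification of \<open>M 0\<close> with a member of \<X> is kept apart, since maps into the
  limit can be studied for any starting term.\<close>

locale universal_tower =
  fixes R :: "'r ring" and \<X> :: "('r, 'a) module set" and M :: "nat \<Rightarrow> ('r, 'p) module"
    and u :: "nat \<Rightarrow> 'p \<Rightarrow> 'p" and P :: "('r, 'p) module" and c :: "nat \<Rightarrow> 'p \<Rightarrow> 'p"
  assumes semibrick: "semibrick R \<X>"
    and universal: "\<exists>B p. universal_sequence R \<X> B (M n) (u n) (M (Suc n)) p"
    and limit: "is_direct_limit R M u P c"
begin

lemma step_exact:
  "\<exists>(B :: ('r, 'a) module \<Rightarrow> ('r, 'p, 'a) extn set) p.
     short_exact R (M n) (u n) (M (Suc n)) p (direct_sum (Sigma \<X> B) (\<lambda>(X, \<xi>). X))"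
proof -
  obtain B p where "universal_sequence R \<X> B (M n) (u n) (M (Suc n)) p" using universal by blast
  then show ?thesis unfolding universal_sequence_def Let_def by blast
qed

lemma M_module: "left_module R (M n)"
  using step_exact[of n] short_exactD(1) by blast

lemma u_hom: "u n \<in> module_hom R (M n) (M (Suc n))"
  using step_exact[of n] short_exactD(4) by blast

lemma u_inj: "inj_on (u n) (carrier (M n))"
  using step_exact[of n] short_exactD(6) by blast

lemma P_module: "left_module R P"
  using limit by (simp add: is_direct_limit_def)

lemma c_hom: "c n \<in> module_hom R (M n) P"
  using limit by (simp add: is_direct_limit_def)

lemma c_u: "x \<in> carrier (M n) \<Longrightarrow> c (Suc n) (u n x) = c n x"
  using limit by (simp add: is_direct_limit_def)

lemma carrier_P: "carrier P = (\<Union>n. c n ` carrier (M n))"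
  using limit unfolding is_direct_limit_def by blast

lemma X_finitely_presented: "X \<in> \<X> \<Longrightarrow> finitely_presented R X"
  using semibrick by (simp add: semibrick_def brick_def)

lemma X_module: "X \<in> \<X> \<Longrightarrow> left_module R X"
  using X_finitely_presented by (auto simp: finitely_presented_def)

lemma tower_map_zeroD:
  assumes "x \<in> carrier (M n)" "tower_map u n k x = \<zero>\<^bsub>M (n + k)\<^esub>"
  shows "x = \<zero>\<^bsub>M n\<^esub>"
  using assms(2)
proof (induction k)
  case (Suc k)
  have cl: "tower_map u n k x \<in> carrier (M (n + k))" for k
    using assms(1) by (induction k) (auto simp: module_homD(1)[OF u_hom])
  interpret L: left_module R "M (n + k)" by (rule M_module)
  have "u (n + k) (tower_map u n k x) = u (n + k) \<zero>\<^bsub>M (n + k)\<^esub>"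
    using Suc.prems module_hom_zero_minus(1)[OF u_hom M_module M_module, of "n + k"] by simp
  then have "tower_map u n k x = \<zero>\<^bsub>M (n + k)\<^esub>"
    by (rule inj_onD[OF u_inj _ cl]) simp
  then show ?case by (rule Suc.IH)
qed simp

text \<open>If two elements have the same image, their difference vanishes at some later stage, and
  the injective transition maps kill nothing on the way there.\<close>

lemma c_inj: "inj_on (c n) (carrier (M n))"
proof (rule inj_onI)
  fix x y assume xy: "x \<in> carrier (M n)" "y \<in> carrier (M n)" "c n x = c n y"
  interpret L: left_module R "M n" by (rule M_module)
  interpret P: left_module R P by (rule P_module)
  have d: "x \<ominus>\<^bsub>M n\<^esub> y \<in> carrier (M n)" using xy by simp
  have "c n (x \<ominus>\<^bsub>M n\<^esub> y) = \<zero>\<^bsub>P\<^esub>"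
    using xy by (simp add: a_minus_def module_homD[OF c_hom] P.r_neg
        module_hom_zero_minus[OF c_hom M_module P_module])
  then obtain k where "tower_map u n k (x \<ominus>\<^bsub>M n\<^esub> y) = \<zero>\<^bsub>M (n + k)\<^esub>"
    using limit d unfolding is_direct_limit_def by blast
  then have "x \<ominus>\<^bsub>M n\<^esub> y = \<zero>\<^bsub>M n\<^esub>" by (rule tower_map_zeroD[OF d])
  then show "x = y" by (rule L.minus_zero_imp_eq[OF xy(1,2)])
qed

lemma c_range_mono:
  assumes "n \<le> m" shows "c n ` carrier (M n) \<subseteq> c m ` carrier (M m)"
  using assms
proof (induction m rule: dec_induct)
  case (step m)
  have "c m ` carrier (M m) \<subseteq> c (Suc m) ` carrier (M (Suc m))"
  proof
    fix y assume "y \<in> c m ` carrier (M m)"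
    then obtain x where x: "x \<in> carrier (M m)" "y = c m x" by blast
    show "y \<in> c (Suc m) ` carrier (M (Suc m))"
      using x c_u[OF x(1)] module_homD(1)[OF u_hom x(1)] by (metis imageI)
  qed
  then show ?case using step.IH by (rule order_trans[rotated])
qed simp

text \<open>A map from a member of \<X> into stage \<open>n + 1\<close> has its image in stage
  \<open>n\<close>, so it lifts through the injective \<open>u n\<close>. Each descent replaces the
  map, hence the induction leaves \<open>f\<close> arbitrary.\<close>

lemma hom_level_image:
  assumes Z: "Z \<in> \<X>"
  shows "f \<in> module_hom R Z (M n) \<Longrightarrow> z \<in> carrier Z \<Longrightarrow> c n (f z) \<in> c 0 ` carrier (M 0)"
proof (induction n arbitrary: f)
  case 0
  then show ?case using module_homD(1)[OF 0(1)] by blast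
next
  case (Suc n)
  obtain B p where "universal_sequence R \<X> B (M n) (u n) (M (Suc n)) p" using universal by blast
  from universal_sequence_hom_image[OF semibrick this Z Suc.prems(1)]
  have "f ` carrier Z \<subseteq> u n ` carrier (M n)" .
  from module_hom_lift_inj[OF M_module u_hom u_inj Suc.prems(1) this X_module[OF Z]]
  obtain h where h: "h \<in> module_hom R Z (M n)" "\<forall>z\<in>carrier Z. u n (h z) = f z" by blast
  have "c (Suc n) (f z) = c n (h z)"
    using h(2) Suc.prems(2) c_u[OF module_homD(1)[OF h(1) Suc.prems(2)]] by simp
  then show ?case using Suc.IH[OF h(1) Suc.prems(2)] by simp
qed

lemma hom_image:
  assumes Z: "Z \<in> \<X>" and f: "f \<in> module_hom R Z P"
  shows "f ` carrier Z \<subseteq> c 0 ` carrier (M 0)"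
proof -
  obtain G where G: "finite G" "G \<subseteq> carrier Z"
    and gen: "\<forall>N. submodule N R Z \<and> G \<subseteq> N \<longrightarrow> N = carrier Z"
    using finitely_presented_generators[OF X_finitely_presented[OF Z]] by blast
  have "\<exists>n. f ` G \<subseteq> c n ` carrier (M n)"
    using G
  proof (induction G rule: finite_induct)
    case (insert x G)
    then obtain n where n: "f ` G \<subseteq> c n ` carrier (M n)" by blast
    have "f x \<in> carrier P" using module_homD(1)[OF f] insert.prems by blast
    then obtain m where m: "f x \<in> c m ` carrier (M m)" unfolding carrier_P by blast
    have "f ` insert x G \<subseteq> c (max n m) ` carrier (M (max n m))"
      using n m c_range_mono[of n "max n m"] c_range_mono[of m "max n m"] by auto
    then show ?case ..
  qed simp
  then obtain n where n: "f ` G \<subseteq> c n ` carrier (M n)" ..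
  \<comment> \<open>The preimage of a stage is a submodule, so containing the generators makes it
    all of \<open>Z\<close>.\<close>
  have "{z \<in> carrier Z. f z \<in> c n ` carrier (M n)} = carrier Z"
  proof (rule gen[rule_format], rule conjI)
    show "submodule {z \<in> carrier Z. f z \<in> c n ` carrier (M n)} R Z"
      by (rule module_hom_preimage_submodule[OF f X_module[OF Z] P_module
            module_hom_image_submodule[OF c_hom M_module P_module]])
    show "G \<subseteq> {z \<in> carrier Z. f z \<in> c n ` carrier (M n)}" using n G(2) by blast
  qed
  then have "f ` carrier Z \<subseteq> c n ` carrier (M n)" by blast
  from module_hom_lift_inj[OF M_module c_hom c_inj f this X_module[OF Z]]
  obtain h where h: "h \<in> module_hom R Z (M n)" "\<forall>z\<in>carrier Z. c n (h z) = f z" by blast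
  show ?thesis
  proof
    fix w assume "w \<in> f ` carrier Z"
    then obtain z where "z \<in> carrier Z" "w = f z" by blast
    then show "w \<in> c 0 ` carrier (M 0)" using hom_level_image[OF Z h(1)] h(2) by metis
  qed
qed

text \<open>The first stage lies in the socle because \<open>Y\<close> itself belongs to \<X>: its
  embedding into \<open>P\<close> is one of the maps whose images are collected.\<close>

lemma soc_limit:
  assumes Y: "Y \<in> \<X>" and e: "e \<in> module_iso R Y (M 0)"
  shows "soc R \<X> P = c 0 ` carrier (M 0)"
proof
  have "submodule (c 0 ` carrier (M 0)) R P"
    by (rule module_hom_image_submodule[OF c_hom M_module P_module])
  then show "soc R \<X> P \<subseteq> c 0 ` carrier (M 0)"
    unfolding soc_def using hom_image by blast
  have "e \<in> module_hom R Y (M 0)" and im: "e ` carrier Y = carrier (M 0)"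
    using e by (auto simp: module_iso_def bij_betw_def)
  from module_hom_comp[OF this(1) c_hom]
  have hom: "(\<lambda>x. c 0 (e x)) \<in> module_hom R Y P" .
  have "(\<lambda>x. c 0 (e x)) ` carrier Y = c 0 ` carrier (M 0)"
    unfolding im[symmetric] by (rule image_image[symmetric])
  then have "c 0 ` carrier (M 0) \<subseteq> N" if "\<forall>X\<in>\<X>. \<forall>f\<in>module_hom R X P. f ` carrier X \<subseteq> N" for N
    using bspec[OF bspec[OF that Y] hom] by simp
  then show "c 0 ` carrier (M 0) \<subseteq> soc R \<X> P"
    unfolding soc_def by (intro Inter_greatest) simp
qed

text \<open>Once \<pi> vanishes on a stage, on the next one it factors through a direct sum of
  members of \<X>, and each summand contributes a map into the image of \<pi>. Asking
  \<open>homs\<close> only for maps with values in that image allows \<open>T\<close> to be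
  \<open>P\<close> itself and \<pi> a projection onto a direct summand.\<close>

lemma hom_zero_extend:
  assumes T: "left_module R T" and \<pi>: "\<pi> \<in> module_hom R P T"
    and base: "\<And>x. x \<in> carrier (M 0) \<Longrightarrow> \<pi> (c 0 x) = \<zero>\<^bsub>T\<^esub>"
    and homs: "\<And>X f x. \<lbrakk>X \<in> \<X>; f \<in> module_hom R X T; f ` carrier X \<subseteq> \<pi> ` carrier P; x \<in> carrier X\<rbrakk>
      \<Longrightarrow> f x = \<zero>\<^bsub>T\<^esub>"
    and x: "x \<in> carrier P"
  shows "\<pi> x = \<zero>\<^bsub>T\<^esub>"
proof -
  have "\<pi> (c n x) = \<zero>\<^bsub>T\<^esub>" if "x \<in> carrier (M n)" for n x
    using that
  proof (induction n arbitrary: x)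
    case 0
    then show ?case by (rule base)
  next
    case (Suc n)
    obtain B :: "('r, 'a) module \<Rightarrow> ('r, 'p, 'a) extn set" and p
      where ex: "short_exact R (M n) (u n) (M (Suc n)) p (direct_sum (Sigma \<X> B) (\<lambda>(X, \<xi>). X))"
      using step_exact by blast
    let ?XK = "direct_sum (Sigma \<X> B) (\<lambda>(X, \<xi>). X)"
    note exs = short_exactD[OF ex]
    have "\<pi> (c (Suc n) (u n y)) = \<zero>\<^bsub>T\<^esub>" if "y \<in> carrier (M n)" for y
      using Suc.IH[OF that] c_u[OF that] by simp
    from short_exact_factor[OF ex T module_hom_comp[OF c_hom \<pi>] this]
    obtain k where k: "k \<in> module_hom R ?XK T" "\<forall>b\<in>carrier (M (Suc n)). k (p b) = \<pi> (c (Suc n) b)"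
      by blast
    have Xm: "left_module R (case j of (X, \<xi>) \<Rightarrow> X)" if "j \<in> Sigma \<X> B" for j
      using that X_module by auto
    have kz: "k v = \<zero>\<^bsub>T\<^esub>" if v: "v \<in> carrier ?XK" for v
    proof (rule module_hom_direct_sum_zero[OF Xm exs(3) T k(1) _ v])
      fix j y assume j: "j \<in> Sigma \<X> B" and y: "y \<in> carrier (case j of (X, \<xi>) \<Rightarrow> X)"
      let ?s = "dsum_single (Sigma \<X> B) (\<lambda>(X, \<xi>). X) j"
      have s: "?s \<in> module_hom R (case j of (X, \<xi>) \<Rightarrow> X) ?XK"
        by (rule dsum_single_hom[OF Xm j])
      have im: "(\<lambda>y. k (?s y)) ` carrier (case j of (X, \<xi>) \<Rightarrow> X) \<subseteq> \<pi> ` carrier P"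
      proof
        fix w assume "w \<in> (\<lambda>y. k (?s y)) ` carrier (case j of (X, \<xi>) \<Rightarrow> X)"
        then obtain y' where y': "y' \<in> carrier (case j of (X, \<xi>) \<Rightarrow> X)" "w = k (?s y')" by blast
        have "?s y' \<in> p ` carrier (M (Suc n))" using module_homD(1)[OF s y'(1)] exs(7) by simp
        then obtain b where b: "b \<in> carrier (M (Suc n))" "p b = ?s y'" by force
        then have "w = \<pi> (c (Suc n) b)" using y'(2) k(2) by metis
        then show "w \<in> \<pi> ` carrier P" using module_homD(1)[OF c_hom b(1)] by blast
      qed
      show "k (?s y) = \<zero>\<^bsub>T\<^esub>"
        by (rule homs[OF _ module_hom_comp[OF s k(1)] im y]) (use j in auto)
    qed
    have "p x \<in> carrier ?XK" by (rule module_homD(1)[OF exs(5) Suc.prems])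
    then show ?case using kz k(2) Suc.prems by metis
  qed
  then show ?thesis using x unfolding carrier_P by blast
qed

end

lemma universal_limit_tower:
  assumes "semibrick R \<X>" "universal_limit R \<X> Y P \<iota>"
  shows "\<exists>M u c e. universal_tower R \<X> M u P c \<and> e \<in> module_iso R Y (M 0) \<and>
    (\<forall>y\<in>carrier Y. \<iota> y = c 0 (e y))"
  using assms unfolding universal_limit_def universal_tower_def by blast

section \<open>Direct summands and endomorphisms of bricks\<close>

text \<open>\<open>A\<close> is a subset of \<open>P\<close> without a module record of its own, so
  the projection is given as an endomorphism of \<open>P\<close>. It is well defined because two
  decompositions of an element differ by an element of both summands.\<close>

lemma direct_summand_projection:
  assumes P: "left_module R P" and A: "submodule A R P" and B: "submodule B R P"
    and AB: "A \<inter> B = {\<zero>\<^bsub>P\<^esub>}" and sum: "A <+>\<^bsub>P\<^esub> B = carrier P"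
  shows "\<exists>\<pi>\<in>module_hom R P P. \<pi> ` carrier P \<subseteq> A \<and> (\<forall>a\<in>A. \<pi> a = a) \<and> (\<forall>b\<in>B. \<pi> b = \<zero>\<^bsub>P\<^esub>)"
proof -
  interpret P: left_module R P by fact
  note As = submoduleD[OF A] and Bs = submoduleD[OF B]
  have Ac: "a \<in> A \<Longrightarrow> a \<in> carrier P" and Bc: "b \<in> B \<Longrightarrow> b \<in> carrier P" for a b
    using As(1) Bs(1) by auto
  have ex: "\<exists>a\<in>A. \<exists>b\<in>B. x = a \<oplus>\<^bsub>P\<^esub> b" if "x \<in> carrier P" for x
    using that unfolding sum[symmetric] set_add_def' by blast
  have uniq: "a = a'" if ab: "a \<in> A" "a' \<in> A" "b \<in> B" "b' \<in> B" "a \<oplus>\<^bsub>P\<^esub> b = a' \<oplus>\<^bsub>P\<^esub> b'" for a a' b b'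
  proof -
    note cl = Ac[OF ab(1)] Ac[OF ab(2)] Bc[OF ab(3)] Bc[OF ab(4)]
    have "a \<ominus>\<^bsub>P\<^esub> a' = (a \<oplus>\<^bsub>P\<^esub> b) \<oplus>\<^bsub>P\<^esub> (\<ominus>\<^bsub>P\<^esub> b \<oplus>\<^bsub>P\<^esub> \<ominus>\<^bsub>P\<^esub> a')"
      using cl by (simp add: a_minus_def P.a_assoc P.r_neg2)
    also have "\<dots> = (b' \<oplus>\<^bsub>P\<^esub> \<ominus>\<^bsub>P\<^esub> b) \<oplus>\<^bsub>P\<^esub> (a' \<oplus>\<^bsub>P\<^esub> \<ominus>\<^bsub>P\<^esub> a')"
      unfolding ab(5) using cl by (simp add: P.a_ac)
    also have "\<dots> = b' \<oplus>\<^bsub>P\<^esub> \<ominus>\<^bsub>P\<^esub> b" using cl by (simp add: P.r_neg)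
    finally have eq: "a \<ominus>\<^bsub>P\<^esub> a' = b' \<oplus>\<^bsub>P\<^esub> \<ominus>\<^bsub>P\<^esub> b" .
    have "a \<ominus>\<^bsub>P\<^esub> a' \<in> A" unfolding a_minus_def by (rule As(3)[OF ab(1) As(5)[OF ab(2)]])
    moreover have "a \<ominus>\<^bsub>P\<^esub> a' \<in> B" unfolding eq by (rule Bs(3)[OF ab(4) Bs(5)[OF ab(3)]])
    ultimately have "a \<ominus>\<^bsub>P\<^esub> a' \<in> A \<inter> B" by (rule IntI)
    then have "a \<ominus>\<^bsub>P\<^esub> a' = \<zero>\<^bsub>P\<^esub>" unfolding AB by simp
    then show ?thesis by (rule P.minus_zero_imp_eq[OF cl(1,2)])
  qed
  define \<pi> where "\<pi> x = (THE a. a \<in> A \<and> (\<exists>b\<in>B. x = a \<oplus>\<^bsub>P\<^esub> b))" for x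
  have \<pi>: "\<pi> (a \<oplus>\<^bsub>P\<^esub> b) = a" if "a \<in> A" "b \<in> B" for a b
    unfolding \<pi>_def using that uniq by (intro the_equality) blast+
  have "\<pi> \<in> module_hom R P P"
    unfolding module_hom_def
  proof (intro CollectI conjI Pi_I ballI)
    fix x assume "x \<in> carrier P"
    then obtain a b where x: "a \<in> A" "b \<in> B" "x = a \<oplus>\<^bsub>P\<^esub> b" using ex by blast
    then show "\<pi> x \<in> carrier P" by (simp add: \<pi> Ac)
    { fix y assume "y \<in> carrier P"
      then obtain a' b' where y: "a' \<in> A" "b' \<in> B" "y = a' \<oplus>\<^bsub>P\<^esub> b'" using ex by blast
      have "x \<oplus>\<^bsub>P\<^esub> y = (a \<oplus>\<^bsub>P\<^esub> a') \<oplus>\<^bsub>P\<^esub> (b \<oplus>\<^bsub>P\<^esub> b')"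
        using x y by (simp add: Ac Bc P.a_ac)
      then show "\<pi> (x \<oplus>\<^bsub>P\<^esub> y) = \<pi> x \<oplus>\<^bsub>P\<^esub> \<pi> y"
        using x y by (simp add: \<pi> As(3) Bs(3)) }
    fix r assume r: "r \<in> carrier R"
    have "r \<odot>\<^bsub>P\<^esub> x = r \<odot>\<^bsub>P\<^esub> a \<oplus>\<^bsub>P\<^esub> r \<odot>\<^bsub>P\<^esub> b"
      using x r by (simp add: Ac Bc P.smult_r_distr)
    then show "\<pi> (r \<odot>\<^bsub>P\<^esub> x) = r \<odot>\<^bsub>P\<^esub> \<pi> x"
      using x r by (simp add: \<pi> As(4) Bs(4))
  qed
  moreover have "\<pi> ` carrier P \<subseteq> A" using ex \<pi> by force
  moreover have "\<pi> a = a" if "a \<in> A" for a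
    using \<pi>[OF that Bs(2)] Ac[OF that] by simp
  moreover have "\<pi> b = \<zero>\<^bsub>P\<^esub>" if "b \<in> B" for b
    using \<pi>[OF As(2) that] Bc[OF that] by simp
  ultimately show ?thesis by blast
qed

lemma brick_endo_inj_or_zero:
  assumes br: "brick R Y" and \<phi>: "\<phi> \<in> module_hom R Y Y"
  shows "inj_on \<phi> (carrier Y) \<or> (\<forall>y\<in>carrier Y. \<phi> y = \<zero>\<^bsub>Y\<^esub>)"
proof (rule disjCI)
  assume nz: "\<not> (\<forall>y\<in>carrier Y. \<phi> y = \<zero>\<^bsub>Y\<^esub>)"
  let ?E = "End_ring R Y" and ?\<phi> = "restrict \<phi> (carrier Y)"
  interpret Y: left_module R Y using br by (simp add: brick_def finitely_presented_def)
  have "?\<phi> \<in> carrier ?E"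
    using \<phi> by (auto simp: End_ring_def module_hom_def)
  moreover have "?\<phi> \<noteq> \<zero>\<^bsub>?E\<^esub>"
    using nz by (auto simp: End_ring_def) (metis restrict_apply')
  ultimately have "?\<phi> \<in> Units ?E"
    using br by (simp add: brick_def division_ring_def)
  \<comment> \<open>A product in \<open>End_ring\<close> applies its left factor first, so this
    equation says that \<psi> undoes \<phi>, which is the side needed for injectivity.\<close>
  then obtain \<psi> where "?\<phi> \<otimes>\<^bsub>?E\<^esub> \<psi> = \<one>\<^bsub>?E\<^esub>" by (auto simp: Units_def)
  then have "compose (carrier Y) \<psi> ?\<phi> = (\<lambda>x\<in>carrier Y. x)" by (simp add: End_ring_def)
  then have inv: "\<psi> (\<phi> y) = y" if "y \<in> carrier Y" for y
    using that by (metis compose_eq restrict_apply')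
  show "inj_on \<phi> (carrier Y)" by (rule inj_on_inverseI[of _ \<psi>]) (rule inv)
qed

lemma brick_nonzero:
  assumes "brick R Y" shows "\<exists>y\<in>carrier Y. y \<noteq> \<zero>\<^bsub>Y\<^esub>"
proof (rule ccontr)
  assume "\<not> (\<exists>y\<in>carrier Y. y \<noteq> \<zero>\<^bsub>Y\<^esub>)"
  then have "\<one>\<^bsub>End_ring R Y\<^esub> = \<zero>\<^bsub>End_ring R Y\<^esub>"
    by (auto simp: End_ring_def intro!: restrict_ext)
  then show False using assms by (simp add: brick_def division_ring_def)
qed

lemma pruefer_module_indecomposable:
  fixes P :: "('r, 'p) module"
  assumes sb: "semibrick R \<X>" and "pruefer_module R \<X> P"
  shows "indecomposable R P"
proof -
  obtain Y \<iota> where Y: "Y \<in> \<X>" and ul: "universal_limit R \<X> Y P \<iota>"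
    using assms(2) by (auto simp: pruefer_module_def)
  from universal_limit_tower[OF sb ul]
  obtain M u c e where "universal_tower R \<X> M u P c" and e: "e \<in> module_iso R Y (M 0)" by blast
  then interpret universal_tower R \<X> M u P c by simp
  interpret P: left_module R P by (rule P_module)
  have br: "brick R Y" using sb Y by (simp add: semibrick_def)
  have e_hom: "e \<in> module_hom R Y (M 0)" and e_bij: "inj_on e (carrier Y)" "e ` carrier Y = carrier (M 0)"
    using e by (auto simp: module_iso_def bij_betw_def)
  define \<iota>' where "\<iota>' y = c 0 (e y)" for y
  have \<iota>_hom: "\<iota>' \<in> module_hom R Y P"
    unfolding \<iota>'_def by (rule module_hom_comp[OF e_hom c_hom])
  have \<iota>_inj: "inj_on \<iota>' (carrier Y)"
    unfolding \<iota>'_def using comp_inj_on[of e "carrier Y" "c 0"] c_inj[of 0] e_bij by (simp add: comp_def)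
  have \<iota>_im: "\<iota>' ` carrier Y = c 0 ` carrier (M 0)"
    unfolding \<iota>'_def e_bij(2)[symmetric] by (rule image_image[symmetric])
  have \<iota>_zero: "\<iota>' \<zero>\<^bsub>Y\<^esub> = \<zero>\<^bsub>P\<^esub>"
    by (rule module_hom_zero_minus(1)[OF \<iota>_hom X_module[OF Y] P_module])
  interpret Ym: left_module R Y by (rule X_module[OF Y])
  have meets: "\<exists>y\<in>carrier Y. \<iota>' y \<in> A \<and> y \<noteq> \<zero>\<^bsub>Y\<^esub>"
    if A: "submodule A R P" and B: "submodule B R P" and AB: "A \<inter> B = {\<zero>\<^bsub>P\<^esub>}"
      and sum: "A <+>\<^bsub>P\<^esub> B = carrier P" and nz: "A \<noteq> {\<zero>\<^bsub>P\<^esub>}" for A B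
  proof (rule ccontr)
    assume "\<not> (\<exists>y\<in>carrier Y. \<iota>' y \<in> A \<and> y \<noteq> \<zero>\<^bsub>Y\<^esub>)"
    then have triv: "y = \<zero>\<^bsub>Y\<^esub>" if "y \<in> carrier Y" "\<iota>' y \<in> A" for y using that by blast
    obtain \<pi> where \<pi>: "\<pi> \<in> module_hom R P P" "\<pi> ` carrier P \<subseteq> A" "\<forall>a\<in>A. \<pi> a = a"
      using direct_summand_projection[OF P_module A B AB sum] by blast
    \<comment> \<open>\<open>hom_image\<close> puts the values of \<open>f\<close> into the image of
      \<open>Y\<close>, and by choice of \<pi> they lie in \<open>A\<close>; under the contrary
      assumption these two meet only in zero.\<close>
    have homs: "f x = \<zero>\<^bsub>P\<^esub>" if "X \<in> \<X>" "f \<in> module_hom R X P" "f ` carrier X \<subseteq> \<pi> ` carrier P" "x \<in> carrier X" for X f x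
    proof -
      have "f x \<in> \<iota>' ` carrier Y" using hom_image[OF that(1,2)] that(4) unfolding \<iota>_im by blast
      then obtain y where y: "y \<in> carrier Y" "f x = \<iota>' y" by blast
      moreover have "\<iota>' y \<in> A" using that(3,4) \<pi>(2) y(2) by (metis imageI subsetD)
      ultimately show ?thesis using triv \<iota>_zero by simp
    qed
    \<comment> \<open>The restriction of \<pi> to \<open>Y\<close> is itself a map from a member of
      \<X> into the image of \<pi>, so \<open>homs\<close> applies to it.\<close>
    have base: "\<pi> (c 0 x) = \<zero>\<^bsub>P\<^esub>" if x: "x \<in> carrier (M 0)" for x
    proof -
      obtain y where y: "y \<in> carrier Y" "x = e y" using x e_bij(2) by blast
      have "(\<lambda>y. \<pi> (\<iota>' y)) ` carrier Y \<subseteq> \<pi> ` carrier P" using module_homD(1)[OF \<iota>_hom] by blast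
      from homs[OF Y module_hom_comp[OF \<iota>_hom \<pi>(1)] this y(1)] show ?thesis by (simp add: \<iota>'_def y(2))
    qed
    have zero: "\<pi> x = \<zero>\<^bsub>P\<^esub>" if "x \<in> carrier P" for x
    proof (rule hom_zero_extend[OF P_module \<pi>(1) _ _ that])
      fix X f x
      assume "X \<in> \<X>" "f \<in> module_hom R X P" "f ` carrier X \<subseteq> \<pi> ` carrier P" "x \<in> carrier X"
      then show "f x = \<zero>\<^bsub>P\<^esub>" by (rule homs)
    qed (rule base)
    have "A \<subseteq> {\<zero>\<^bsub>P\<^esub>}"
    proof
      fix a assume a: "a \<in> A"
      then have "a \<in> carrier P" using submoduleD(1)[OF A] by blast
      then show "a \<in> {\<zero>\<^bsub>P\<^esub>}" using zero[of a] \<pi>(3) a by simp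
    qed
    then show False using nz submoduleD(2)[OF A] by blast
  qed
  have main: "A = {\<zero>\<^bsub>P\<^esub>} \<or> B = {\<zero>\<^bsub>P\<^esub>}"
    if A: "submodule A R P" and B: "submodule B R P" and AB: "A \<inter> B = {\<zero>\<^bsub>P\<^esub>}"
      and sum: "A <+>\<^bsub>P\<^esub> B = carrier P" for A B
  proof (rule ccontr)
    assume "\<not> (A = {\<zero>\<^bsub>P\<^esub>} \<or> B = {\<zero>\<^bsub>P\<^esub>})"
    then have nz: "A \<noteq> {\<zero>\<^bsub>P\<^esub>}" "B \<noteq> {\<zero>\<^bsub>P\<^esub>}" by auto
    obtain a where a: "a \<in> carrier Y" "\<iota>' a \<in> A" "a \<noteq> \<zero>\<^bsub>Y\<^esub>" using meets[OF A B AB sum nz(1)] by blast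
    \<comment> \<open>\<open>meets\<close> is to be applied with the two summands exchanged, and the
      set of sums depends formally on their order.\<close>
    have "B <+>\<^bsub>P\<^esub> A = A <+>\<^bsub>P\<^esub> B"
    proof -
      have "x \<oplus>\<^bsub>P\<^esub> y = y \<oplus>\<^bsub>P\<^esub> x" if "x \<in> A" "y \<in> B" for x y
        using that submoduleD(1)[OF A] submoduleD(1)[OF B] by (intro P.a_comm) auto
      then show ?thesis unfolding set_add_def' by (auto; metis)
    qed
    then have "B <+>\<^bsub>P\<^esub> A = carrier P" using sum by simp
    moreover have "B \<inter> A = {\<zero>\<^bsub>P\<^esub>}" using AB by blast
    ultimately obtain b where b: "b \<in> carrier Y" "\<iota>' b \<in> B" "b \<noteq> \<zero>\<^bsub>Y\<^esub>"
      using meets[OF B A _ _ nz(2)] by blast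
    obtain \<pi> where \<pi>: "\<pi> \<in> module_hom R P P" "\<forall>a\<in>A. \<pi> a = a" "\<forall>b\<in>B. \<pi> b = \<zero>\<^bsub>P\<^esub>"
      using direct_summand_projection[OF P_module A B AB sum] by blast
    \<comment> \<open>Every map from \<open>Y\<close> to \<open>P\<close> lands in the image of
      \<open>Y\<close>, so the projection maps this image into itself and, \<open>\<iota>'\<close>
      being injective, induces an endomorphism of \<open>Y\<close>.\<close>
    have "(\<lambda>y. \<pi> (\<iota>' y)) ` carrier Y \<subseteq> \<iota>' ` carrier Y"
      unfolding \<iota>_im by (rule hom_image[OF Y module_hom_comp[OF \<iota>_hom \<pi>(1)]])
    from module_hom_lift_inj[OF X_module[OF Y] \<iota>_hom \<iota>_inj module_hom_comp[OF \<iota>_hom \<pi>(1)] this X_module[OF Y]]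
    obtain \<phi> where \<phi>: "\<phi> \<in> module_hom R Y Y" "\<forall>y\<in>carrier Y. \<iota>' (\<phi> y) = \<pi> (\<iota>' y)" by blast
    have "\<iota>' (\<phi> b) = \<iota>' \<zero>\<^bsub>Y\<^esub>" using \<phi>(2) b \<pi>(3) \<iota>_zero by simp
    then have \<phi>b: "\<phi> b = \<zero>\<^bsub>Y\<^esub>"
      by (rule inj_onD[OF \<iota>_inj _ module_homD(1)[OF \<phi>(1) b(1)]]) simp
    have "\<iota>' (\<phi> a) = \<iota>' a" using \<phi>(2) a \<pi>(2) by simp
    then have \<phi>a: "\<phi> a = a"
      by (rule inj_onD[OF \<iota>_inj _ module_homD(1)[OF \<phi>(1) a(1)] a(1)])
    have "\<phi> b = \<phi> \<zero>\<^bsub>Y\<^esub>"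
      using \<phi>b module_hom_zero_minus(1)[OF \<phi>(1) X_module[OF Y] X_module[OF Y]] by simp
    then have "\<not> inj_on \<phi> (carrier Y)" using b inj_onD[of \<phi> "carrier Y" b "\<zero>\<^bsub>Y\<^esub>"] by auto
    then show False using brick_endo_inj_or_zero[OF br \<phi>(1)] a \<phi>a by auto
  qed
  obtain y where y: "y \<in> carrier Y" "y \<noteq> \<zero>\<^bsub>Y\<^esub>" using brick_nonzero[OF br] by blast
  have "\<iota>' y \<noteq> \<zero>\<^bsub>P\<^esub>"
    using inj_onD[OF \<iota>_inj, of y "\<zero>\<^bsub>Y\<^esub>"] y \<iota>_zero by auto
  then have "carrier P \<noteq> {\<zero>\<^bsub>P\<^esub>}" using module_homD(1)[OF \<iota>_hom y(1)] by blast
  then show ?thesis unfolding indecomposable_def using main by blast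
qed

theorem lemma6p2:
  fixes R :: "'r ring" and \<X> :: "('r, 'a) module set"
  assumes "ring R"
    and "semibrick R \<X>"
    and "\<forall>X\<in>\<X>. proj_dim_le_one R X"
    and "\<forall>X\<in>\<X>. \<not> divisible R \<X> X"
  shows "(\<forall>Y\<in>\<X>. \<forall>(P :: ('r, 'p) module) \<iota>.
            universal_limit R \<X> Y P \<iota> \<longrightarrow> soc R \<X> P = \<iota> ` carrier Y) \<and>
         (\<forall>P :: ('r, 'p) module. pruefer_module R \<X> P \<longrightarrow> indecomposable R P)"
proof (intro conjI ballI allI impI)
  fix Y and P :: "('r, 'p) module" and \<iota>
  assume Y: "Y \<in> \<X>" and ul: "universal_limit R \<X> Y P \<iota>"
  from universal_limit_tower[OF assms(2) ul] obtain M u c e where t: "universal_tower R \<X> M u P c"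
    and e: "e \<in> module_iso R Y (M 0)" and \<iota>: "\<forall>y\<in>carrier Y. \<iota> y = c 0 (e y)" by blast
  \<comment> \<open>\<open>universal_limit\<close> prescribes \<iota> only on
    \<open>carrier Y\<close>, which determines the image.\<close>
  have "\<iota> ` carrier Y = c 0 ` e ` carrier Y"
    unfolding image_image using \<iota> by (intro image_cong) auto
  also have "\<dots> = c 0 ` carrier (M 0)" using e by (auto simp: module_iso_def bij_betw_def)
  finally show "soc R \<X> P = \<iota> ` carrier Y"
    using universal_tower.soc_limit[OF t Y e] by simp
qed (rule pruefer_module_indecomposable[OF assms(2)])

end
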